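(* Let $n\ge2$ and let $\mathcal{E}=\mathcal{G}\times_{Z(\mathcal{G})}\mathcal{H}\mathcal{R}/\mathcal{H}$ act on $\mathcal{X}=\mathcal{G}/\mathcal{H}=\widetilde{\mathrm{Sp}(2n,\mathbb{R})}/\mathrm{SU}(n)$ by $(g,r\mathcal{H})\cdot x\mathcal{H}=gxr\mathcal{H}$. The stabilizer $\mathrm{Stab}(\mathcal{H})$ of the base coset $\mathcal{H}\in\mathcal{X}$ is a maximal compact subgroup of $\mathcal{E}$.
   Context: $\mathrm{Sp}(2n,\mathbb{R})=\{M\in M_{2n}(\mathbb{R}): M^T\Omega M=\Omega\}$, $\Omega=\begin{pmatrix} 0 & I_n \\ -I_n & 0 \end{pmatrix}$. $\mathrm{U}(n)$ is embedded in $\mathrm{Sp}(2n,\mathbb{R})$ by $A+iB\mapsto\begin{pmatrix} A & -B \\ B & A \end{pmatrix}$ ($A,B$ real). Let $\pi:\widetilde{\mathrm{Sp}(2n,\mathbb{R})}\to\mathrm{Sp}(2n,\mathbb{R})$ be the universal covering and $\widetilde{\mathrm{U}(n)}=\pi^{-1}(\mathrm{U}(n))$. Put $\mathcal{G}=\widetilde{\mathrm{Sp}(2n,\mathbb{R})}$; $\mathcal{H}=\mathrm{SU}(n)\subset\mathcal{G}$, the identity component of $\pi^{-1}(\mathrm{SU}(n))$; $\mathcal{R}\cong\mathbb{R}$, the identity component of $\pi^{-1}(\{e^{ia}\mathrm{id}:a\in\mathbb{R}\})$. Then $\mathcal{H}\mathcal{R}=\widetilde{\mathrm{U}(n)}$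 is a direct product and contains the center $Z(\mathcal{G})=\pi^{-1}(\{\pm\mathrm{id}\})$. Let $i:Z(\mathcal{G})\to\mathcal{G}$ be the inclusion and $\iota:Z(\mathcal{G})\to\mathcal{H}\mathcal{R}/\mathcal{H}\cong\mathbb{R}$ the restriction of the quotient map $\mathcal{H}\mathcal{R}\to\mathcal{H}\mathcal{R}/\mathcal{H}$. Elements of $\mathcal{H}\mathcal{R}/\mathcal{H}$ are written $r\mathcal{H}$, $r\in\mathcal{R}$. Define $$\mathcal{E}=\mathcal{G}\times_{Z(\mathcal{G})}\mathcal{H}\mathcal{R}/\mathcal{H}:=\frac{\mathcal{G}\times\mathcal{H}\mathcal{R}/\mathcal{H}}{\{(i(z),\iota(z)^{-1}):z\in Z(\mathcal{G})\}}.$$ *)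

theory Defs
  imports "HOL-Analysis.Analysis" "HOL-Algebra.Group_Action" "HOL-Algebra.Left_Coset"
begin

section \<open>The symplectic group and the embedded unitary matrices\<close>

text \<open>Matrices of size \<open>2n\<close> are indexed by \<open>'n + 'n\<close> with \<open>n = CARD('n)\<close>;
  \<open>block_mat A B C D\<close> has rows \<open>(A, B)\<close> and \<open>(C, D)\<close>.\<close>

definition block_mat ::
  "'a^'n^'n \<Rightarrow> 'a^'n^'n \<Rightarrow> 'a^'n^'n \<Rightarrow> 'a^'n^'n \<Rightarrow> 'a^('n + 'n)^('n + 'n)" where
  "block_mat A B C D = (\<chi> i j.
     case i of
       Inl a \<Rightarrow> (case j of Inl b \<Rightarrow> A $ a $ b | Inr b \<Rightarrow> B $ a $ b)
     | Inr a \<Rightarrow> (case j of Inl b \<Rightarrow> C $ a $ b | Inr b \<Rightarrow> D $ a $ b))"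

definition Omega :: "real^('n::finite + 'n)^('n + 'n)" where
  "Omega = block_mat 0 (mat 1) (- mat 1) 0"

definition Sp :: "(real^('n::finite + 'n)^('n + 'n)) set" where
  "Sp = {M. transpose M ** Omega ** M = Omega}"

definition Sp_group :: "(real^('n::finite + 'n)^('n + 'n)) monoid" where
  "Sp_group = \<lparr>carrier = Sp, mult = (**), one = mat 1\<rparr>"

definition conj_transpose :: "complex^'n^'n \<Rightarrow> complex^'n^'n" where
  "conj_transpose A = (\<chi> i j. cnj (A $ j $ i))"

definition unitary_matrices :: "(complex^'n::finite^'n) set" where
  "unitary_matrices = {A. conj_transpose A ** A = mat 1 \<and> A ** conj_transpose A = mat 1}"

definition special_unitary_matrices :: "(complex^'n::finite^'n) set" where
  "special_unitary_matrices = {A \<in> unitary_matrices. det A = 1}"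

definition unitary_embed :: "complex^'n^'n \<Rightarrow> real^('n::finite + 'n)^('n + 'n)" where
  "unitary_embed M =
     (let A = (\<chi> i j. Re (M $ i $ j)); B = (\<chi> i j. Im (M $ i $ j))
      in block_mat A (- B) B A)"

section \<open>Topological groups\<close>

text \<open>The carrier of \<open>G\<close> has the subspace topology of its type.\<close>

definition topological_group :: "'g::topological_space monoid \<Rightarrow> bool" where
  "topological_group G \<longleftrightarrow>
     group G \<and>
     continuous_on (carrier G \<times> carrier G) (\<lambda>(x, y). x \<otimes>\<^bsub>G\<^esub> y) \<and>
     continuous_on (carrier G) (\<lambda>x. inv\<^bsub>G\<^esub> x)"

text \<open>In the library \<open>simply_connected\<close> includes path-connectedness. Since the universal covering
  is unique up to isomorphism, it is characterised here rather than constructed.\<close>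

definition universal_covering_of_Sp ::
  "'g::topological_space monoid \<Rightarrow> ('g \<Rightarrow> real^('n::finite + 'n)^('n + 'n)) \<Rightarrow> bool" where
  "universal_covering_of_Sp G p \<longleftrightarrow>
     topological_group G \<and>
     p \<in> hom G Sp_group \<and>
     covering_space (carrier G) p Sp \<and>
     simply_connected (carrier G)"

definition group_center :: "('g, 'm) monoid_scheme \<Rightarrow> 'g set" where
  "group_center G = {z \<in> carrier G. \<forall>g \<in> carrier G. z \<otimes>\<^bsub>G\<^esub> g = g \<otimes>\<^bsub>G\<^esub> z}"

definition quotient_topology :: "'a topology \<Rightarrow> ('a \<Rightarrow> 'b) \<Rightarrow> 'b topology" where
  "quotient_topology X q =
     topology (\<lambda>U. U \<subseteq> q ` topspace X \<and> openin X {x \<in> topspace X. q x \<in> U})"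

lemma openin_quotient_topology:
  "openin (quotient_topology X q) U \<longleftrightarrow>
     U \<subseteq> q ` topspace X \<and> openin X {x \<in> topspace X. q x \<in> U}"
proof -
  have "istopology (\<lambda>U. U \<subseteq> q ` topspace X \<and> openin X {x \<in> topspace X. q x \<in> U})"
    unfolding istopology_def
  proof (intro conjI allI impI; (elim conjE)?)
    fix S T
    assume "openin X {x \<in> topspace X. q x \<in> S}" "openin X {x \<in> topspace X. q x \<in> T}"
    then have "openin X ({x \<in> topspace X. q x \<in> S} \<inter> {x \<in> topspace X. q x \<in> T})" by blast
    then show "openin X {x \<in> topspace X. q x \<in> S \<inter> T}"
      by (rule back_subst[of "openin X"]) blast
  next
    fix K
    assume "\<forall>U\<in>K. U \<subseteq> q ` topspace X \<and> openin X {x \<in> topspace X. q x \<in> U}"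
    then have "openin X (\<Union>U\<in>K. {x \<in> topspace X. q x \<in> U})" by blast
    then show "openin X {x \<in> topspace X. q x \<in> \<Union>K}"
      by (rule back_subst[of "openin X"]) blast
  qed blast+
  then show ?thesis
    unfolding quotient_topology_def by (simp add: topology_inverse')
qed

lemma topspace_quotient_topology: "topspace (quotient_topology X q) = q ` topspace X"
proof -
  have "{x \<in> topspace X. q x \<in> q ` topspace X} = topspace X" by blast
  then have "openin (quotient_topology X q) (q ` topspace X)"
    by (simp add: openin_quotient_topology)
  then show ?thesis
    by (meson openin_quotient_topology openin_subset openin_topspace subset_antisym)
qed

lemma quotient_map_quotient_topology: "quotient_map X (quotient_topology X q) q"
  by (auto simp: quotient_map_def topspace_quotient_topology openin_quotient_topology)

definition compact_subgroup :: "('a, 'm) monoid_scheme \<Rightarrow> 'a topology \<Rightarrow> 'a set \<Rightarrow> bool" where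
  "compact_subgroup G T K \<longleftrightarrow> subgroup K G \<and> compactin T K"

definition maximal_compact_subgroup ::
  "('a, 'm) monoid_scheme \<Rightarrow> 'a topology \<Rightarrow> 'a set \<Rightarrow> bool" where
  "maximal_compact_subgroup G T K \<longleftrightarrow>
     compact_subgroup G T K \<and> (\<forall>L. compact_subgroup G T L \<and> K \<subseteq> L \<longrightarrow> L = K)"

section \<open>The subgroups \<open>\<H>\<close> and \<open>\<R>\<close>, the group \<open>\<E>\<close> and its action\<close>

definition grpH ::
  "'g::topological_space monoid \<Rightarrow> ('g \<Rightarrow> real^('n::finite + 'n)^('n + 'n)) \<Rightarrow> 'g set" where
  "grpH G p = connected_component_set
     {g \<in> carrier G. p g \<in> unitary_embed ` special_unitary_matrices} \<one>\<^bsub>G\<^esub>"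

definition grpR ::
  "'g::topological_space monoid \<Rightarrow> ('g \<Rightarrow> real^('n::finite + 'n)^('n + 'n)) \<Rightarrow> 'g set" where
  "grpR G p = connected_component_set
     {g \<in> carrier G. p g \<in> {unitary_embed (mat (cis a)) | a. True}} \<one>\<^bsub>G\<^esub>"

definition grpHR ::
  "'g::topological_space monoid \<Rightarrow> ('g \<Rightarrow> real^('n::finite + 'n)^('n + 'n)) \<Rightarrow> 'g monoid" where
  "grpHR G p = G\<lparr>carrier := grpH G p <#>\<^bsub>G\<^esub> grpR G p\<rparr>"

text \<open>Left cosets are used, to match the notation \<open>r\<H>\<close>; \<open>\<H>\<close> is normal in \<open>\<H>\<R>\<close>.\<close>

definition HR_mod_H ::
  "'g::topological_space monoid \<Rightarrow> ('g \<Rightarrow> real^('n::finite + 'n)^('n + 'n)) \<Rightarrow> 'g set monoid" where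
  "HR_mod_H G p = grpHR G p LMod grpH G p"

definition HR_mod_H_topology ::
  "'g::topological_space monoid \<Rightarrow> ('g \<Rightarrow> real^('n::finite + 'n)^('n + 'n)) \<Rightarrow> 'g set topology" where
  "HR_mod_H_topology G p =
     quotient_topology (top_of_set (carrier (grpHR G p))) (\<lambda>x. x <#\<^bsub>G\<^esub> grpH G p)"

definition antidiag_center ::
  "'g::topological_space monoid \<Rightarrow> ('g \<Rightarrow> real^('n::finite + 'n)^('n + 'n)) \<Rightarrow> ('g \<times> 'g set) set" where
  "antidiag_center G p =
     {(z, inv\<^bsub>HR_mod_H G p\<^esub> (z <#\<^bsub>G\<^esub> grpH G p)) | z. z \<in> group_center G}"

definition grpE ::
  "'g::topological_space monoid \<Rightarrow> ('g \<Rightarrow> real^('n::finite + 'n)^('n + 'n))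
     \<Rightarrow> ('g \<times> 'g set) set monoid" where
  "grpE G p = (G \<times>\<times> HR_mod_H G p) Mod antidiag_center G p"

definition classE ::
  "'g::topological_space monoid \<Rightarrow> ('g \<Rightarrow> real^('n::finite + 'n)^('n + 'n))
     \<Rightarrow> 'g \<times> 'g set \<Rightarrow> ('g \<times> 'g set) set" where
  "classE G p y = antidiag_center G p #>\<^bsub>G \<times>\<times> HR_mod_H G p\<^esub> y"

definition grpE_topology ::
  "'g::topological_space monoid \<Rightarrow> ('g \<Rightarrow> real^('n::finite + 'n)^('n + 'n))
     \<Rightarrow> ('g \<times> 'g set) set topology" where
  "grpE_topology G p =
     quotient_topology (prod_topology (top_of_set (carrier G)) (HR_mod_H_topology G p)) (classE G p)"

definition spaceX ::
  "'g::topological_space monoid \<Rightarrow> ('g \<Rightarrow> real^('n::finite + 'n)^('n + 'n)) \<Rightarrow> 'g set set" where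
  "spaceX G p = lcosets\<^bsub>G\<^esub> (grpH G p)"

text \<open>The value \<open>(g, r\<H>) \<cdot> x\<H> = gxr\<H>\<close> is picked by \<open>THE\<close>; that it does not depend on the
  representatives is part of the theorem. The restriction to \<open>spaceX\<close> is what \<open>group_action\<close> needs.\<close>

definition actE ::
  "'g::topological_space monoid \<Rightarrow> ('g \<Rightarrow> real^('n::finite + 'n)^('n + 'n))
     \<Rightarrow> ('g \<times> 'g set) set \<Rightarrow> 'g set \<Rightarrow> 'g set" where
  "actE G p e = (\<lambda>c \<in> spaceX G p. THE d.
     \<exists>g \<in> carrier G. \<exists>r \<in> grpR G p. \<exists>x \<in> carrier G.
       e = classE G p (g, r <#\<^bsub>G\<^esub> grpH G p) \<and>
       c = x <#\<^bsub>G\<^esub> grpH G p \<and>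
       d = (g \<otimes>\<^bsub>G\<^esub> x \<otimes>\<^bsub>G\<^esub> r) <#\<^bsub>G\<^esub> grpH G p)"

end

theory Submission
  imports Defs
begin

text \<open>Polar decomposition deforms \<open>Sp(2n, \<real>)\<close> onto \<open>U(n)\<close>, and the determinant of the unitary
  factor lifts to a continuous angle on the simply connected group \<open>\<G>\<close>. Paths of unitary matrices
  can be divided by lifted sections over the spheres \<open>U(k) / U(k - 1)\<close> until they lie in \<open>U(1)\<close>, so
  an element of the kernel of the covering with angle \<open>0\<close> is trivial. Hence \<open>\<H>\<close> is compact,
  \<open>\<R>\<close> is a line on which the angle is proportional to the parameter, and \<open>\<H>\<R>\<close> is the
  whole preimage of \<open>U(n)\<close>. The stabilizer consists of the classes of \<open>(h r\<^sup>-\<^sup>1, r\<H>)\<close>; it is compact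
  because the centre is cocompact in \<open>\<R>\<close>. For a larger compact subgroup, boundedness of the matrix
  norm of the \<open>\<G>\<close>-component forces that component into \<open>\<H>\<R>\<close> (a bounded subgroup of
  \<open>Sp(2n, \<real>)\<close> containing \<open>U(n)\<close> is \<open>U(n)\<close>), and boundedness of the total angle, which is additive
  there, forces the total angle to vanish.\<close>

section \<open>Matrices\<close>

text \<open>The covering is known only through its axioms, so the relevant part of the fundamental
  group of Sp(2n, R) has to be extracted by hand. The pivot is \<open>kernel_angle\<close>. Without
  it the component over SU(n) could be an infinite covering and hence non-compact. The obstacle that
  shapes the maximality argument is that \<open>angle\<close> is not a homomorphism on the whole
  group: \<open>circle_part\<close> lets only a unitary left factor be pulled out, so
  \<open>angle_mult\<close> asks for \<open>p k\<close> to be unitary. A norm argument must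
  therefore come before the angle argument. The factor 1 / n in \<open>level\<close> comes from det
  (e^{ia} id) = e^{ina}. With it \<open>rot a\<close> has level a, the quotient of HR by H becomes
  the real line, and passing to another representative of a class in E moves \<open>level z\<close>
  from one coordinate to the other. Hence \<open>level g + a\<close> is well defined on E. The
  stabilizer consists of the classes over U(n) where this number vanishes.\<close>

lemma continuous_on_matrix_mult [continuous_intros]:
  fixes A :: "'a::topological_space \<Rightarrow> 'b::real_normed_field^'n^'m"
  assumes "continuous_on S A" "continuous_on S B"
  shows "continuous_on S (\<lambda>x. A x ** B x)"
  unfolding matrix_matrix_mult_def by (intro continuous_intros assms)

lemma continuous_on_matrix_vector_mult [continuous_intros]:
  fixes A :: "'a::topological_space \<Rightarrow> 'b::real_normed_field^'n^'m"
  assumes "continuous_on S A" "continuous_on S B"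
  shows "continuous_on S (\<lambda>x. A x *v B x)"
  unfolding matrix_vector_mult_def by (intro continuous_intros assms)

lemma continuous_on_transpose [continuous_intros]:
  fixes A :: "'a::topological_space \<Rightarrow> 'b::real_normed_field^'n^'m"
  assumes "continuous_on S A"
  shows "continuous_on S (\<lambda>x. transpose (A x))"
  unfolding transpose_def by (intro continuous_intros assms)

lemma continuous_on_det [continuous_intros]:
  fixes A :: "'a::topological_space \<Rightarrow> 'b::real_normed_field^'n^'n"
  assumes "continuous_on S A"
  shows "continuous_on S (\<lambda>x. det (A x))"
  unfolding det_def by (intro continuous_intros assms)

text \<open>The condition does not depend on the point, so this rule reaches matrices whose entries
  are chosen by a case distinction on indices.\<close>

lemma continuous_on_if_const [continuous_intros]:
  "(P \<Longrightarrow> continuous_on S f) \<Longrightarrow> (\<not> P \<Longrightarrow> continuous_on S g) \<Longrightarrow>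
    continuous_on S (\<lambda>x. if P then f x else g x)"
  by (cases P) auto

lemma matrix_vector_mult_axis:
  fixes A :: "'a::semiring_1^'n^'m"
  shows "A *v axis j 1 = column j A"
  by (simp add: vec_eq_iff column_def matrix_vector_mult_def axis_def if_distrib cong: if_cong)

lemma matrix_inv_inverse:
  fixes A :: "'a::field^'n^'n"
  assumes "invertible A"
  shows matrix_inv_right: "A ** matrix_inv A = mat 1"
    and matrix_inv_left: "matrix_inv A ** A = mat 1"
proof -
  have "A ** matrix_inv A = mat 1 \<and> matrix_inv A ** A = mat 1"
    using assms unfolding matrix_inv_def invertible_def by (rule someI_ex)
  then show "A ** matrix_inv A = mat 1" "matrix_inv A ** A = mat 1" by auto
qed

lemma matrix_inv_eqI:
  fixes A :: "'a::field^'n^'n"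
  assumes "A ** B = mat 1"
  shows "matrix_inv A = B"
proof -
  have "invertible A" using assms invertible_right_inverse by blast
  then have "matrix_inv A = matrix_inv A ** (A ** B)" "matrix_inv A ** A = mat 1"
    by (simp_all add: assms matrix_inv_left)
  then show ?thesis by (simp add: matrix_mul_assoc)
qed

lemma matrix_inv_mat_1 [simp]: "matrix_inv (mat 1 :: 'a::field^'n^'n) = mat 1"
  by (rule matrix_inv_eqI) simp

text \<open>Cramer's rule, applied to the columns of the inverse. The purpose is continuity: every
  entry becomes a quotient of determinants.\<close>

lemma matrix_inv_cramer:
  fixes A :: "'a::field^'n^'n"
  assumes "det A \<noteq> 0"
  shows "matrix_inv A = (\<chi> k j. det (\<chi> i l. if l = k then axis j 1 $ i else A $ i $ l) / det A)"
proof -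
  have inv: "invertible A" using assms invertible_det_nz by blast
  have "column j (matrix_inv A) = (\<chi> k. det (\<chi> i l. if l = k then axis j 1 $ i else A $ i $ l) / det A)" for j
  proof -
    have "column j (matrix_inv A) = matrix_inv A *v axis j 1"
      by (simp add: matrix_vector_mult_axis)
    then have "A *v column j (matrix_inv A) = axis j 1"
      by (simp only: matrix_vector_mul_assoc matrix_inv_right[OF inv] matrix_vector_mul_lid)
    then show ?thesis by (simp add: cramer[OF assms])
  qed
  then show ?thesis by (simp add: vec_eq_iff column_def)
qed

lemma continuous_on_matrix_inv [continuous_intros]:
  fixes A :: "'a::topological_space \<Rightarrow> 'b::real_normed_field^'n^'n"
  assumes "continuous_on S A" "\<And>x. x \<in> S \<Longrightarrow> det (A x) \<noteq> 0"
  shows "continuous_on S (\<lambda>x. matrix_inv (A x))"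
proof -
  have "continuous_on S (\<lambda>x. \<chi> k j. det (\<chi> i l. if l = k then axis j 1 $ i else A x $ i $ l) / det (A x))"
    using assms by (intro continuous_intros) auto
  then show ?thesis
    by (rule continuous_on_eq) (rule matrix_inv_cramer[OF assms(2), symmetric])
qed

lemma matrix_diff_ldistrib:
  fixes A :: "'a::ring_1^'n^'m" shows "A ** (B - C) = A ** B - A ** C"
  by (vector matrix_matrix_mult_def sum_subtractf algebra_simps)

lemma matrix_diff_rdistrib:
  fixes A :: "'a::ring_1^'n^'m" shows "(A - B) ** C = A ** C - B ** C"
  by (vector matrix_matrix_mult_def sum_subtractf algebra_simps)

lemma matrix_add_rdistrib:
  fixes A :: "'a::semiring_1^'n^'m" shows "(A + B) ** C = A ** C + B ** C"
  by (vector matrix_matrix_mult_def sum.distrib algebra_simps)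

lemma matrix_minus_mult:
  fixes A :: "'a::ring_1^'n^'m" shows "(- A) ** B = - (A ** B)" "A ** (- C) = - (A ** C)"
  by (vector matrix_matrix_mult_def sum_negf)+

lemma matrix_scaleR_mult:
  fixes A :: "real^'n^'m" shows "(c *\<^sub>R A) ** B = c *\<^sub>R (A ** B)" "A ** (c *\<^sub>R C) = c *\<^sub>R (A ** C)"
  by (vector matrix_matrix_mult_def sum_distrib_left mult_ac)+

lemma transpose_linear:
  fixes A :: "real^'n^'m"
  shows transpose_add: "transpose (A + B) = transpose A + transpose B"
    and transpose_minus: "transpose (- A) = - transpose A"
    and transpose_diff: "transpose (A - B) = transpose A - transpose B"
    and transpose_scaleR: "transpose (c *\<^sub>R A) = c *\<^sub>R transpose A"
  by (simp_all add: transpose_def vec_eq_iff)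

lemmas matrix_algebra = matrix_add_ldistrib matrix_add_rdistrib matrix_diff_ldistrib
  matrix_diff_rdistrib matrix_minus_mult matrix_scaleR_mult

lemma inner_transpose:
  fixes A :: "real^'n^'m" shows "x \<bullet> (A *v y) = (transpose A *v x) \<bullet> y"
  by (simp add: dot_lmul_matrix)

lemma norm_eq_transpose_mult:
  fixes A :: "real^'n^'m" shows "(norm (A *v x))\<^sup>2 = x \<bullet> ((transpose A ** A) *v x)"
proof -
  have "(norm (A *v x))\<^sup>2 = (A *v x) \<bullet> (A *v x)" by (simp add: power2_norm_eq_inner)
  also have "\<dots> = (transpose A *v (A *v x)) \<bullet> x" by (rule inner_transpose)
  also have "\<dots> = x \<bullet> ((transpose A ** A) *v x)"
    by (simp only: matrix_vector_mul_assoc inner_commute)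
  finally show ?thesis .
qed

text \<open>The matrix norm is the Frobenius norm, so it can be computed column by column, and an
  orthogonal factor on the left preserves the length of each column.\<close>

lemma norm_orthogonal_mult:
  fixes A :: "real^'m^'m"
  assumes "transpose A ** A = mat 1"
  shows "norm (A ** B) = norm (B :: real^'m^'m)"
proof -
  have "norm X = sqrt (\<Sum>j\<in>UNIV. (norm (column j X))\<^sup>2)" for X :: "real^'m^'m"
  proof -
    have "norm X = sqrt (\<Sum>i\<in>UNIV. (norm (X $ i))\<^sup>2)"
      by (simp add: norm_vec_def L2_set_def)
    also have "(\<Sum>i\<in>UNIV. (norm (X $ i))\<^sup>2) = (\<Sum>i\<in>UNIV. \<Sum>j\<in>UNIV. (X $ i $ j)\<^sup>2)"
      by (simp add: norm_vec_def L2_set_def sum_nonneg)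
    also have "\<dots> = (\<Sum>j\<in>UNIV. \<Sum>i\<in>UNIV. (X $ i $ j)\<^sup>2)" by (rule sum.swap)
    also have "\<dots> = (\<Sum>j\<in>UNIV. (norm (column j X))\<^sup>2)"
      by (simp add: norm_vec_def L2_set_def sum_nonneg column_def)
    finally show ?thesis .
  qed
  moreover have "norm (column j (A ** B)) = norm (column j B)" for j
  proof -
    have "column j (A ** B) = A *v column j B"
      by (simp add: column_def matrix_matrix_mult_def matrix_vector_mult_def vec_eq_iff)
    moreover have "(norm (A *v column j B))\<^sup>2 = column j B \<bullet> column j B"
      by (simp only: norm_eq_transpose_mult assms matrix_vector_mul_lid)
    ultimately show ?thesis by (simp add: norm_eq_sqrt_inner power2_norm_eq_inner)
  qed
  ultimately show ?thesis by simp
qed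

section \<open>The symplectic group\<close>

lemma sum_UNIV_sum:
  fixes f :: "'a::finite + 'b::finite \<Rightarrow> 'c::comm_monoid_add"
  shows "sum f UNIV = (\<Sum>i\<in>UNIV. f (Inl i)) + (\<Sum>i\<in>UNIV. f (Inr i))"
proof -
  have "sum f (UNIV <+> UNIV) = (\<Sum>i\<in>UNIV. f (Inl i)) + (\<Sum>i\<in>UNIV. f (Inr i))"
    by (subst sum.Plus) auto
  then show ?thesis by simp
qed

lemma block_mat_nth:
  "block_mat A B C D $ Inl i $ Inl j = A $ i $ j" "block_mat A B C D $ Inl i $ Inr j = B $ i $ j"
  "block_mat A B C D $ Inr i $ Inl j = C $ i $ j" "block_mat A B C D $ Inr i $ Inr j = D $ i $ j"
  by (simp_all add: block_mat_def)

lemma matrix_sum_eqI: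
  fixes X Y :: "'a^('n::finite + 'n)^('n + 'n)"
  assumes "\<And>i j. X $ Inl i $ Inl j = Y $ Inl i $ Inl j" "\<And>i j. X $ Inl i $ Inr j = Y $ Inl i $ Inr j"
    "\<And>i j. X $ Inr i $ Inl j = Y $ Inr i $ Inl j" "\<And>i j. X $ Inr i $ Inr j = Y $ Inr i $ Inr j"
  shows "X = Y"
proof -
  have "X $ i $ j = Y $ i $ j" for i j by (cases i; cases j) (auto simp: assms)
  then show ?thesis by (simp add: vec_eq_iff)
qed

lemma block_mat_mult:
  fixes A :: "'a::semiring_1^'n^'n"
  shows "block_mat A B C D ** block_mat A' B' C' D' =
    block_mat (A ** A' + B ** C') (A ** B' + B ** D') (C ** A' + D ** C') (C ** B' + D ** D')"
  by (rule matrix_sum_eqI) (simp_all add: block_mat_nth matrix_matrix_mult_def sum_UNIV_sum)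

lemma transpose_block_mat:
  "transpose (block_mat A B C D) = block_mat (transpose A) (transpose C) (transpose B) (transpose D)"
  by (rule matrix_sum_eqI) (simp_all add: block_mat_nth transpose_def)

lemma block_mat_minus: "- block_mat A B C D = block_mat (- A) (- B) (- C) (- D :: 'a::ring_1^'n^'n)"
  by (rule matrix_sum_eqI) (simp_all add: block_mat_nth)

lemma block_mat_one: "block_mat (mat 1) 0 0 (mat 1) = (mat 1 :: 'a::semiring_1^('n::finite + 'n)^('n + 'n))"
  by (rule matrix_sum_eqI) (simp_all add: block_mat_nth mat_def)

lemma block_mat_eq_iff:
  "block_mat A B C D = block_mat A' B' C' D' \<longleftrightarrow> A = A' \<and> B = B' \<and> C = C' \<and> D = D'"
  by (metis (no_types, lifting) block_mat_nth vec_eq_iff)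

lemma block_mat_exhaust:
  fixes X :: "'a^('n::finite + 'n)^('n + 'n)"
  obtains A B C D where "X = block_mat A B C D"
proof
  show "X = block_mat (\<chi> i j. X $ Inl i $ Inl j) (\<chi> i j. X $ Inl i $ Inr j)
    (\<chi> i j. X $ Inr i $ Inl j) (\<chi> i j. X $ Inr i $ Inr j)"
    by (rule matrix_sum_eqI) (simp_all add: block_mat_nth)
qed

lemma transpose_mat_1_minus: "transpose (- mat 1 :: 'a::ring_1^'n^'n) = - mat 1"
  by (simp add: transpose_def vec_eq_iff mat_def)

lemma transpose_zero [simp]: "transpose (0 :: 'a::zero^'n^'m) = 0"
  by (simp add: transpose_def vec_eq_iff)

lemma matrix_mult_zero [simp]:
  fixes A :: "'a::semiring_1^'n^'m" shows "A ** 0 = 0" "0 ** A = 0"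
  by (simp_all add: matrix_matrix_mult_def vec_eq_iff)

lemma Omega_squared: "Omega ** Omega = - (mat 1 :: real^('n::finite + 'n)^('n + 'n))"
  unfolding Omega_def block_mat_mult
  by (simp add: block_mat_one[symmetric] block_mat_minus matrix_minus_mult del: One_nat_def)

lemma transpose_Omega: "transpose Omega = - (Omega :: real^('n::finite + 'n)^('n + 'n))"
  unfolding Omega_def transpose_block_mat block_mat_minus by (simp add: transpose_mat_1_minus)

lemma Omega_cancel: "Omega ** (Omega ** A) = - (A :: real^('n::finite + 'n)^('n + 'n))"
  "(A ** Omega) ** Omega = - A"
proof -
  show "Omega ** (Omega ** A) = - A"
    by (simp only: matrix_mul_assoc Omega_squared matrix_minus_mult matrix_mul_lid)
  show "(A ** Omega) ** Omega = - A"
    by (simp only: matrix_mul_assoc[symmetric] Omega_squared matrix_minus_mult matrix_mul_rid)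
qed

lemma SpD: "M \<in> Sp \<Longrightarrow> transpose M ** Omega ** M = Omega"
  by (simp add: Sp_def)

lemma Sp_left_inverse: "M \<in> Sp \<Longrightarrow> (- (Omega ** transpose M ** Omega)) ** M = mat 1"
proof -
  assume "M \<in> Sp"
  then have "Omega ** (transpose M ** Omega ** M) = - mat 1" by (simp only: SpD Omega_squared)
  then show ?thesis by (simp add: matrix_minus_mult matrix_mul_assoc)
qed

lemma Sp_right_inverse: "M \<in> Sp \<Longrightarrow> M ** (- (Omega ** transpose M ** Omega)) = mat 1"
  using Sp_left_inverse matrix_left_right_inverse by blast

lemma Sp_det: "M \<in> Sp \<Longrightarrow> det M \<noteq> 0"
  using Sp_left_inverse invertible_left_inverse invertible_det_nz by blast

lemma Sp_mult: "M \<in> Sp \<Longrightarrow> N \<in> Sp \<Longrightarrow> M ** N \<in> Sp"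
proof -
  assume "M \<in> Sp" "N \<in> Sp"
  have "transpose (M ** N) ** Omega ** (M ** N) = transpose N ** (transpose M ** Omega ** M) ** N"
    by (simp only: matrix_transpose_mul matrix_mul_assoc)
  then show ?thesis using \<open>M \<in> Sp\<close> \<open>N \<in> Sp\<close> by (simp add: Sp_def)
qed

lemma Sp_one: "mat 1 \<in> Sp" by (simp add: Sp_def)

lemma Omega_in_Sp: "Omega \<in> Sp"
proof -
  have "transpose Omega ** Omega ** Omega = Omega"
    by (simp only: transpose_Omega matrix_minus_mult Omega_squared matrix_mul_lid minus_minus)
  then show ?thesis by (simp add: Sp_def)
qed

lemma Sp_matrix_inv: 
  assumes "M \<in> Sp"
  shows "matrix_inv M = - (Omega ** transpose M ** Omega)" "matrix_inv M \<in> Sp"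
    "M ** matrix_inv M = mat 1" "matrix_inv M ** M = mat 1"
proof -
  show eq: "matrix_inv M = - (Omega ** transpose M ** Omega)"
    using Sp_right_inverse[OF assms] by (rule matrix_inv_eqI)
  let ?N = "- (Omega ** transpose M ** Omega)"
  show r: "M ** matrix_inv M = mat 1" and "matrix_inv M ** M = mat 1"
    using Sp_left_inverse[OF assms] Sp_right_inverse[OF assms] by (simp_all add: eq)
  have "transpose (matrix_inv M) ** (transpose M ** Omega ** M) ** matrix_inv M
      = transpose (M ** matrix_inv M) ** Omega ** (M ** matrix_inv M)"
    by (simp only: matrix_transpose_mul matrix_mul_assoc)
  then have "transpose (matrix_inv M) ** Omega ** matrix_inv M = Omega"
    using assms r by (simp add: SpD)
  then show "matrix_inv M \<in> Sp" by (simp add: Sp_def)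
qed

text \<open>This is the formula for the inverse solved for the transpose: up to sign it is the
  inverse between two factors \<open>Omega\<close>, and \<open>Sp\<close> is closed under
  negation.\<close>

lemma Sp_transpose: "M \<in> Sp \<Longrightarrow> transpose M \<in> Sp"
proof -
  assume M: "M \<in> Sp"
  have "transpose M = - (Omega ** matrix_inv M ** Omega)"
    by (simp add: Sp_matrix_inv[OF M] matrix_minus_mult matrix_mul_assoc[symmetric] Omega_cancel)
      (simp add: Omega_squared matrix_minus_mult)
  moreover have "- (Omega ** matrix_inv M ** Omega) \<in> Sp"
    using Sp_mult[OF Sp_mult[OF Omega_in_Sp Sp_matrix_inv(2)[OF M]] Omega_in_Sp]
    by (simp add: Sp_def transpose_linear matrix_minus_mult)
  ultimately show ?thesis by simp
qed

lemma group_Sp_group: "group (Sp_group :: (real^('n::finite + 'n)^('n + 'n)) monoid)"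
  by (rule groupI)
    (auto simp: Sp_group_def Sp_mult Sp_one matrix_mul_assoc, metis Sp_matrix_inv(2,4))

lemma inv_Sp_group: "M \<in> Sp \<Longrightarrow> inv\<^bsub>Sp_group\<^esub> M = matrix_inv M"
  by (rule group.inv_equality[OF group_Sp_group]) (auto simp: Sp_group_def intro: Sp_matrix_inv(2-4))

lemma continuous_on_Sp_matrix_inv [continuous_intros]:
  assumes "continuous_on S A" "A ` S \<subseteq> Sp"
  shows "continuous_on S (\<lambda>x. matrix_inv (A x))"
  using assms Sp_det by (intro continuous_intros) auto

text \<open>The Cayley transform, \<open>S\<close> to \<open>(S - 1)(S + 1)\<^sup>-\<^sup>1\<close>, maps the symplectic group to its Lie
  algebra; scaling by \<open>t\<close> there and transforming back gives this path from \<open>1\<close> to \<open>S\<close>.\<close>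

definition moebius :: "real \<Rightarrow> real^'m^'m \<Rightarrow> real^'m^'m" where
  "moebius t S = ((1 + t) *\<^sub>R S + (1 - t) *\<^sub>R mat 1) ** matrix_inv ((1 - t) *\<^sub>R S + (1 + t) *\<^sub>R mat 1)"

text \<open>The equation * is symmetric in \<open>x\<close> and \<open>y\<close>, so the numerator
  \<open>a S + b\<close> and the denominator \<open>b S + a\<close> pull \<open>Omega\<close> back
  to the same form, and their quotient preserves \<open>Omega\<close>.\<close>

lemma moebius_in_Sp:
  assumes S: "S \<in> Sp" and det: "det ((1 - t) *\<^sub>R S + (1 + t) *\<^sub>R mat 1) \<noteq> 0"
  shows "moebius t S \<in> Sp"
proof -
  define a b where "a = 1 + t" and "b = 1 - t"
  define N where "N = matrix_inv (b *\<^sub>R S + a *\<^sub>R mat 1)"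
  have N: "(b *\<^sub>R S + a *\<^sub>R mat 1) ** N = mat 1"
    using det invertible_det_nz matrix_inv_right unfolding N_def a_def b_def by blast
  have *: "transpose (x *\<^sub>R S + y *\<^sub>R mat 1) ** Omega ** (x *\<^sub>R S + y *\<^sub>R mat 1) =
      (x * x + y * y) *\<^sub>R Omega + (x * y) *\<^sub>R (transpose S ** Omega + Omega ** S)" for x y
    using SpD[OF S]
    by (simp add: matrix_algebra transpose_linear scaleR_add_left scaleR_add_right mult.commute
        add_ac)
  have "transpose (moebius t S) ** Omega ** moebius t S =
     transpose N ** (transpose (a *\<^sub>R S + b *\<^sub>R mat 1) ** Omega ** (a *\<^sub>R S + b *\<^sub>R mat 1)) ** N"
    unfolding moebius_def a_def[symmetric] b_def[symmetric] N_def[symmetric]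
    by (simp only: matrix_transpose_mul matrix_mul_assoc)
  also have "\<dots> = transpose N ** (transpose (b *\<^sub>R S + a *\<^sub>R mat 1) ** Omega ** (b *\<^sub>R S + a *\<^sub>R mat 1)) ** N"
    unfolding * by (simp add: mult.commute add.commute)
  also have "\<dots> = transpose ((b *\<^sub>R S + a *\<^sub>R mat 1) ** N) ** Omega ** ((b *\<^sub>R S + a *\<^sub>R mat 1) ** N)"
    by (simp only: matrix_transpose_mul matrix_mul_assoc)
  also have "\<dots> = Omega" by (simp add: N)
  finally show ?thesis by (simp add: Sp_def)
qed

lemma matrix_inv_two: "matrix_inv (2 *\<^sub>R mat 1 :: real^'m^'m) = (1/2) *\<^sub>R mat 1"
  by (rule matrix_inv_eqI) (simp add: matrix_scaleR_mult)

lemma moebius_1: "moebius 1 S = S" by (simp add: moebius_def matrix_inv_two matrix_scaleR_mult)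

lemma moebius_0: "det (S + mat 1) \<noteq> 0 \<Longrightarrow> moebius 0 S = mat 1"
  by (simp add: moebius_def matrix_inv_right invertible_det_nz)

lemma det_scaleR_mat_1: "c \<noteq> 0 \<Longrightarrow> det (c *\<^sub>R mat 1 :: real^'m^'m) \<noteq> 0"
  by (simp add: invertible_det_nz[symmetric] invertible_right_inverse)
    (rule exI[of _ "(1/c) *\<^sub>R mat 1"], simp add: matrix_scaleR_mult)

lemma moebius_mat_1: 
  shows "moebius t (mat 1 :: real^'m^'m) = mat 1"
proof -
  have eq: "(1 + t) *\<^sub>R (mat 1 :: real^'m^'m) + (1 - t) *\<^sub>R mat 1 = 2 *\<^sub>R mat 1"
    "(1 - t) *\<^sub>R (mat 1 :: real^'m^'m) + (1 + t) *\<^sub>R mat 1 = 2 *\<^sub>R mat 1"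
    by (simp_all add: scaleR_add_left[symmetric])
  show ?thesis unfolding moebius_def eq matrix_inv_two by (simp add: matrix_scaleR_mult)
qed

lemma continuous_on_moebius [continuous_intros]:
  assumes "continuous_on X f" "continuous_on X A"
    "\<And>x. x \<in> X \<Longrightarrow> det ((1 - f x) *\<^sub>R A x + (1 + f x) *\<^sub>R mat 1) \<noteq> 0"
  shows "continuous_on X (\<lambda>x. moebius (f x) (A x))"
  unfolding moebius_def by (intro continuous_intros assms)

lemma matrix_vector_mult_minus:
  fixes A :: "'a::ring_1^'n^'m" shows "(- A) *v x = - (A *v x)"
  by (vector matrix_vector_mult_def sum_negf)

section \<open>Square roots of positive definite matrices\<close>

definition symmetric_matrices :: "(real^'m^'m) set" where
  "symmetric_matrices = {A. transpose A = A}"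

definition posdef_matrices :: "(real^'m^'m) set" where
  "posdef_matrices = {A \<in> symmetric_matrices. \<forall>x. x \<noteq> 0 \<longrightarrow> 0 < x \<bullet> (A *v x)}"

text \<open>Limits of positive definite matrices may be only semidefinite; the closedness half of
  the existence proof for square roots takes place in this larger set.\<close>

definition possemidef_matrices :: "(real^'m^'m) set" where
  "possemidef_matrices = {A \<in> symmetric_matrices. \<forall>x. 0 \<le> x \<bullet> (A *v x)}"

lemma posdefD:
  assumes "A \<in> posdef_matrices"
  shows "transpose A = A" "x \<noteq> 0 \<Longrightarrow> 0 < x \<bullet> (A *v x)"
  using assms by (auto simp: posdef_matrices_def symmetric_matrices_def)

lemma posdef_subset_symmetric: "posdef_matrices \<subseteq> symmetric_matrices"
  by (auto simp: posdef_matrices_def)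

lemma posdef_subset_possemidef: "posdef_matrices \<subseteq> possemidef_matrices"
proof -
  have "0 \<le> x \<bullet> (A *v x)" if "A \<in> posdef_matrices" for A :: "real^'m^'m" and x
    using posdefD(2)[OF that, of x] by (cases "x = 0") auto
  then show ?thesis by (auto simp: possemidef_matrices_def posdef_matrices_def)
qed

section \<open>The open convex cone of positive definite matrices\<close>

lemma subspace_symmetric_matrices: "subspace symmetric_matrices"
  by (auto simp: subspace_def symmetric_matrices_def transpose_linear)

lemma convex_posdef: "convex posdef_matrices"
proof (rule convexI)
  fix A B :: "real^'m^'m" and u v :: real
  assume A: "A \<in> posdef_matrices" and B: "B \<in> posdef_matrices" and uv: "0 \<le> u" "0 \<le> v" "u + v = 1"
  have "0 < x \<bullet> ((u *\<^sub>R A + v *\<^sub>R B) *v x)" if "x \<noteq> 0" for x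
  proof -
    have "x \<bullet> ((u *\<^sub>R A + v *\<^sub>R B) *v x) = u * (x \<bullet> (A *v x)) + v * (x \<bullet> (B *v x))"
      by (simp add: matrix_vector_mult_add_rdistrib inner_add_right scaleR_matrix_vector_assoc[symmetric])
    also have "\<dots> > 0"
    proof (cases "u = 0")
      case True then show ?thesis using uv posdefD(2)[OF B that] by simp
    next
      case False
      then have "u * (x \<bullet> (A *v x)) > 0" using uv posdefD(2)[OF A that] by simp
      moreover have "v * (x \<bullet> (B *v x)) \<ge> 0" using uv posdefD(2)[OF B that] by simp
      ultimately show ?thesis by linarith
    qed
    finally show ?thesis .
  qed
  then show "u *\<^sub>R A + v *\<^sub>R B \<in> posdef_matrices"
    using posdefD(1)[OF A] posdefD(1)[OF B]
    by (simp add: posdef_matrices_def symmetric_matrices_def transpose_linear)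
qed

lemma mat_1_posdef: "mat 1 \<in> posdef_matrices"
  by (auto simp: posdef_matrices_def symmetric_matrices_def)

lemma norm_matrix_vector_mult_le:
  fixes A :: "real^'n^'m"
  shows "norm (A *v x) \<le> norm A * norm x"
proof -
  have "(norm (A *v x))\<^sup>2 = (\<Sum>i\<in>UNIV. ((A *v x) $ i)\<^sup>2)"
    by (simp add: norm_vec_def L2_set_def sum_nonneg)
  also have "\<dots> \<le> (\<Sum>i\<in>UNIV. (norm (A $ i))\<^sup>2 * (norm x)\<^sup>2)"
  proof (rule sum_mono)
    fix i
    have "\<bar>(A *v x) $ i\<bar> \<le> norm (A $ i) * norm x"
      by (simp add: matrix_vector_mul_component Cauchy_Schwarz_ineq2)
    then show "((A *v x) $ i)\<^sup>2 \<le> (norm (A $ i))\<^sup>2 * (norm x)\<^sup>2"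
      by (metis abs_ge_zero power2_abs power_mono power_mult_distrib)
  qed
  also have "\<dots> = (norm A * norm x)\<^sup>2"
    by (simp add: norm_vec_def[of A] L2_set_def sum_nonneg power_mult_distrib sum_distrib_right)
  finally show ?thesis by (rule power2_le_imp_le) simp
qed

text \<open>The minimum \<open>c\<close> of the quadratic form on the unit sphere is a radius of
  safety: a symmetric perturbation of norm below \<open>c\<close> changes the form on unit vectors
  by less than \<open>c\<close>.\<close>

lemma openin_posdef: "openin (top_of_set symmetric_matrices) (posdef_matrices :: (real^'m^'m) set)"
proof (subst openin_contains_ball, intro conjI ballI posdef_subset_symmetric)
  fix A :: "real^'m^'m" assume A: "A \<in> posdef_matrices"
  have "continuous_on (sphere 0 1) (\<lambda>x. x \<bullet> (A *v x))" by (intro continuous_intros)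
  moreover have "sphere (0::real^'m) 1 \<noteq> {}" by simp
  ultimately obtain u where u: "u \<in> sphere 0 1" and
      min: "\<And>x. x \<in> sphere 0 1 \<Longrightarrow> u \<bullet> (A *v u) \<le> x \<bullet> (A *v x)"
    using continuous_attains_inf[OF compact_sphere] by blast
  define c where "c = u \<bullet> (A *v u)"
  have "u \<noteq> 0" using u by auto
  then have c: "c > 0" unfolding c_def by (rule posdefD(2)[OF A])
  have "ball A c \<inter> symmetric_matrices \<subseteq> posdef_matrices"
  proof
    fix B assume B: "B \<in> ball A c \<inter> symmetric_matrices"
    have "0 < x \<bullet> (B *v x)" if "x \<noteq> 0" for x
    proof -
      define y where "y = x /\<^sub>R norm x"
      have y: "norm y = 1" "x = norm x *\<^sub>R y" using that by (auto simp: y_def)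
      have "\<bar>y \<bullet> ((B - A) *v y)\<bar> \<le> norm y * norm ((B - A) *v y)" by (rule Cauchy_Schwarz_ineq2)
      also have "\<dots> \<le> norm (B - A)"
        using norm_matrix_vector_mult_le[of "B - A" y] by (simp add: y)
      also have "\<dots> < c" using B by (simp add: dist_norm norm_minus_commute)
      finally have "\<bar>y \<bullet> ((B - A) *v y)\<bar> < c" .
      moreover have "c \<le> y \<bullet> (A *v y)" using min[of y] y by (simp add: c_def)
      ultimately have "0 < y \<bullet> (B *v y)"
        by (simp add: matrix_vector_mult_diff_rdistrib inner_diff_right)
      then have "0 < norm x * (norm x * (y \<bullet> (B *v y)))" using that by simp
      also have "\<dots> = x \<bullet> (B *v x)"
        by (subst (3 4) y(2)) (simp add: matrix_vector_mult_scaleR)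
      finally show ?thesis .
    qed
    then show "B \<in> posdef_matrices" using B by (auto simp: posdef_matrices_def)
  qed
  then show "\<exists>e>0. ball A e \<inter> symmetric_matrices \<subseteq> posdef_matrices" using c by blast
qed

lemma symmetric_square_inner:
  fixes A :: "real^'m^'m"
  shows "transpose A = A \<Longrightarrow> x \<bullet> ((A ** A) *v x) = (norm (A *v x))\<^sup>2"
  by (simp add: norm_eq_transpose_mult)

lemma posdef_mult_nonzero:
  assumes "A \<in> posdef_matrices" "x \<noteq> 0" shows "A *v x \<noteq> 0"
  using posdefD(2)[OF assms] by auto

lemma posdef_invertible: "A \<in> posdef_matrices \<Longrightarrow> invertible A"
  unfolding invertible_left_inverse matrix_left_invertible_ker using posdef_mult_nonzero by blast

lemma posdef_square: "A \<in> posdef_matrices \<Longrightarrow> A ** A \<in> posdef_matrices"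
  using posdef_mult_nonzero[of A] posdefD(1)[of A]
  by (simp add: posdef_matrices_def symmetric_matrices_def matrix_transpose_mul symmetric_square_inner)

lemma posdef_transpose_mult: "det M \<noteq> 0 \<Longrightarrow> transpose M ** M \<in> posdef_matrices"
proof -
  assume "det M \<noteq> 0"
  then have "M *v x \<noteq> 0" if "x \<noteq> 0" for x
    using that unfolding invertible_det_nz[symmetric] invertible_left_inverse matrix_left_invertible_ker
    by blast
  then show ?thesis
    by (simp add: posdef_matrices_def symmetric_matrices_def matrix_transpose_mul
        norm_eq_transpose_mult[symmetric])
qed

text \<open>The trace is the sum of the quadratic form of \<open>P\<close> over the columns of
  \<open>D\<close>, at least one of which is nonzero.\<close>

lemma trace_posdef_square:
  fixes P D :: "real^'m^'m"
  assumes "\<And>x. x \<noteq> 0 \<Longrightarrow> 0 < x \<bullet> (P *v x)" and "D \<noteq> 0"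
  shows "0 < trace (transpose D ** P ** D)"
proof -
  have eq: "trace (transpose D ** P ** D) = (\<Sum>j\<in>UNIV. column j D \<bullet> (P *v column j D))"
    unfolding trace_def
  proof (rule sum.cong[OF refl])
    fix j
    have "(transpose D ** (P ** D)) $ j $ j = column j D \<bullet> column j (P ** D)"
      by (simp add: matrix_matrix_mult_def transpose_def column_def inner_vec_def)
    also have "column j (P ** D) = P *v column j D"
      by (simp add: column_def matrix_matrix_mult_def matrix_vector_mult_def vec_eq_iff)
    finally show "(transpose D ** P ** D) $ j $ j = column j D \<bullet> (P *v column j D)"
      by (simp add: matrix_mul_assoc)
  qed
  obtain j where "column j D \<noteq> 0" using assms(2) by (auto simp: vec_eq_iff column_def)
  then have "0 < column j D \<bullet> (P *v column j D)" by (rule assms(1))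
  moreover have "0 \<le> column i D \<bullet> (P *v column i D)" for i
    using assms(1)[of "column i D"] by (cases "column i D = 0") auto
  ultimately show ?thesis unfolding eq by (intro sum_pos2[of _ j]) auto
qed

text \<open>With \<open>D = A - B\<close>, \<open>A\<^sup>2 = B\<^sup>2\<close> gives \<open>AD = - DB\<close>, so \<open>trace (DAD) + trace (DBD) = 0\<close>,
  while both traces are positive unless \<open>D = 0\<close>.\<close>

lemma inj_on_posdef_square: "inj_on (\<lambda>A. A ** A) posdef_matrices"
proof (rule inj_onI, rule ccontr)
  fix A B :: "real^'m^'m"
  assume A: "A \<in> posdef_matrices" and B: "B \<in> posdef_matrices" and eq: "A ** A = B ** B" and "A \<noteq> B"
  define D where "D = A - B"
  have D: "D \<noteq> 0" "transpose D = D"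
    using \<open>A \<noteq> B\<close> posdefD(1)[OF A] posdefD(1)[OF B] by (auto simp: D_def transpose_linear)
  have AD: "A ** D = - (D ** B)" unfolding D_def by (simp add: matrix_algebra eq)
  have "0 < trace (D ** A ** D)" using trace_posdef_square[OF posdefD(2)[OF A] D(1)] D(2) by simp
  moreover have "0 < trace (D ** B ** D)" using trace_posdef_square[OF posdefD(2)[OF B] D(1)] D(2) by simp
  moreover have "trace (D ** A ** D) = - trace (D ** B ** D)"
  proof -
    have "D ** A ** D = - (D ** (D ** B))"
      by (simp add: matrix_mul_assoc[symmetric] AD matrix_minus_mult)
    then have "trace (D ** A ** D) = - trace (D ** (D ** B))" by (simp add: trace_def sum_negf)
    also have "\<dots> = - trace ((D ** B) ** D)" by (rule arg_cong[OF trace_mul_sym])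
    finally show ?thesis .
  qed
  ultimately show False by simp
qed

text \<open>If \<open>y = P *v x\<close> were nonzero, moving \<open>x\<close> in the direction
  \<open>- y\<close> would make the form negative, since it vanishes at \<open>x\<close> and has
  first-order term \<open>- 2 * t * (y \<bullet> y)\<close>.\<close>

lemma possemidef_kernel:
  assumes P: "P \<in> possemidef_matrices" and "x \<bullet> (P *v x) = 0"
  shows "P *v x = 0"
proof (rule ccontr)
  define y where "y = P *v x"
  assume "P *v x \<noteq> 0"
  then have y: "y \<bullet> y > 0" by (simp add: y_def)
  have sym: "transpose P = P" and psd: "\<And>z. 0 \<le> z \<bullet> (P *v z)"
    using P by (auto simp: possemidef_matrices_def symmetric_matrices_def)
  have xy: "x \<bullet> (P *v y) = y \<bullet> y" by (subst inner_transpose) (simp add: sym y_def)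
  have q: "(x - t *\<^sub>R y) \<bullet> (P *v (x - t *\<^sub>R y)) = - 2 * t * (y \<bullet> y) + t * t * (y \<bullet> (P *v y))" for t
  proof -
    have "P *v (x - t *\<^sub>R y) = y - t *\<^sub>R (P *v y)"
      by (simp add: matrix_vector_mult_diff_distrib matrix_vector_mult_scaleR y_def)
    moreover have "x \<bullet> y = 0" using assms(2) by (simp add: y_def)
    ultimately show ?thesis by (simp add: inner_diff_left inner_diff_right xy algebra_simps)
  qed
  show False
  proof (cases "y \<bullet> (P *v y) = 0")
    case True
    then show False using psd[of "x - 1 *\<^sub>R y"] unfolding q using y by simp
  next
    case False
    then have d: "y \<bullet> (P *v y) > 0" using psd[of y] by linarith
    \<comment> \<open>The minimizer of the quadratic polynomial in \<open>q\<close>.\<close>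
    define t where "t = (y \<bullet> y) / (y \<bullet> (P *v y))"
    have t: "t > 0" "t * (y \<bullet> (P *v y)) = y \<bullet> y" using y d by (simp_all add: t_def)
    have "- 2 * t * (y \<bullet> y) + t * t * (y \<bullet> (P *v y)) = - t * (y \<bullet> y)"
      by (simp only: mult.assoc t(2))
    then have "0 \<le> - t * (y \<bullet> y)" using psd[of "x - t *\<^sub>R y"] unfolding q by linarith
    then show False using mult_pos_pos[OF t(1) y] by simp
  qed
qed

text \<open>For symmetric \<open>P\<close> the squared Frobenius norm is the trace of
  \<open>P ** P\<close>. The estimate bounds the roots of a bounded sequence of squares.\<close>

lemma norm_symmetric_le:
  fixes P :: "real^'m^'m"
  assumes "transpose P = P"
  shows "(norm P)\<^sup>2 \<le> CARD('m) * norm (P ** P)"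
proof -
  have sym: "P $ i $ j = P $ j $ i" for i j
    using assms by (metis (mono_tags, lifting) transpose_def vec_lambda_beta)
  have sq: "P $ i $ j * P $ i $ j = P $ i $ j * P $ j $ i" for i j by (subst (2) sym) (rule refl)
  have "(norm P)\<^sup>2 = (\<Sum>i\<in>UNIV. \<Sum>j\<in>UNIV. (P $ i $ j)\<^sup>2)"
    by (simp add: norm_vec_def L2_set_def sum_nonneg)
  also have "\<dots> = (\<Sum>i\<in>UNIV. (P ** P) $ i $ i)"
    unfolding matrix_matrix_mult_def by (simp only: power2_eq_square vec_lambda_beta) (intro sum.cong refl sq)
  also have "\<dots> \<le> (\<Sum>i\<in>(UNIV::'m set). norm (P ** P))"
  proof (rule sum_mono)
    fix i
    have "\<bar>(P ** P) $ i $ i\<bar> \<le> norm ((P ** P) $ i)" by (rule component_le_norm_cart)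
    also have "\<dots> \<le> norm (P ** P)" by (rule Finite_Cartesian_Product.norm_nth_le)
    finally show "(P ** P) $ i $ i \<le> norm (P ** P)" by simp
  qed
  finally show ?thesis by simp
qed

lemma closed_possemidef: "closed (possemidef_matrices :: (real^'m^'m) set)"
proof -
  have 1: "closed {A :: real^'m^'m. transpose A = A}"
    by (intro closed_Collect_eq continuous_intros)
  have 2: "closed {A :: real^'m^'m. \<forall>x. 0 \<le> x \<bullet> (A *v x)}"
    by (intro closed_Collect_all closed_Collect_le continuous_intros)
  have "possemidef_matrices =
      {A :: real^'m^'m. transpose A = A} \<inter> {A. \<forall>x. 0 \<le> x \<bullet> (A *v x)}"
    by (auto simp: possemidef_matrices_def symmetric_matrices_def)
  then show ?thesis using closed_Int[OF 1 2] by argo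
qed

text \<open>The roots of a convergent sequence of squares are bounded by
  \<open>norm_symmetric_le\<close>; a convergent subsequence of them gives a semidefinite root of
  the limit.\<close>

lemma closed_possemidef_squares: "closed ((\<lambda>A. A ** A) ` (possemidef_matrices :: (real^'m^'m) set))"
proof (subst closed_sequential_limits, intro allI impI, elim conjE)
  fix X :: "nat \<Rightarrow> real^'m^'m" and L
  assume "\<forall>n. X n \<in> (\<lambda>A. A ** A) ` possemidef_matrices" and lim: "X \<longlonglongrightarrow> L"
  then have "\<forall>n. \<exists>A. A \<in> possemidef_matrices \<and> X n = A ** A" by blast
  then obtain P where P: "\<And>n. P n \<in> possemidef_matrices" and X: "\<And>n. X n = P n ** P n"
    by metis
  obtain B where B: "\<And>n. norm (X n) \<le> B"
    using lim convergent_imp_bounded[of X] by (auto simp: bounded_iff)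
  have "norm (P n) \<le> sqrt (CARD('m) * B)" for n
  proof -
    have "(norm (P n))\<^sup>2 \<le> CARD('m) * norm (X n)"
      using P[of n] norm_symmetric_le[of "P n"]
      by (simp add: X possemidef_matrices_def symmetric_matrices_def)
    also have "\<dots> \<le> CARD('m) * B" using B[of n] by (simp add: mult_left_mono)
    finally show ?thesis by (rule real_le_rsqrt)
  qed
  then have "bounded (range P)" by (auto simp: bounded_iff)
  then obtain Q r where r: "strict_mono r" "(P \<circ> r) \<longlonglongrightarrow> Q"
    using bounded_imp_convergent_subsequence by blast
  have Q: "Q \<in> possemidef_matrices"
    using closed_sequentially[OF closed_possemidef, of "P \<circ> r" Q] P r(2) by auto
  have "continuous_on UNIV (\<lambda>A :: real^'m^'m. A ** A)" by (intro continuous_intros)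
  then have "(\<lambda>n. (P \<circ> r) n ** (P \<circ> r) n) \<longlonglongrightarrow> Q ** Q"
    using continuous_on_tendsto_compose[OF _ r(2), of UNIV "\<lambda>A. A ** A"] by auto
  moreover have "(\<lambda>n. (P \<circ> r) n ** (P \<circ> r) n) \<longlonglongrightarrow> L"
    using LIMSEQ_subseq_LIMSEQ[OF lim r(1)] by (simp add: X o_def)
  ultimately have "L = Q ** Q" using LIMSEQ_unique by blast
  then show "L \<in> (\<lambda>A. A ** A) ` possemidef_matrices" using Q by blast
qed

text \<open>Invariance of domain inside the linear space of symmetric matrices, where the cone is
  open and squaring is injective on it.\<close>

lemma openin_posdef_square_image:
  fixes U :: "(real^'m^'m) set"
  assumes "openin (top_of_set posdef_matrices) U"
  shows "openin (top_of_set posdef_matrices) ((\<lambda>A. A ** A) ` U)"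
proof -
  have U: "openin (top_of_set symmetric_matrices) U" using assms openin_posdef openin_trans by blast
  have Up: "U \<subseteq> posdef_matrices" using assms openin_imp_subset by blast
  have "openin (top_of_set symmetric_matrices) ((\<lambda>A. A ** A) ` U)"
  proof (rule invariance_of_domain_subspaces[OF U])
    show "inj_on (\<lambda>A. A ** A) U" using inj_on_posdef_square Up inj_on_subset by blast
    show "(\<lambda>A. A ** A) \<in> U \<rightarrow> symmetric_matrices"
      using Up posdef_square posdef_subset_symmetric by blast
  qed (auto intro!: subspace_symmetric_matrices continuous_intros)
  then show ?thesis
    by (rule openin_subset_trans) (use Up posdef_square posdef_subset_symmetric in auto)
qed

text \<open>Existence of roots by connectedness in place of diagonalization: the set of squares is
  nonempty, open and closed in the convex cone.\<close>

lemma posdef_square_surj: "(\<lambda>A. A ** A) ` posdef_matrices = (posdef_matrices :: (real^'m^'m) set)"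
proof -
  let ?I = "(\<lambda>A. A ** A) ` posdef_matrices :: (real^'m^'m) set"
  have "openin (top_of_set posdef_matrices) ?I" by (rule openin_posdef_square_image) simp
  \<comment> \<open>A semidefinite root of a definite matrix is itself definite by
    \<open>possemidef_kernel\<close>, so closedness of the semidefinite squares passes to
    \<open>?I\<close>.\<close>
  moreover have eq: "?I = posdef_matrices \<inter> (\<lambda>A. A ** A) ` possemidef_matrices"
  proof
    show "?I \<subseteq> posdef_matrices \<inter> (\<lambda>A. A ** A) ` possemidef_matrices"
      using posdef_square posdef_subset_possemidef by blast
    show "posdef_matrices \<inter> (\<lambda>A. A ** A) ` possemidef_matrices \<subseteq> ?I"
    proof clarify
      fix P :: "real^'m^'m" assume P: "P \<in> possemidef_matrices" and PP: "P ** P \<in> posdef_matrices"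
      have "0 < x \<bullet> (P *v x)" if "x \<noteq> 0" for x
      proof -
        have "P *v x \<noteq> 0"
          using posdef_mult_nonzero[OF PP that] by (auto simp: matrix_vector_mul_assoc[symmetric])
        then have "x \<bullet> (P *v x) \<noteq> 0" using possemidef_kernel[OF P] by blast
        moreover have "0 \<le> x \<bullet> (P *v x)" using P by (simp add: possemidef_matrices_def)
        ultimately show ?thesis by linarith
      qed
      then have "P \<in> posdef_matrices" using P by (simp add: posdef_matrices_def possemidef_matrices_def)
      then show "P ** P \<in> ?I" by blast
    qed
  qed
  have "closedin (top_of_set posdef_matrices) ?I"
    unfolding eq by (rule closedin_closed_Int[OF closed_possemidef_squares])
  moreover have "connected posdef_matrices" by (rule convex_connected[OF convex_posdef])
  ultimately show ?thesis using mat_1_posdef connected_clopen by blast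
qed

definition matrix_sqrt :: "real^'m^'m \<Rightarrow> real^'m^'m" where
  "matrix_sqrt = inv_into posdef_matrices (\<lambda>A. A ** A)"

lemma matrix_sqrt:
  assumes "S \<in> posdef_matrices"
  shows matrix_sqrt_posdef: "matrix_sqrt S \<in> posdef_matrices"
    and matrix_sqrt_square: "matrix_sqrt S ** matrix_sqrt S = S"
proof -
  have S: "S \<in> (\<lambda>A. A ** A) ` posdef_matrices" using assms posdef_square_surj by blast
  show "matrix_sqrt S \<in> posdef_matrices" unfolding matrix_sqrt_def by (rule inv_into_into[OF S])
  show "matrix_sqrt S ** matrix_sqrt S = S"
    using f_inv_into_f[OF S] unfolding matrix_sqrt_def .
qed

lemma matrix_sqrt_eqI: "P \<in> posdef_matrices \<Longrightarrow> P ** P = S \<Longrightarrow> matrix_sqrt S = P"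
  unfolding matrix_sqrt_def using inv_into_f_f[OF inj_on_posdef_square] by blast

lemma matrix_sqrt_mat_1: "matrix_sqrt (mat 1) = mat 1"
  by (rule matrix_sqrt_eqI[OF mat_1_posdef]) simp

lemma continuous_on_matrix_sqrt: "continuous_on posdef_matrices matrix_sqrt"
proof (rule continuous_on_inverse_open_map[where f = "\<lambda>A. A ** A"])
  show "(\<lambda>A. A ** A) ` posdef_matrices = posdef_matrices" by (rule posdef_square_surj)
  show "\<And>x. x \<in> posdef_matrices \<Longrightarrow> matrix_sqrt (x ** x) = x" by (rule matrix_sqrt_eqI) auto
qed (auto intro!: continuous_intros openin_posdef_square_image)

section \<open>Polar decomposition in the symplectic group\<close>

lemma posdef_matrix_inv: "P \<in> posdef_matrices \<Longrightarrow> matrix_inv P \<in> posdef_matrices"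
proof -
  assume P: "P \<in> posdef_matrices"
  define Q where "Q = matrix_inv P"
  have PQ: "P ** Q = mat 1" "Q ** P = mat 1"
    using matrix_inv_right matrix_inv_left posdef_invertible[OF P] by (auto simp: Q_def)
  have "transpose Q ** P = mat 1"
    using arg_cong[OF PQ(1), of transpose] by (simp add: matrix_transpose_mul posdefD(1)[OF P])
  then have "transpose Q = transpose Q ** (P ** Q)" by (simp add: PQ)
  also have "\<dots> = Q" by (simp add: matrix_mul_assoc \<open>transpose Q ** P = mat 1\<close>)
  finally have sym: "transpose Q = Q" .
  have "0 < x \<bullet> (Q *v x)" if "x \<noteq> 0" for x
  proof -
    have x: "x = P *v (Q *v x)" by (simp add: matrix_vector_mul_assoc PQ)
    then have "Q *v x \<noteq> 0" using that by auto
    then have "0 < (Q *v x) \<bullet> (P *v (Q *v x))" by (rule posdefD(2)[OF P])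
    then show ?thesis using x by (simp add: inner_commute)
  qed
  then show ?thesis using sym by (simp add: Q_def posdef_matrices_def symmetric_matrices_def)
qed

text \<open>For a symplectic \<open>S\<close> with root \<open>P\<close>, the matrix
  \<open>Q\<close>, which is the inverse of \<open>P\<close> conjugated by \<open>Omega\<close>, is
  also a positive definite root of \<open>S\<close>. By uniqueness \<open>P = Q\<close>, and this
  equation says that \<open>P\<close> is symplectic.\<close>

lemma matrix_sqrt_in_Sp:
  assumes S: "S \<in> posdef_matrices" and "S \<in> Sp"
  shows "matrix_sqrt S \<in> Sp"
proof -
  define P where "P = matrix_sqrt S"
  define R where "R = matrix_inv P"
  define Q where "Q = - (Omega ** R ** Omega)"
  have P: "P \<in> posdef_matrices" "P ** P = S" using matrix_sqrt[OF S] by (auto simp: P_def)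
  have R: "R \<in> posdef_matrices" using posdef_matrix_inv P by (simp add: R_def)
  have PR: "P ** R = mat 1" "R ** P = mat 1"
    using matrix_inv_right matrix_inv_left posdef_invertible[OF P(1)] by (auto simp: R_def)
  have "Q \<in> posdef_matrices"
  proof -
    have "0 < x \<bullet> (Q *v x)" if "x \<noteq> 0" for x
    proof -
      have "Omega *v (Omega *v x) = - x"
        by (simp add: matrix_vector_mul_assoc Omega_squared matrix_vector_mult_minus)
      then have "Omega *v x \<noteq> 0" using that by auto
      then have "0 < (Omega *v x) \<bullet> (R *v (Omega *v x))" by (rule posdefD(2)[OF R])
      also have "\<dots> = x \<bullet> ((transpose Omega ** R ** Omega) *v x)"
        by (subst inner_commute, subst inner_transpose)
          (simp only: matrix_vector_mul_assoc matrix_mul_assoc inner_commute)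
      also have "transpose Omega ** R ** Omega = Q" by (simp add: Q_def transpose_Omega matrix_minus_mult)
      finally show ?thesis .
    qed
    moreover have "transpose Q = Q"
      by (simp add: Q_def transpose_linear matrix_transpose_mul transpose_Omega matrix_minus_mult
          posdefD(1)[OF R] matrix_mul_assoc)
    ultimately show ?thesis by (simp add: posdef_matrices_def symmetric_matrices_def)
  qed
  moreover have "Q ** Q = S"
  proof -
    have "Q ** Q = - (Omega ** (R ** R) ** Omega)"
      by (simp add: Q_def matrix_minus_mult matrix_mul_assoc[symmetric] Omega_cancel)
    also have "R ** R = matrix_inv S"
      by (rule matrix_inv_eqI[symmetric])
        (metis (no_types) P(2) PR(1) matrix_mul_assoc matrix_mul_lid)
    also have "- (Omega ** matrix_inv S ** Omega) = S"
      by (simp add: Sp_matrix_inv(1)[OF \<open>S \<in> Sp\<close>] posdefD(1)[OF S] matrix_minus_mult matrix_mul_assoc[symmetric]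
          Omega_cancel) (simp add: Omega_squared matrix_minus_mult)
    finally show ?thesis .
  qed
  ultimately have "P = Q" using matrix_sqrt_eqI by (simp add: P_def)
  then have "P ** Omega ** P = Omega ** (R ** P)"
    by (simp add: Q_def matrix_minus_mult matrix_mul_assoc[symmetric] Omega_cancel)
  then show ?thesis using posdefD(1)[OF P(1)] PR by (simp add: Sp_def P_def)
qed

lemma Sp_gram: "M \<in> Sp \<Longrightarrow> transpose M ** M \<in> posdef_matrices" "M \<in> Sp \<Longrightarrow> transpose M ** M \<in> Sp"
  using posdef_transpose_mult Sp_det Sp_mult Sp_transpose by blast+

definition polar_abs :: "real^'m^'m \<Rightarrow> real^'m^'m" where
  "polar_abs M = matrix_sqrt (transpose M ** M)"

definition polar_unitary :: "real^'m^'m \<Rightarrow> real^'m^'m" where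
  "polar_unitary M = M ** matrix_inv (polar_abs M)"

lemma polar_abs_Sp: 
  assumes "M \<in> Sp" 
  shows "polar_abs M \<in> Sp" "polar_abs M \<in> posdef_matrices" "polar_abs M ** polar_abs M = transpose M ** M"
  using matrix_sqrt_in_Sp Sp_gram[OF assms] matrix_sqrt by (auto simp: polar_abs_def)

lemma polar_unitary_Sp:
  assumes M: "M \<in> Sp"
  shows "polar_unitary M \<in> Sp" "transpose (polar_unitary M) ** polar_unitary M = mat 1"
    "polar_unitary M ** polar_abs M = M"
proof -
  let ?P = "polar_abs M"
  note P = polar_abs_Sp[OF M]
  show "polar_unitary M \<in> Sp" unfolding polar_unitary_def by (intro Sp_mult M Sp_matrix_inv(2) P)
  show "polar_unitary M ** polar_abs M = M"
    by (simp add: polar_unitary_def matrix_mul_assoc[symmetric] Sp_matrix_inv(4)[OF P(1)])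
  have "transpose (polar_unitary M) ** polar_unitary M = matrix_inv ?P ** (transpose M ** M) ** matrix_inv ?P"
    using posdefD(1)[OF posdef_matrix_inv[OF P(2)]]
    by (simp only: polar_unitary_def matrix_transpose_mul matrix_mul_assoc)
  also have "\<dots> = (matrix_inv ?P ** ?P) ** (?P ** matrix_inv ?P)"
    by (simp only: P(3)[symmetric] matrix_mul_assoc)
  also have "\<dots> = mat 1" by (simp add: Sp_matrix_inv(3,4)[OF P(1)])
  finally show "transpose (polar_unitary M) ** polar_unitary M = mat 1" .
qed

lemma polar_unitary_mult:
  assumes "transpose K ** K = mat 1"
  shows "polar_unitary (K ** M) = K ** polar_unitary M"
proof -
  have "transpose (K ** M) ** (K ** M) = transpose M ** (transpose K ** K) ** M"
    by (simp only: matrix_transpose_mul matrix_mul_assoc)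
  then show ?thesis using assms by (simp add: polar_unitary_def polar_abs_def matrix_mul_assoc)
qed

lemma polar_unitary_orthogonal: "transpose M ** M = mat 1 \<Longrightarrow> polar_unitary M = M"
  by (simp add: polar_unitary_def polar_abs_def matrix_sqrt_mat_1)

lemma continuous_on_polar_abs [continuous_intros]:
  assumes "continuous_on X A" "A ` X \<subseteq> Sp"
  shows "continuous_on X (\<lambda>x. polar_abs (A x))"
  unfolding polar_abs_def
  by (rule continuous_on_compose2[OF continuous_on_matrix_sqrt])
    (use assms Sp_gram in \<open>auto intro!: continuous_intros\<close>)

lemma continuous_on_polar_unitary [continuous_intros]:
  assumes "continuous_on X A" "A ` X \<subseteq> Sp"
  shows "continuous_on X (\<lambda>x. polar_unitary (A x))"
  unfolding polar_unitary_def using assms polar_abs_Sp by (intro continuous_intros) auto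

text \<open>Only the positive factor moves, along its Cayley path. On \<open>Sp\<close>, time 1
  gives the matrix back and time 0 its unitary factor; orthogonal matrices never move.\<close>

definition polar_homotopy :: "real \<Rightarrow> real^'m^'m \<Rightarrow> real^'m^'m" where
  "polar_homotopy t M = polar_unitary M ** moebius t (polar_abs M)"

text \<open>Half of this matrix is a convex combination of \<open>P\<close> and the unit, hence
  positive definite.\<close>

lemma posdef_moebius_det:
  assumes P: "P \<in> posdef_matrices" and t: "0 \<le> t" "t \<le> 1"
  shows "det ((1 - t) *\<^sub>R P + (1 + t) *\<^sub>R mat 1) \<noteq> 0"
proof -
  let ?A = "((1 - t) / 2) *\<^sub>R P + ((1 + t) / 2) *\<^sub>R mat 1"
  have "?A \<in> posdef_matrices"
    by (rule convexD[OF convex_posdef P mat_1_posdef]) (use t in \<open>auto simp: field_simps\<close>)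
  then obtain B where B: "?A ** B = mat 1" using posdef_invertible invertible_right_inverse by blast
  have "((1 - t) *\<^sub>R P + (1 + t) *\<^sub>R mat 1) ** ((1/2) *\<^sub>R B) = ?A ** B"
    by (simp add: matrix_algebra scaleR_add_right)
  then have "invertible ((1 - t) *\<^sub>R P + (1 + t) *\<^sub>R mat 1)" unfolding B using invertible_right_inverse by blast
  then show ?thesis using invertible_det_nz by blast
qed

lemma polar_homotopy_in_Sp: "M \<in> Sp \<Longrightarrow> 0 \<le> t \<Longrightarrow> t \<le> 1 \<Longrightarrow> polar_homotopy t M \<in> Sp"
  unfolding polar_homotopy_def
  by (intro Sp_mult polar_unitary_Sp moebius_in_Sp polar_abs_Sp posdef_moebius_det) auto

lemma polar_homotopy_1: "M \<in> Sp \<Longrightarrow> polar_homotopy 1 M = M"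
  by (simp add: polar_homotopy_def moebius_1 polar_unitary_Sp)

lemma polar_homotopy_0: "M \<in> Sp \<Longrightarrow> polar_homotopy 0 M = polar_unitary M"
  using posdef_moebius_det[of "polar_abs M" 0] polar_abs_Sp[of M]
  by (simp add: polar_homotopy_def moebius_0)

lemma polar_homotopy_orthogonal: "transpose M ** M = mat 1 \<Longrightarrow> polar_homotopy t M = M"
  by (simp add: polar_homotopy_def polar_unitary_orthogonal polar_abs_def matrix_sqrt_mat_1 moebius_mat_1)

lemma continuous_on_polar_homotopy [continuous_intros]:
  assumes "continuous_on X f" "continuous_on X A" "f ` X \<subseteq> {0..1}" "A ` X \<subseteq> Sp"
  shows "continuous_on X (\<lambda>x. polar_homotopy (f x) (A x))"
  unfolding polar_homotopy_def
  by (intro continuous_intros assms posdef_moebius_det) (use assms polar_abs_Sp in auto)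

text \<open>Cayley paths translated by \<open>X\<close> run from \<open>X\<close> to every nearby
  \<open>Y\<close>. For \<open>Y = X\<close> the path is constant, so the tube lemma yields one
  neighbourhood on which all these paths exist and stay inside \<open>V\<close>. The continuous
  angle on the covering group is built on this.\<close>

lemma Sp_locally_path_connected:
  "locally path_connected (Sp :: (real^('n::finite + 'n)^('n + 'n)) set)"
proof (subst locally_path_connected_im_kleinen, intro allI impI, elim conjE)
  fix V and X :: "real^('n + 'n)^('n + 'n)"
  assume V: "openin (top_of_set Sp) V" and "X \<in> V"
  obtain W where W: "open W" "V = Sp \<inter> W" using V by (auto simp: openin_open)
  have X: "X \<in> Sp" "X \<in> W" using \<open>X \<in> V\<close> W by auto
  define A where "A = (\<lambda>z :: real \<times> (real^('n + 'n)^('n + 'n)). matrix_inv X ** snd z)"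
  define d where "d = (\<lambda>z. det ((1 - fst z) *\<^sub>R A z + (1 + fst z) *\<^sub>R mat 1))"
  define f where "f = (\<lambda>z. X ** moebius (fst z) (A z))"
  define D where "D = ({0..1} \<times> Sp) \<inter> d -` (- {0})"
  define U where "U = D \<inter> f -` W"
  have contA: "continuous_on Y A" for Y unfolding A_def by (intro continuous_intros)
  have contd: "continuous_on Y d" for Y unfolding d_def by (intro continuous_intros contA)
  have contf: "continuous_on D f"
    unfolding f_def by (intro continuous_intros contA) (auto simp: D_def d_def)
  have "openin (top_of_set ({0..1} \<times> Sp)) D"
    unfolding D_def by (intro continuous_openin_preimage_gen contd) auto
  moreover have "openin (top_of_set D) U"
    unfolding U_def by (intro continuous_openin_preimage_gen contf W)
  ultimately have opU: "openin (top_of_set ({0..1} \<times> Sp)) U" using openin_trans by blast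
  have "(t, X) \<in> U" if "t \<in> {0..1}" for t
  proof -
    have A1: "A (t, X) = mat 1" using X by (simp add: A_def Sp_matrix_inv(4))
    have "(1 - t) *\<^sub>R (mat 1 :: real^('n + 'n)^('n + 'n)) + (1 + t) *\<^sub>R mat 1 = 2 *\<^sub>R mat 1"
      by (simp add: scaleR_add_left[symmetric])
    then have "d (t, X) \<noteq> 0" by (simp add: d_def A1 det_scaleR_mat_1)
    moreover have "f (t, X) = X" by (simp add: f_def A1 moebius_mat_1)
    ultimately show ?thesis using that X by (simp add: U_def D_def)
  qed
  then obtain N where N: "openin (top_of_set Sp) N" "X \<in> N" "{0..1} \<times> N \<subseteq> U"
    using Retracts.tube_lemma[of "{0..1::real}" X U Sp, OF _ _ _ opU] by (auto simp: image_subset_iff)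
  have path: "\<exists>g. path g \<and> path_image g \<subseteq> V \<and> pathstart g = X \<and> pathfinish g = Y" if Y: "Y \<in> N" for Y
  proof (intro exI conjI)
    let ?g = "\<lambda>t. f (t, Y)"
    have U: "(t, Y) \<in> U" if "t \<in> {0..1}" for t using N Y that by blast
    have YS: "Y \<in> Sp" using N Y openin_imp_subset by blast
    have "continuous_on ((\<lambda>t. (t, Y)) ` {0..1}) f"
      by (rule continuous_on_subset[OF contf]) (use U in \<open>auto simp: U_def\<close>)
    then show "path ?g" unfolding path_def
      by (rule continuous_on_compose2) (auto intro!: continuous_intros)
    show "path_image ?g \<subseteq> V"
    proof (clarsimp simp: path_image_def)
      fix t :: real assume "0 \<le> t" "t \<le> 1"
      then have "(t, Y) \<in> U" using U by simp
      then have "f (t, Y) \<in> W" "d (t, Y) \<noteq> 0" by (auto simp: U_def D_def)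
      moreover have "f (t, Y) \<in> Sp" unfolding f_def
        by (intro Sp_mult X moebius_in_Sp)
          (use YS X \<open>d (t, Y) \<noteq> 0\<close> in \<open>auto simp: A_def d_def intro!: Sp_mult Sp_matrix_inv(2)\<close>)
      ultimately show "f (t, Y) \<in> V" using W by blast
    qed
    have "d (0, Y) \<noteq> 0" using U[of 0] by (auto simp: U_def D_def)
    then show "pathstart ?g = X" by (simp add: pathstart_def f_def d_def moebius_0)
    show "pathfinish ?g = Y" using X
      by (simp add: pathfinish_def f_def moebius_1 A_def matrix_mul_assoc Sp_matrix_inv(3))
  qed
  moreover have "N \<subseteq> V"
  proof
    fix Y assume "Y \<in> N"
    then obtain g where "path_image g \<subseteq> V" "pathfinish g = Y" using path by blast
    then show "Y \<in> V" using pathfinish_in_path_image by blast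
  qed
  ultimately show "\<exists>u. openin (top_of_set Sp) u \<and> X \<in> u \<and> u \<subseteq> V \<and>
      (\<forall>y. y \<in> u \<longrightarrow> (\<exists>p. path p \<and> path_image p \<subseteq> V \<and> pathstart p = X \<and> pathfinish p = y))"
    using N by blast
qed

section \<open>Bounded subgroups of the symplectic group\<close>

text \<open>For symmetric \<open>S\<close>, Cauchy-Schwarz gives \<open>|Sx|\<^sup>2 \<le> |S\<^sup>2x|\<close> on unit vectors, so the
  norms of the iterated squares grow doubly exponentially if \<open>|Sx| > 1\<close>.\<close>

lemma bounded_squares_norm_le:
  fixes S :: "real^'m^'m"
  assumes sym: "transpose S = S" and B: "\<And>k. norm (((\<lambda>X. X ** X) ^^ k) S) \<le> B"
  shows "norm (S *v x) \<le> norm x"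
proof -
  have unit: "norm (S *v u) \<le> 1" if u: "norm u = 1" for u
  proof (rule ccontr)
    assume "\<not> norm (S *v u) \<le> 1"
    define a where "a = norm (S *v u)"
    define T where "T k = ((\<lambda>X. X ** X) ^^ k) S" for k
    have a: "a > 1" using \<open>\<not> norm (S *v u) \<le> 1\<close> by (simp add: a_def)
    have sy: "transpose (T k) = T k" for k
      by (induction k) (simp_all add: T_def sym matrix_transpose_mul)
    have "norm (T k *v u) \<ge> a ^ (2 ^ k)" for k
    proof (induction k)
      case 0 show ?case by (simp add: T_def a_def)
    next
      case (Suc k)
      have "a ^ (2 ^ Suc k) = (a ^ (2 ^ k))\<^sup>2" by (simp add: power_mult[symmetric] mult.commute)
      also have "\<dots> \<le> (norm (T k *v u))\<^sup>2" using Suc a by (intro power_mono) auto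
      also have "\<dots> = u \<bullet> (T (Suc k) *v u)" using symmetric_square_inner[OF sy] by (simp add: T_def)
      also have "\<dots> \<le> norm (T (Suc k) *v u)" using norm_cauchy_schwarz[of u] u by simp
      finally show ?case .
    qed
    moreover have "norm (T k *v u) \<le> B" for k
      using norm_matrix_vector_mult_le[of "T k" u] B[of k] u by (simp add: T_def)
    moreover obtain k where "B < a ^ k" using real_arch_pow[OF a] by blast
    moreover have "a ^ k \<le> a ^ (2 ^ k)" for k using a by (intro power_increasing) (auto simp: less_imp_le)
    ultimately show False by (meson not_le order_trans)
  qed
  show ?thesis
  proof (cases "x = 0")
    case False
    have "norm (S *v (x /\<^sub>R norm x)) \<le> 1" by (rule unit) (use False in simp)
    then show ?thesis using False by (simp add: matrix_vector_mult_scaleR field_simps)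
  qed simp
qed

text \<open>Both \<open>S = transpose M ** M\<close> and its inverse lie in \<open>L\<close> and so
  do not increase norms; hence \<open>S\<close> is an isometry. Being symmetric too, it squares to
  the unit, and the unit is the only positive definite root of the unit.\<close>

lemma bounded_subgroup_orthogonal:
  fixes L :: "(real^'m^'m) set"
  assumes mult: "\<And>X Y. X \<in> L \<Longrightarrow> Y \<in> L \<Longrightarrow> X ** Y \<in> L"
    and trans: "\<And>X. X \<in> L \<Longrightarrow> transpose X \<in> L" and inv: "\<And>X. X \<in> L \<Longrightarrow> matrix_inv X \<in> L"
    and det: "\<And>X. X \<in> L \<Longrightarrow> det X \<noteq> 0" and B: "\<And>X. X \<in> L \<Longrightarrow> norm X \<le> B" and M: "M \<in> L"
  shows "transpose M ** M = mat 1"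
proof -
  define S where "S = transpose M ** M"
  have S: "S \<in> L" "S \<in> posdef_matrices"
    using mult[OF trans[OF M] M] posdef_transpose_mult[OF det[OF M]] by (simp_all add: S_def)
  define R where "R = matrix_inv S"
  have R: "R \<in> L" "R \<in> posdef_matrices" using S inv posdef_matrix_inv by (auto simp: R_def)
  have RS: "R ** S = mat 1" using S posdef_invertible matrix_inv_left by (auto simp: R_def)
  have "((\<lambda>X. X ** X) ^^ k) X \<in> L" if "X \<in> L" for k X
    by (induction k) (auto simp: that mult)
  then have le: "norm (X *v x) \<le> norm x" if "X \<in> L" "X \<in> posdef_matrices" for X x
    using that B posdefD(1) by (intro bounded_squares_norm_le[of X B]) auto
  have "norm (S *v x) = norm x" for x
  proof (rule antisym)
    have "norm (R *v (S *v x)) \<le> norm (S *v x)" by (rule le[OF R])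
    then show "norm x \<le> norm (S *v x)" by (simp add: matrix_vector_mul_assoc RS)
  qed (rule le[OF S])
  then have "orthogonal_transformation (\<lambda>x. S *v x)"
    by (simp add: orthogonal_transformation)
  then have "orthogonal_matrix S" by (simp add: orthogonal_transformation_matrix)
  then have "S ** S = mat 1 ** mat 1" using posdefD(1)[OF S(2)] by (simp add: orthogonal_matrix)
  then show ?thesis using inj_on_posdef_square S mat_1_posdef unfolding S_def inj_on_def by blast
qed

section \<open>Embedded unitary matrices\<close>

lemma unitary_embed_nth:
  "unitary_embed A $ Inl i $ Inl j = Re (A $ i $ j)" "unitary_embed A $ Inl i $ Inr j = - Im (A $ i $ j)"
  "unitary_embed A $ Inr i $ Inl j = Im (A $ i $ j)" "unitary_embed A $ Inr i $ Inr j = Re (A $ i $ j)"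
  by (simp_all add: unitary_embed_def Let_def block_mat_nth)

lemma unitary_embed_mult: "unitary_embed (A ** B) = unitary_embed A ** unitary_embed B"
  by (rule matrix_sum_eqI)
    (simp_all add: unitary_embed_nth matrix_matrix_mult_def sum_UNIV_sum Re_sum Im_sum
      sum_subtractf sum_negf sum.distrib)

lemma unitary_embed_mat_1 [simp]: "unitary_embed (mat 1) = mat 1"
  by (rule matrix_sum_eqI) (simp_all add: unitary_embed_nth mat_def)

lemma transpose_unitary_embed: "transpose (unitary_embed A) = unitary_embed (conj_transpose A)"
  by (rule matrix_sum_eqI) (simp_all add: unitary_embed_nth transpose_def conj_transpose_def)

lemma inj_unitary_embed: "unitary_embed A = unitary_embed B \<Longrightarrow> A = B"
proof -
  assume eq: "unitary_embed A = unitary_embed B"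
  have "A $ i $ j = B $ i $ j" for i j
    by (rule complex_eqI) (metis eq unitary_embed_nth(1), metis eq unitary_embed_nth(3))
  then show ?thesis by (simp add: vec_eq_iff)
qed

lemma unitary_embed_Omega:
  "unitary_embed A ** Omega = Omega ** unitary_embed A"
  unfolding Omega_def unitary_embed_def Let_def
  by (simp add: block_mat_mult matrix_minus_mult block_mat_eq_iff)

lemma continuous_on_unitary_embed [continuous_intros]:
  assumes "continuous_on S A"
  shows "continuous_on S (\<lambda>x. unitary_embed (A x))"
proof -
  have "continuous_on S (\<lambda>x. unitary_embed (A x) $ i $ j)" for i j
    by (cases i; cases j) (simp_all add: unitary_embed_nth, (intro continuous_intros assms)+)
  then have "continuous_on S (\<lambda>x. \<chi> i j. unitary_embed (A x) $ i $ j)"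
    by (intro continuous_on_vec_lambda)
  then show ?thesis by simp
qed

text \<open>Reads only the first block column; it is a left inverse of \<open>unitary_embed\<close>,
  and on other matrices its value has no meaning.\<close>

definition complex_part :: "real^('n::finite + 'n)^('n + 'n) \<Rightarrow> complex^'n^'n" where
  "complex_part M = (\<chi> i j. Complex (M $ Inl i $ Inl j) (M $ Inr i $ Inl j))"

lemma complex_part_unitary_embed [simp]: "complex_part (unitary_embed A) = A"
  by (simp add: complex_part_def unitary_embed_nth vec_eq_iff)

lemma continuous_on_complex_part [continuous_intros]:
  assumes "continuous_on S A"
  shows "continuous_on S (\<lambda>x. complex_part (A x))"
  unfolding complex_part_def Complex_eq by (intro continuous_intros assms)

definition unitary_Sp :: "(real^('n::finite + 'n)^('n + 'n)) set" where
  "unitary_Sp = {M \<in> Sp. transpose M ** M = mat 1}"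

lemma unitary_SpD: "M \<in> unitary_Sp \<Longrightarrow> M \<in> Sp" "M \<in> unitary_Sp \<Longrightarrow> transpose M ** M = mat 1"
  "M \<in> unitary_Sp \<Longrightarrow> M ** transpose M = mat 1"
  using matrix_left_right_inverse by (auto simp: unitary_Sp_def)

lemma unitary_embed_in_unitary_Sp:
  assumes "A \<in> unitary_matrices" shows "unitary_embed A \<in> unitary_Sp"
proof -
  have orth: "transpose (unitary_embed A) ** unitary_embed A = mat 1"
    using assms by (simp add: transpose_unitary_embed unitary_embed_mult[symmetric] unitary_matrices_def)
  have "transpose (unitary_embed A) ** Omega ** unitary_embed A
      = Omega ** (transpose (unitary_embed A) ** unitary_embed A)"
    by (simp only: transpose_unitary_embed unitary_embed_Omega matrix_mul_assoc)
  then show ?thesis by (simp add: unitary_Sp_def Sp_def orth)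
qed

text \<open>U(n) is the intersection of Sp(2n, R) with the orthogonal group: an orthogonal
  symplectic matrix commutes with \<open>Omega\<close>, which is complex linearity and forces the
  block form of the embedding.\<close>

lemma unitary_Sp_eq: "unitary_Sp = unitary_embed ` unitary_matrices"
proof
  show "unitary_embed ` unitary_matrices \<subseteq> unitary_Sp" using unitary_embed_in_unitary_Sp by blast
  show "unitary_Sp \<subseteq> unitary_embed ` (unitary_matrices :: (complex^'n^'n) set)"
  proof
    fix M :: "real^('n + 'n)^('n + 'n)" assume M: "M \<in> unitary_Sp"
    have "M ** (transpose M ** Omega ** M) = Omega ** M"
      by (simp add: matrix_mul_assoc unitary_SpD[OF M])
    then have comm: "M ** Omega = Omega ** M" by (simp add: SpD[OF unitary_SpD(1)[OF M]])
    obtain A B C D where block: "M = block_mat A B C D" by (rule block_mat_exhaust)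
    have "block_mat (- B) A (- D) C = block_mat C D (- A) (- B)"
      using comm unfolding block Omega_def by (simp add: block_mat_mult matrix_minus_mult)
    then have "C = - B" "A = D" unfolding block_mat_eq_iff by metis+
    then have eq: "M = unitary_embed (complex_part M)"
      by (intro matrix_sum_eqI) (auto simp: block block_mat_nth unitary_embed_nth complex_part_def)
    let ?Z = "complex_part M"
    have "unitary_embed (conj_transpose ?Z ** ?Z) = unitary_embed (mat 1)"
      "unitary_embed (?Z ** conj_transpose ?Z) = unitary_embed (mat 1)"
      using unitary_SpD(2,3)[OF M] eq by (simp_all add: unitary_embed_mult transpose_unitary_embed[symmetric])
    then have "?Z \<in> unitary_matrices"
      using inj_unitary_embed unfolding unitary_matrices_def by blast
    then show "M \<in> unitary_embed ` unitary_matrices" using eq by blast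
  qed
qed

lemma unitary_embed_complex_part: "M \<in> unitary_Sp \<Longrightarrow> unitary_embed (complex_part M) = M"
  by (auto simp: unitary_Sp_eq)

lemma complex_part_mult:
  "M \<in> unitary_Sp \<Longrightarrow> N \<in> unitary_Sp \<Longrightarrow> complex_part (M ** N) = complex_part M ** complex_part N"
  by (metis complex_part_unitary_embed unitary_embed_complex_part unitary_embed_mult)

lemma unitary_Sp_mult: "M \<in> unitary_Sp \<Longrightarrow> N \<in> unitary_Sp \<Longrightarrow> M ** N \<in> unitary_Sp"
proof -
  assume MN: "M \<in> unitary_Sp" "N \<in> unitary_Sp"
  have "transpose (M ** N) ** (M ** N) = transpose N ** (transpose M ** M) ** N"
    by (simp only: matrix_transpose_mul matrix_mul_assoc)
  then show ?thesis using MN by (simp add: unitary_Sp_def Sp_mult)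
qed

lemma unitary_Sp_one: "mat 1 \<in> unitary_Sp" by (simp add: unitary_Sp_def Sp_one)

lemma unitary_Sp_matrix_inv: "M \<in> unitary_Sp \<Longrightarrow> matrix_inv M = transpose M"
  using unitary_SpD(3) by (intro matrix_inv_eqI)

lemma unitary_Sp_inv_closed: "M \<in> unitary_Sp \<Longrightarrow> matrix_inv M \<in> unitary_Sp"
  using unitary_SpD(3) by (auto simp: unitary_Sp_matrix_inv unitary_Sp_def Sp_transpose)

section \<open>The determinant of the unitary polar factor\<close>

lemma det_conj_transpose: "det (conj_transpose A) = cnj (det A)"
proof -
  have "det (conj_transpose A) = det (transpose (conj_transpose A))" by simp
  also have "transpose (conj_transpose A) = (\<chi> i j. cnj (A $ i $ j))"
    by (simp add: transpose_def conj_transpose_def vec_eq_iff)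
  also have "det \<dots> = cnj (det A)" by (simp add: det_def)
  finally show ?thesis .
qed

lemma norm_det_unitary: "A \<in> unitary_matrices \<Longrightarrow> norm (det A) = 1"
proof -
  assume "A \<in> unitary_matrices"
  then have "det (conj_transpose A ** A) = 1" by (simp add: unitary_matrices_def)
  then have "cnj (det A) * det A = 1" by (simp add: det_mul det_conj_transpose)
  then have "norm (cnj (det A) * det A) = 1" by simp
  then have "(norm (det A))\<^sup>2 = 1" by (simp add: norm_mult power2_eq_square)
  then show ?thesis using norm_ge_zero[of "det A"] unfolding power2_eq_1_iff by linarith
qed

definition circle_part :: "real^('n::finite + 'n)^('n + 'n) \<Rightarrow> complex" where
  "circle_part M = det (complex_part (polar_unitary M))"

lemma polar_unitary_in_unitary_Sp: "M \<in> Sp \<Longrightarrow> polar_unitary M \<in> unitary_Sp"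
  by (simp add: unitary_Sp_def polar_unitary_Sp)

lemma circle_part_unitary: "M \<in> unitary_Sp \<Longrightarrow> circle_part M = det (complex_part M)"
  by (simp add: circle_part_def polar_unitary_orthogonal unitary_SpD)

lemma norm_circle_part: "M \<in> Sp \<Longrightarrow> norm (circle_part M) = 1"
  using polar_unitary_in_unitary_Sp[of M] norm_det_unitary by (auto simp: circle_part_def unitary_Sp_eq)

text \<open>A unitary left factor passes through the polar decomposition unchanged
  (\<open>polar_unitary_mult\<close>). This asymmetry is inherited by the additivity of
  \<open>angle\<close>.\<close>

lemma circle_part_mult: "K \<in> unitary_Sp \<Longrightarrow> M \<in> Sp \<Longrightarrow> circle_part (K ** M) = circle_part K * circle_part M"
  by (simp add: circle_part_unitary) (simp add: circle_part_def polar_unitary_mult unitary_SpD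
      complex_part_mult polar_unitary_in_unitary_Sp det_mul)

lemma continuous_on_circle_part [continuous_intros]:
  assumes "continuous_on X A" "A ` X \<subseteq> Sp"
  shows "continuous_on X (\<lambda>x. circle_part (A x))"
  unfolding circle_part_def by (intro continuous_intros assms)

lemma circle_part_one: "circle_part (mat 1) = 1"
  by (metis circle_part_unitary complex_part_unitary_embed det_I unitary_Sp_one unitary_embed_mat_1)

definition special_unitary_Sp :: "(real^('n::finite + 'n)^('n + 'n)) set" where
  "special_unitary_Sp = {M \<in> unitary_Sp. circle_part M = 1}"

lemma special_unitary_Sp_eq:
  "special_unitary_Sp = unitary_embed ` (special_unitary_matrices :: (complex^'n::finite^'n) set)"
proof -
  have "circle_part (unitary_embed A) = det A" if "A \<in> unitary_matrices" for A :: "complex^'n^'n"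
    using that by (simp add: circle_part_unitary unitary_embed_in_unitary_Sp)
  then have "unitary_embed ` {A :: complex^'n^'n. A \<in> unitary_matrices \<and> det A = 1} =
      {M \<in> unitary_embed ` unitary_matrices. circle_part M = 1}"
    by auto
  then show ?thesis by (simp add: special_unitary_Sp_def special_unitary_matrices_def unitary_Sp_eq)
qed

lemma closed_unitary_Sp: "closed (unitary_Sp :: (real^('n::finite + 'n)^('n + 'n)) set)"
proof -
  have eq: "unitary_Sp = {M :: real^('n + 'n)^('n + 'n). transpose M ** Omega ** M = Omega} \<inter> {M. transpose M ** M = mat 1}"
    by (auto simp: unitary_Sp_def Sp_def)
  show ?thesis unfolding eq by (intro closed_Int closed_Collect_eq continuous_intros)
qed

lemma compact_special_unitary_Sp: "compact (special_unitary_Sp :: (real^('n::finite + 'n)^('n + 'n)) set)"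
proof -
  let ?S = "special_unitary_Sp :: (real^('n::finite + 'n)^('n + 'n)) set"
  have eq: "?S = unitary_Sp \<inter> {M. det (complex_part M) = 1}"
    by (auto simp: special_unitary_Sp_def circle_part_unitary)
  have "closed ?S" unfolding eq
    by (intro closed_Int closed_unitary_Sp closed_Collect_eq continuous_intros)
  moreover have "norm M = norm (mat 1 :: real^('n + 'n)^('n + 'n))" if "M \<in> ?S" for M
    using that norm_orthogonal_mult[of M "mat 1"] by (simp add: special_unitary_Sp_def unitary_SpD)
  then have "bounded ?S" by (auto simp: bounded_iff)
  ultimately show ?thesis by (simp add: compact_eq_bounded_closed)
qed

text \<open>Commutation lets \<open>Omega\<close> be cancelled from the symplectic equation. This is
  how central elements are later seen to lie over U(n).\<close>

lemma Sp_commuting_Omega_unitary: "M \<in> Sp \<Longrightarrow> M ** Omega = Omega ** M \<Longrightarrow> M \<in> unitary_Sp"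
proof -
  assume M: "M \<in> Sp" and c: "M ** Omega = Omega ** M"
  have "transpose M ** M ** Omega = Omega" using SpD[OF M] c by (simp add: matrix_mul_assoc[symmetric])
  then have "transpose M ** M ** Omega ** Omega = Omega ** Omega" by simp
  then have "transpose M ** M = mat 1" by (simp only: Omega_cancel Omega_squared neg_equal_iff_equal)
  then show ?thesis using M by (simp add: unitary_Sp_def)
qed

section \<open>Lifting circle-valued functions\<close>

lemma continuous_on_locally:
  assumes "\<And>x. x \<in> X \<Longrightarrow> \<exists>U. openin (top_of_set X) U \<and> x \<in> U \<and> continuous_on U f"
  shows "continuous_on X f"
  unfolding continuous_on_topological
proof (intro ballI allI impI)
  fix x B assume x: "x \<in> X" and B: "open B" "f x \<in> B"
  obtain U where U: "openin (top_of_set X) U" "x \<in> U" "continuous_on U f" using assms x by blast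
  obtain A where A: "open A" "x \<in> A" "\<forall>y\<in>U. y \<in> A \<longrightarrow> f y \<in> B"
    using U B unfolding continuous_on_topological by metis
  obtain O' where O': "open O'" "U = X \<inter> O'" using U(1) by (auto simp: openin_open)
  show "\<exists>A. open A \<and> x \<in> A \<and> (\<forall>y\<in>X. y \<in> A \<longrightarrow> f y \<in> B)"
    by (rule exI[of _ "A \<inter> O'"]) (use A O' U(2) in auto)
qed

text \<open>The difference is continuous with values in the discrete set of multiples of
  \<open>2 * pi\<close>. This is the uniqueness principle behind all later computations of
  angles.\<close>

lemma cis_eq_imp_diff_constant:
  fixes f g :: "'a::topological_space \<Rightarrow> real"
  assumes "connected S" "continuous_on S f" "continuous_on S g"
    and cis: "\<And>x. x \<in> S \<Longrightarrow> cis (f x) = cis (g x)" and "x \<in> S" "y \<in> S"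
  shows "f x - g x = f y - g y"
proof -
  have "(\<lambda>x. f x - g x) constant_on S"
  proof (rule continuous_discrete_range_constant[OF assms(1)])
    show "continuous_on S (\<lambda>x. f x - g x)" using assms by (intro continuous_intros)
    fix x assume x: "x \<in> S"
    have int: "\<exists>n::int. f y - g y = 2 * pi * n" if "y \<in> S" for y
    proof -
      have "cis (f y - g y) = 1" using cis[OF that] by (simp add: cis_divide[symmetric])
      then have "sin (f y - g y) = 0 \<and> cos (f y - g y) = 1" by (simp add: complex_eq_iff)
      then show ?thesis using cos_one_2pi_int[of "f y - g y"] by (auto simp: mult_ac)
    qed
    have "2 * pi \<le> norm (f y - g y - (f x - g x))" if y: "y \<in> S" "f y - g y \<noteq> f x - g x" for y
    proof -
      obtain m n :: int where mn: "f y - g y = 2 * pi * m" "f x - g x = 2 * pi * n"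
        using int x y(1) by metis
      then have "m \<noteq> n" using y by auto
      then have "1 \<le> \<bar>real_of_int (m - n)\<bar>" by linarith
      then have "2 * pi * 1 \<le> 2 * pi * \<bar>real_of_int (m - n)\<bar>" by (intro mult_left_mono) auto
      also have "\<dots> = \<bar>2 * pi * (real_of_int m - real_of_int n)\<bar>" by (simp add: abs_mult)
      finally show ?thesis by (simp add: mn right_diff_distrib)
    qed
    then show "\<exists>e>0. \<forall>y. y \<in> S \<and> f y - g y \<noteq> f x - g x \<longrightarrow> e \<le> norm (f y - g y - (f x - g x))"
      using pi_gt_zero by (intro exI[of _ "2 * pi"]) auto
  qed
  then show ?thesis using assms unfolding constant_on_def by metis
qed

lemma convex_circle_lift:
  fixes f :: "'a::real_normed_vector \<Rightarrow> complex"
  assumes "convex S" "continuous_on S f" "\<And>x. x \<in> S \<Longrightarrow> norm (f x) = 1"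
  obtains g where "continuous_on S g" "\<And>x. x \<in> S \<Longrightarrow> f x = cis (g x)"
proof -
  obtain h where h: "continuous_on S h" "\<And>x. x \<in> S \<Longrightarrow> f x = exp (h x)"
    using continuous_logarithm_on_contractible[OF assms(2) convex_imp_contractible[OF assms(1)]] assms(3)
    by (metis norm_zero zero_neq_one)
  have "f x = cis (Im (h x))" if "x \<in> S" for x
  proof -
    have "Re (h x) = 0" using assms(3)[OF that] h(2)[OF that] by simp
    then show ?thesis using h(2)[OF that] by (simp add: exp_eq_polar)
  qed
  moreover have "continuous_on S (\<lambda>x. Im (h x))" using h by (intro continuous_intros)
  ultimately show ?thesis using that by blast
qed

text \<open>The function is lifted over the whole homotopy square. The increment along a row does
  not depend on the row, since both ends of a row are one point, and it is 0 on the last row, where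
  the loop is constant.\<close>

lemma nullhomotopic_loop_circle_lift:
  assumes "homotopic_loops X c (\<lambda>_. a)" "continuous_on X \<phi>" "\<And>x. x \<in> X \<Longrightarrow> norm (\<phi> x) = 1"
    and l: "continuous_on {0..1} l" "\<And>s. s \<in> {0..1} \<Longrightarrow> \<phi> (c s) = cis (l s)"
  shows "l 1 = (l 0 :: real)"
proof -
  obtain k where k: "continuous_on ({0..1} \<times> {0..1}) k" "k ` ({0..1::real} \<times> {0..1::real}) \<subseteq> X"
    and k0: "\<And>x. x \<in> {0..1} \<Longrightarrow> k (0, x) = c x" and k1: "\<And>x. x \<in> {0..1} \<Longrightarrow> k (1, x) = a"
    and kl: "\<And>t. t \<in> {0..1} \<Longrightarrow> k (t, 1) = k (t, 0)"
    using assms(1) unfolding homotopic_loops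
    by (auto simp: pathstart_def pathfinish_def image_subset_iff Pi_iff)
  have "convex ({0..1::real} \<times> {0..1::real})" by (intro convex_Times) auto
  moreover have "continuous_on ({0..1} \<times> {0..1}) (\<lambda>z. \<phi> (k z))"
    using continuous_on_compose2[OF assms(2) k] .
  moreover have "norm (\<phi> (k z)) = 1" if "z \<in> {0..1} \<times> {0..1}" for z using assms(3) k(2) that by blast
  ultimately obtain g where g: "continuous_on ({0..1} \<times> {0..1}) g"
      "\<And>z. z \<in> {0..1} \<times> {0..1} \<Longrightarrow> \<phi> (k z) = cis (g z)"
    using convex_circle_lift by blast
  have row: "continuous_on {0..1} (\<lambda>s. g (t, s))" "continuous_on {0..1} (\<lambda>s. g (s, t))" if "t \<in> {0..1}" for t
    by (rule continuous_on_compose2[OF g(1)]; use that in \<open>force intro!: continuous_intros\<close>)+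
  have "g (0, 1) - g (0, 0) = g (1, 1) - g (1, 0)"
    by (rule cis_eq_imp_diff_constant[of "{0..1}" "\<lambda>s. g (s, 1)" "\<lambda>s. g (s, 0)"])
      (use g(2)[symmetric] kl row in auto)
  moreover have "g (1, 1) - g (1, 0) = g (1, 0) - g (1, 0)"
    by (rule cis_eq_imp_diff_constant[of "{0..1}" "\<lambda>s. g (1, s)" "\<lambda>s. g (1, 0)"])
      (use g(2)[symmetric] k1 row in auto)
  moreover have "l 1 - g (0, 1) = l 0 - g (0, 0)"
    by (rule cis_eq_imp_diff_constant[of "{0..1}" l "\<lambda>s. g (0, s)"])
      (use g(2)[symmetric] k0 row l in auto)
  ultimately show ?thesis by simp
qed

text \<open>Simple connectedness is phrased with free homotopies of loops; the base points along a
  homotopy between two constant loops trace a path.\<close>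

lemma simply_connected_path_connected:
  assumes "simply_connected X" shows "path_connected X"
  unfolding path_connected_component
proof (intro ballI)
  fix a b assume ab: "a \<in> X" "b \<in> X"
  then have "homotopic_loops X (\<lambda>_. a) (\<lambda>_. b)"
    using assms unfolding simply_connected_def
    by (elim allE[of _ "\<lambda>_. a"] allE[of _ "\<lambda>_. b"])
      (auto simp: path_def pathstart_def pathfinish_def path_image_def)
  then show "path_component X a b" 
    using homotopic_loops_imp_path_component_value[of X "\<lambda>_. a" "\<lambda>_. b" 0] by simp
qed

text \<open>The number \<open>t\<close> is an argument of the function at \<open>x\<close>,
  continued from 0 at \<open>a\<close> along some path. It is a relation because independence of the
  path is only proved below.\<close>

definition circle_path_lift :: "'a::topological_space set \<Rightarrow> ('a \<Rightarrow> complex) \<Rightarrow> 'a \<Rightarrow> 'a \<Rightarrow> real \<Rightarrow> bool" where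
  "circle_path_lift X \<phi> a x t \<longleftrightarrow> (\<exists>c l. path c \<and> path_image c \<subseteq> X \<and> pathstart c = a \<and> pathfinish c = x \<and>
     path l \<and> pathstart l = 0 \<and> pathfinish l = t \<and> (\<forall>s\<in>{0..1}. \<phi> (c s) = cis (l s)))"

lemma circle_path_lift_extend:
  assumes t: "circle_path_lift X \<phi> a x t"
    and d: "path d" "path_image d \<subseteq> X" "pathstart d = x"
    and m: "path m" "\<And>s. s \<in> {0..1} \<Longrightarrow> \<phi> (d s) = cis (m s)"
  shows "circle_path_lift X \<phi> a (pathfinish d) (t + pathfinish m - pathstart m)"
proof -
  obtain c l where c: "path c" "path_image c \<subseteq> X" "pathstart c = a" "pathfinish c = x"
    and l: "path l" "pathstart l = 0" "pathfinish l = t" "\<And>s. s \<in> {0..1} \<Longrightarrow> \<phi> (c s) = cis (l s)"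
    using t by (auto simp: circle_path_lift_def)
  \<comment> \<open>The argument \<open>m\<close> along \<open>d\<close> may start on another branch
    than \<open>t\<close>; it is shifted to fit.\<close>
  define m' where "m' = (\<lambda>s. t - pathstart m + m s)"
  have m': "path m'" "pathstart m' = t" "pathfinish m' = t + pathfinish m - pathstart m"
    using m(1) by (auto simp: m'_def path_def pathstart_def pathfinish_def intro!: continuous_intros)
  have "cis t = cis (pathstart m)"
    using l(4)[of 1] m(2)[of 0] l(3) c(4) d(3) by (simp add: pathstart_def pathfinish_def)
  then have cis: "cis (m' s) = cis (m s)" for s
    by (simp add: m'_def cis_mult[symmetric] cis_divide[symmetric])
  have "\<phi> ((c +++ d) s) = cis ((l +++ m') s)" if "s \<in> {0..1}" for s
    using that l(4)[of "2 * s"] m(2)[of "2 * s - 1"] by (auto simp: joinpaths_def cis)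
  then show ?thesis
    unfolding circle_path_lift_def using c d l m'
    by (intro exI[of _ "c +++ d"] exI[of _ "l +++ m'"]) (auto simp: path_image_join_subset subset_path_image_join)
qed

text \<open>Simple connectedness makes the continued argument \<open>t\<close> independent of the path.\<close>

lemma circle_path_lift_loop:
  assumes "simply_connected X" "continuous_on X \<phi>" "\<And>x. x \<in> X \<Longrightarrow> norm (\<phi> x) = 1"
    and "circle_path_lift X \<phi> a a t"
  shows "t = 0"
proof -
  obtain c l where c: "path c" "path_image c \<subseteq> X" "pathstart c = a" "pathfinish c = a"
    and l: "path l" "pathstart l = 0" "pathfinish l = t" "\<And>s. s \<in> {0..1} \<Longrightarrow> \<phi> (c s) = cis (l s)"
    using assms(4) by (auto simp: circle_path_lift_def)
  have "a \<in> X" using c pathstart_in_path_image by blast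
  then have "homotopic_loops X c (\<lambda>_. a)"
    using assms(1) c unfolding simply_connected_def
    by (elim allE[of _ c] allE[of _ "\<lambda>_. a"])
      (auto simp: path_def pathstart_def pathfinish_def path_image_def)
  then have "l 1 = l 0"
    using nullhomotopic_loop_circle_lift[OF _ assms(2,3)] l unfolding path_def by blast
  then show ?thesis using l by (simp add: pathstart_def pathfinish_def)
qed

lemma reversepath_apply: "reversepath g s = g (1 - s)"
  by (simp add: reversepath_def)

text \<open>Out along one path and back along the other is a loop, on which the continued argument
  returns to 0.\<close>

lemma circle_path_lift_unique:
  assumes "simply_connected X" "continuous_on X \<phi>" "\<And>x. x \<in> X \<Longrightarrow> norm (\<phi> x) = 1"
    and t: "circle_path_lift X \<phi> a x t" and t': "circle_path_lift X \<phi> a x t'"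
  shows "t = t'"
proof -
  obtain c l where c: "path c" "path_image c \<subseteq> X" "pathstart c = a" "pathfinish c = x"
    and l: "path l" "pathstart l = 0" "pathfinish l = t'" "\<And>s. s \<in> {0..1} \<Longrightarrow> \<phi> (c s) = cis (l s)"
    using t' by (auto simp: circle_path_lift_def)
  have "circle_path_lift X \<phi> a (pathfinish (reversepath c))
      (t + pathfinish (reversepath l) - pathstart (reversepath l))"
    by (rule circle_path_lift_extend[OF t]) (use c l in \<open>auto simp: reversepath_apply\<close>)
  then have "circle_path_lift X \<phi> a a (t - t')" using c l by simp
  then show ?thesis using circle_path_lift_loop[OF assms(1-3)] by fastforce
qed

theorem simply_connected_circle_lift:
  fixes X :: "'a::topological_space set"
  assumes X: "simply_connected X" "locally path_connected X" and \<phi>: "continuous_on X \<phi>"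
    and norm: "\<And>x. x \<in> X \<Longrightarrow> norm (\<phi> x) = 1" and a: "a \<in> X" "\<phi> a = 1"
  obtains \<theta> where "continuous_on X \<theta>" "\<theta> a = 0" "\<And>x. x \<in> X \<Longrightarrow> \<phi> x = cis (\<theta> x)"
proof -
  let ?P = "circle_path_lift X \<phi> a"
  have base: "?P a 0" unfolding circle_path_lift_def
    by (rule exI[of _ "\<lambda>_. a"], rule exI[of _ "\<lambda>_. 0"])
      (use a in \<open>auto simp: path_def pathstart_def pathfinish_def path_image_def\<close>)
  have ex: "\<exists>t. ?P x t" if x: "x \<in> X" for x
  proof -
    have "path_connected X" using X(1) by (rule simply_connected_path_connected)
    then obtain d where d: "path d" "path_image d \<subseteq> X" "pathstart d = a" "pathfinish d = x"
      using a x unfolding path_connected_def by blast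
    have "continuous_on {0..1} (\<lambda>s. \<phi> (d s))"
      using continuous_on_compose2[OF \<phi>, of "{0..1}" d] d by (auto simp: path_def path_image_def)
    moreover have "norm (\<phi> (d s)) = 1" if "s \<in> {0..1}" for s
      using norm[of "d s"] d(2) that unfolding path_image_def by blast
    ultimately obtain m where "continuous_on {0..1::real} m" "\<And>s. s \<in> {0..1} \<Longrightarrow> \<phi> (d s) = cis (m s)"
      using convex_circle_lift[of "{0..1::real}"] by auto
    then show ?thesis
      using circle_path_lift_extend[OF base d(1-3), of m] d(4) by (auto simp: path_def)
  qed
  define \<theta> where "\<theta> x = (THE t. ?P x t)" for x
  have eq: "?P x t \<Longrightarrow> \<theta> x = t" for x t
    unfolding \<theta>_def using circle_path_lift_unique[OF X(1) \<phi> norm] by blast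
  have P: "x \<in> X \<Longrightarrow> ?P x (\<theta> x)" for x using ex eq by metis
  have cis: "\<phi> x = cis (\<theta> x)" if "x \<in> X" for x
    using P[OF that] unfolding circle_path_lift_def pathfinish_def by force
  have "continuous_on X \<theta>"
  proof (rule continuous_on_locally)
    fix x assume x: "x \<in> X"
    \<comment> \<open>Within a half plane around the value at \<open>x\<close> the principal
      logarithm is continuous, and it describes the continued argument on a path-connected
      neighbourhood.\<close>
    define W where "W = X \<inter> (\<lambda>y. Re (\<phi> y / \<phi> x)) -` {0<..}"
    have nz: "\<phi> x \<noteq> 0" using norm[OF x] by auto
    have contq: "continuous_on Y (\<lambda>y. \<phi> y / \<phi> x)" if "Y \<subseteq> X" for Y
      using continuous_on_subset[OF \<phi> that] nz by (intro continuous_intros) auto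
    have "openin (top_of_set X) W" unfolding W_def
      by (intro continuous_openin_preimage_gen continuous_on_Re contq) auto
    moreover have "x \<in> W" using x nz by (simp add: W_def)
    ultimately obtain U where U: "openin (top_of_set X) U" "path_connected U" "x \<in> U" "U \<subseteq> W"
      using X(2) unfolding locally_path_connected by blast
    have pos: "\<phi> y / \<phi> x \<notin> \<real>\<^sub>\<le>\<^sub>0" "\<phi> y / \<phi> x \<noteq> 0" if "y \<in> U" for y
      using that U(4) by (auto simp: W_def complex_nonpos_Reals_iff)
    have UX: "U \<subseteq> X" using U(4) by (auto simp: W_def)
    have "continuous_on U (\<lambda>y. \<theta> x + Im (Ln (\<phi> y / \<phi> x)))"
      by (intro continuous_intros contq[OF UX] pos)
    moreover have "\<theta> x + Im (Ln (\<phi> y / \<phi> x)) = \<theta> y" if y: "y \<in> U" for y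
    proof -
      obtain d where d: "path d" "path_image d \<subseteq> U" "pathstart d = x" "pathfinish d = y"
        using U y unfolding path_connected_def by blast
      define m where "m = (\<lambda>s. \<theta> x + Im (Ln (\<phi> (d s) / \<phi> x)))"
      have dU: "d s \<in> U" if "s \<in> {0..1}" for s using d that by (auto simp: path_image_def)
      have "continuous_on {0..1} d" using d by (simp add: path_def)
      then have "continuous_on {0..1} (\<lambda>s. \<phi> (d s) / \<phi> x)"
        by (rule continuous_on_compose2[OF contq[OF UX]]) (use dU in auto)
      then have "path m" unfolding m_def path_def using pos dU
        by (intro continuous_on_add continuous_on_const continuous_on_Im continuous_on_Ln') auto
      moreover have "\<phi> (d s) = cis (m s)" if "s \<in> {0..1}" for s
      proof -
        let ?z = "\<phi> (d s) / \<phi> x"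
        have "norm ?z = 1" using norm UX dU[OF that] x by (simp add: norm_divide subset_iff)
        then have "Re (Ln ?z) = 0" using Re_Ln[OF pos(2)[OF dU[OF that]]] by (simp only: ln_one)
        then have "exp (Ln ?z) = cis (Im (Ln ?z))" by (simp add: exp_eq_polar)
        then have "cis (Im (Ln ?z)) = ?z" using pos(2)[OF dU[OF that]] by simp
        then show ?thesis using nz cis[OF x] by (simp add: m_def cis_mult[symmetric])
      qed
      ultimately have "?P (pathfinish d) (\<theta> x + pathfinish m - pathstart m)"
        using d UX by (intro circle_path_lift_extend[OF P[OF x]]) auto
      moreover have "pathstart m = \<theta> x" using d(3) nz by (simp add: m_def pathstart_def)
      moreover have "pathfinish m = \<theta> x + Im (Ln (\<phi> y / \<phi> x))" using d(4) by (simp add: m_def pathfinish_def)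
      ultimately show ?thesis using eq d(4) by fastforce
    qed
    ultimately have "continuous_on U \<theta>" using continuous_on_eq by blast
    then show "\<exists>U. openin (top_of_set X) U \<and> x \<in> U \<and> continuous_on U \<theta>" using U by blast
  qed
  then show ?thesis using that eq[OF base] cis by blast
qed

section \<open>Lifting through the universal covering\<close>

text \<open>The centre is fixed at 0: lifts are normalized there, and the subdivision points
  \<open>(k / N) x\<close> of the lifting construction must stay in the set.\<close>

definition star_shaped :: "'a::real_vector set \<Rightarrow> bool" where
  "star_shaped C \<longleftrightarrow> 0 \<in> C \<and> (\<forall>x\<in>C. \<forall>t\<in>{0..1}. t *\<^sub>R x \<in> C)"

lemma star_shaped_connected:
  fixes C :: "'a::real_normed_vector set"
  assumes "star_shaped C" shows "connected C"
proof (rule starlike_imp_connected)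
  have "closed_segment 0 x \<subseteq> C" if "x \<in> C" for x
    using assms that by (auto simp: star_shaped_def closed_segment_def)
  then show "starlike C" using assms by (auto simp: starlike_def star_shaped_def)
qed

locale Sp_cover =
  fixes G :: "'g::topological_space monoid" (structure)
    and p :: "'g \<Rightarrow> real^('n::finite + 'n)^('n + 'n)"
  assumes cover: "universal_covering_of_Sp G p"

sublocale Sp_cover \<subseteq> group G
  using cover by (simp add: universal_covering_of_Sp_def topological_group_def)

context Sp_cover
begin

section \<open>The covering homomorphism, its local section and uniqueness of lifts\<close>

lemma p_in_Sp: "g \<in> carrier G \<Longrightarrow> p g \<in> Sp"
  using cover by (auto simp: universal_covering_of_Sp_def hom_def Sp_group_def)

lemma p_mult: "g \<in> carrier G \<Longrightarrow> h \<in> carrier G \<Longrightarrow> p (g \<otimes> h) = p g ** p h"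
  using cover by (auto simp: universal_covering_of_Sp_def hom_def Sp_group_def)

lemma group_hom_p: "group_hom G Sp_group p"
  using cover group_Sp_group is_group
  by (auto simp: group_hom_def group_hom_axioms_def universal_covering_of_Sp_def)

lemma p_one: "p \<one> = mat 1"
  using group_hom.hom_one[OF group_hom_p] by (simp add: Sp_group_def)

lemma p_inv: "g \<in> carrier G \<Longrightarrow> p (inv g) = matrix_inv (p g)"
  using group_hom.hom_inv[OF group_hom_p] by (simp add: inv_Sp_group p_in_Sp)

lemma p_covering: "covering_space (carrier G) p Sp"
  using cover by (simp add: universal_covering_of_Sp_def)

lemma p_surj: "M \<in> Sp \<Longrightarrow> \<exists>g\<in>carrier G. p g = M"
  unfolding covering_space_imp_surjective[OF p_covering, symmetric] by auto

lemma continuous_on_p: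
  assumes "continuous_on S f" "\<And>x. x \<in> S \<Longrightarrow> f x \<in> carrier G"
  shows "continuous_on S (\<lambda>x. p (f x))"
  by (rule continuous_on_compose2[of "carrier G" p]) (use assms p_covering in \<open>auto simp: covering_space_def\<close>)

lemma continuous_on_mult:
  assumes "continuous_on S f" "continuous_on S g"
    "\<And>x. x \<in> S \<Longrightarrow> f x \<in> carrier G" "\<And>x. x \<in> S \<Longrightarrow> g x \<in> carrier G"
  shows "continuous_on S (\<lambda>x. f x \<otimes> g x)"
proof -
  have "continuous_on (carrier G \<times> carrier G) (\<lambda>(x, y). x \<otimes> y)"
    using cover by (simp add: universal_covering_of_Sp_def topological_group_def)
  then have "continuous_on S (\<lambda>x. (\<lambda>(x, y). x \<otimes> y) (f x, g x))"
    by (rule continuous_on_compose2) (use assms in \<open>auto intro!: continuous_intros\<close>)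
  then show ?thesis by simp
qed

lemma continuous_on_inv:
  assumes "continuous_on S f" "\<And>x. x \<in> S \<Longrightarrow> f x \<in> carrier G"
  shows "continuous_on S (\<lambda>x. inv (f x))"
  by (rule continuous_on_compose2[of "carrier G" "m_inv G"])
    (use assms cover in \<open>auto simp: universal_covering_of_Sp_def topological_group_def\<close>)

text \<open>The inverse of \<open>p\<close> on the sheet through the unit. Translated by group
  elements, this single section serves at every point.\<close>

lemma local_section:
  obtains V s where "openin (top_of_set Sp) V" "mat 1 \<in> V" "continuous_on V s"
    "openin (top_of_set (carrier G)) (s ` V)" "\<And>v. v \<in> V \<Longrightarrow> p (s v) = v"
    "s (mat 1) = \<one>" "\<And>v. v \<in> V \<Longrightarrow> s v \<in> carrier G"
proof -
  obtain V \<U> where V: "mat 1 \<in> V" "openin (top_of_set Sp) V" and \<U>: "\<Union>\<U> = carrier G \<inter> p -` V"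
      "\<And>u. u \<in> \<U> \<Longrightarrow> openin (top_of_set (carrier G)) u" "\<And>u. u \<in> \<U> \<Longrightarrow> \<exists>q. homeomorphism u V p q"
    using p_covering Sp_one unfolding covering_space_def by metis
  have "\<one> \<in> \<Union>\<U>" using V by (simp add: \<U>(1) p_one)
  then obtain u s where u: "u \<in> \<U>" "\<one> \<in> u" and s: "homeomorphism u V p s" using \<U>(3) by blast
  have im: "s ` V = u" using s by (simp add: homeomorphism_def)
  show ?thesis
  proof (rule that[OF V(2) V(1)])
    show "continuous_on V s" "\<And>v. v \<in> V \<Longrightarrow> p (s v) = v" using s by (auto simp: homeomorphism_def)
    show "openin (top_of_set (carrier G)) (s ` V)" using im \<U>(2) u by simp
    have "s (p \<one>) = \<one>" using s u by (simp add: homeomorphism_def)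
    then show "s (mat 1) = \<one>" by (simp add: p_one)
    show "\<And>v. v \<in> V \<Longrightarrow> s v \<in> carrier G" using im \<U>(1) u by blast
  qed
qed

text \<open>The kernel of \<open>p\<close> is discrete: the sheet of \<open>local_section\<close>
  meets it only in the unit, so \<open>k\<close> is locally constant.\<close>

lemma kernel_map_constant:
  fixes k :: "'a::topological_space \<Rightarrow> 'g"
  assumes "connected T" "continuous_on T k" and k: "\<And>x. x \<in> T \<Longrightarrow> k x \<in> carrier G"
    and pk: "\<And>x. x \<in> T \<Longrightarrow> p (k x) = mat 1" and "x \<in> T" "y \<in> T"
  shows "k x = k y"
proof -
  obtain V s where s: "openin (top_of_set (carrier G)) (s ` V)" "mat 1 \<in> V"
      "\<And>v. v \<in> V \<Longrightarrow> p (s v) = v" "s (mat 1) = \<one>"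
    using local_section by metis
  have "k constant_on T"
  proof (rule locally_constant_imp_constant[OF assms(1)])
    fix a assume a: "a \<in> T"
    let ?U = "T \<inter> (\<lambda>x. inv (k a) \<otimes> k x) -` (s ` V)"
    have "openin (top_of_set T) ?U"
      by (rule continuous_openin_preimage[OF _ _ s(1)])
        (use k a in \<open>auto intro!: continuous_on_mult assms(2)\<close>)
    moreover have "\<one> \<in> s ` V" using s by (metis imageI)
    then have "a \<in> ?U" using a k by (simp add: l_inv)
    moreover have "k x = k a" if "x \<in> ?U" for x
    proof -
      have x: "x \<in> T" using that by blast
      have "inv (k a) \<otimes> k x \<in> s ` V" using that by simp
      then obtain v where v: "v \<in> V" "inv (k a) \<otimes> k x = s v" by blast
      have "v = p (inv (k a) \<otimes> k x)" using v s(3) by simp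
      also have "\<dots> = mat 1" using k[OF a] k[OF x] pk[OF a] pk[OF x] by (simp add: p_mult p_inv)
      finally have "inv (k a) \<otimes> k x = \<one>" using v s(4) by simp
      then show ?thesis using k[OF a] k[OF x] by (metis inv_equality inv_inv inv_closed)
    qed
    ultimately show "\<exists>U. openin (top_of_set T) U \<and> a \<in> U \<and> (\<forall>x\<in>U. k x = k a)" by blast
  qed
  then show ?thesis using assms(5,6) unfolding constant_on_def by metis
qed

text \<open>The quotient of two lifts maps into the discrete kernel.\<close>

lemma lift_unique:
  fixes f g :: "'a::topological_space \<Rightarrow> 'g"
  assumes "connected T" "continuous_on T f" "continuous_on T g"
    and f: "\<And>x. x \<in> T \<Longrightarrow> f x \<in> carrier G" and g: "\<And>x. x \<in> T \<Longrightarrow> g x \<in> carrier G"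
    and eq: "\<And>x. x \<in> T \<Longrightarrow> p (f x) = p (g x)" and "a \<in> T" "f a = g a" and "x \<in> T"
  shows "f x = g x"
proof -
  have "inv (f x) \<otimes> g x = inv (f a) \<otimes> g a"
    by (rule kernel_map_constant[OF assms(1)])
      (use assms in \<open>auto intro!: continuous_on_mult continuous_on_inv simp: p_mult p_inv Sp_matrix_inv(4) p_in_Sp\<close>)
  then have "inv (f x) \<otimes> g x = \<one>" using assms by (simp add: l_inv)
  then show ?thesis using f g assms(9) by (metis inv_equality inv_inv inv_closed)
qed

text \<open>Commutation of matrices lifts to the covering group: \<open>z \<otimes> t\<close> and
  \<open>t \<otimes> z\<close> are lifts of the same map of \<open>t\<close> that agree at the
  unit.\<close>

lemma commute_connected:
  assumes T: "connected T" "T \<subseteq> carrier G" "\<one> \<in> T" and z: "z \<in> carrier G"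
    and comm: "\<And>t. t \<in> T \<Longrightarrow> p z ** p t = p t ** p z" and t: "t \<in> T"
  shows "z \<otimes> t = t \<otimes> z"
  by (rule lift_unique[of T "\<lambda>t. z \<otimes> t" "\<lambda>t. t \<otimes> z" \<one>])
    (use assms in \<open>auto intro!: continuous_on_mult continuous_intros simp: p_mult subset_iff\<close>)

text \<open>The library's lifting theorems need a covering space inside a normed vector space. For a group
  the lift at \<open>x\<close> is an explicit product: a local section applied to \<open>f(kx/N)\<^sup>-\<^sup>1 f((k+1)x/N)\<close> for
  \<open>k < N\<close>, with \<open>N\<close> uniform by compactness.\<close>

lemma lift_compact_star_shaped:
  fixes f :: "'a::real_normed_vector \<Rightarrow> real^('n + 'n)^('n + 'n)"
  assumes star: "star_shaped C" and C: "compact C" and contf: "continuous_on C f"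
    and f: "\<And>x. x \<in> C \<Longrightarrow> f x \<in> Sp" "f 0 = mat 1"
  obtains F where "continuous_on C F" "\<And>x. x \<in> C \<Longrightarrow> F x \<in> carrier G"
    "\<And>x. x \<in> C \<Longrightarrow> p (F x) = f x" "F 0 = \<one>"
proof -
  obtain V s where V: "openin (top_of_set Sp) V" "mat 1 \<in> V" and s: "continuous_on V s"
      "\<And>v. v \<in> V \<Longrightarrow> p (s v) = v" "s (mat 1) = \<one>" "\<And>v. v \<in> V \<Longrightarrow> s v \<in> carrier G"
    using local_section by metis
  obtain e where e: "e > 0" "ball (mat 1) e \<inter> Sp \<subseteq> V"
    using V unfolding openin_contains_ball by blast
  \<comment> \<open>This quotient is the unit on the diagonal, so uniform continuity puts the
    quotients over short steps into \<open>V\<close>.\<close>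
  define h where "h = (\<lambda>z. matrix_inv (f (fst z)) ** f (snd z))"
  have "continuous_on (C \<times> C) (\<lambda>z. f (fst z))" "continuous_on (C \<times> C) (\<lambda>z. f (snd z))"
    by (rule continuous_on_compose2[OF contf]; auto intro!: continuous_intros)+
  then have conth: "continuous_on (C \<times> C) h"
    unfolding h_def using f by (intro continuous_intros) auto
  then have "uniformly_continuous_on (C \<times> C) h"
    by (intro compact_uniformly_continuous compact_Times C)
  then obtain d where d: "d > 0" "\<And>z z'. z \<in> C \<times> C \<Longrightarrow> z' \<in> C \<times> C \<Longrightarrow> dist z' z < d \<Longrightarrow> dist (h z') (h z) < e"
    using e(1) unfolding uniformly_continuous_on_def by metis
  obtain B where B: "B > 0" "\<And>x. x \<in> C \<Longrightarrow> norm x \<le> B"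
    using compact_imp_bounded[OF C] bounded_pos by metis
  obtain N :: nat where "B / d < N" using reals_Archimedean2 by blast
  moreover have "0 < B / d" using d(1) B(1) by simp
  ultimately have "0 < real N" "B < N * d" using d(1) by (linarith, simp add: pos_divide_less_eq)
  then have N: "B < N * d" "N > 0" by simp_all
  define y where "y = (\<lambda>k x. (real k / N) *\<^sub>R (x :: 'a))"
  define q where "q = (\<lambda>k x. h (y k x, y (Suc k) x))"
  have yC: "y k x \<in> C" if "k \<le> N" "x \<in> C" for k x
    using star that N unfolding star_shaped_def y_def by simp
  have conty: "continuous_on C (y k)" for k unfolding y_def by (intro continuous_intros)
  have qV: "q k x \<in> V" if k: "k < N" and x: "x \<in> C" for k x
  proof -
    have "dist (y k x, y (Suc k) x) (y k x, y k x) = norm (y (Suc k) x - y k x)"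
      by (simp add: dist_prod_def dist_norm)
    also have "y (Suc k) x - y k x = (1 / N) *\<^sub>R x"
      by (simp add: y_def scaleR_diff_left[symmetric] diff_divide_distrib[symmetric])
    also have "norm \<dots> < d"
      using B(2)[OF x] N by (simp add: field_simps)
    finally have "dist (q k x) (h (y k x, y k x)) < e"
      unfolding q_def using k x yC by (intro d(2)) auto
    moreover have "h (y k x, y k x) = mat 1"
      using f(1)[OF yC] k x by (simp add: h_def Sp_matrix_inv(4))
    moreover have "q k x \<in> Sp"
      using f(1) yC k x by (auto simp: q_def h_def intro!: Sp_mult Sp_matrix_inv(2))
    ultimately show ?thesis using e(2) by (auto simp: dist_commute)
  qed
  define L where "L = rec_nat (\<lambda>x. \<one>) (\<lambda>k F x. F x \<otimes> s (q k x))"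
  have L: "L 0 x = \<one>" "L (Suc k) x = L k x \<otimes> s (q k x)" for k x by (simp_all add: L_def)
  have main: "k \<le> N \<Longrightarrow> continuous_on C (L k) \<and> (\<forall>x\<in>C. L k x \<in> carrier G \<and> p (L k x) = f (y k x))" for k
  proof (induction k)
    case 0
    have "L 0 = (\<lambda>x. \<one>)" by (simp add: L_def)
    then show ?case by (simp add: p_one y_def f)
  next
    case (Suc k)
    then have IH: "continuous_on C (L k)" "\<And>x. x \<in> C \<Longrightarrow> L k x \<in> carrier G"
        "\<And>x. x \<in> C \<Longrightarrow> p (L k x) = f (y k x)" and k: "k < N" by auto
    have "continuous_on C (q k)"
      unfolding q_def by (rule continuous_on_compose2[OF conth])
        (use k yC in \<open>auto intro!: continuous_intros conty\<close>)
    then have "continuous_on C (\<lambda>x. s (q k x))"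
      by (rule continuous_on_compose2[OF s(1)]) (use qV k in auto)
    then have "continuous_on C (L (Suc k))"
      unfolding L(2)[abs_def] using IH qV k s by (intro continuous_on_mult) auto
    moreover have "p (L (Suc k) x) = f (y (Suc k) x)" if "x \<in> C" for x
    proof -
      have "p (L (Suc k) x) = f (y k x) ** (matrix_inv (f (y k x)) ** f (y (Suc k) x))"
        using that IH qV k s by (simp add: L p_mult) (simp add: q_def h_def)
      then show ?thesis using f(1)[OF yC] k that by (simp add: matrix_mul_assoc Sp_matrix_inv(3))
    qed
    moreover have "L (Suc k) x \<in> carrier G" if "x \<in> C" for x using that IH qV k s by (simp add: L)
    ultimately show ?case by blast
  qed
  have "y N x = x" for x using N by (simp add: y_def)
  moreover have "L k 0 = \<one>" for k
    by (induction k) (simp_all add: L q_def h_def y_def f s)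
  ultimately show ?thesis using main[of N] by (intro that[of "L N"]) auto
qed

text \<open>The set is exhausted by its intersections with balls; the compact lifts on them agree by
  uniqueness.\<close>

lemma lift_closed_star_shaped:
  fixes f :: "'a::euclidean_space \<Rightarrow> real^('n + 'n)^('n + 'n)"
  assumes star: "star_shaped C" and C: "closed C" and contf: "continuous_on C f"
    and f: "\<And>x. x \<in> C \<Longrightarrow> f x \<in> Sp" "f 0 = mat 1"
  obtains F where "continuous_on C F" "\<And>x. x \<in> C \<Longrightarrow> F x \<in> carrier G"
    "\<And>x. x \<in> C \<Longrightarrow> p (F x) = f x" "F 0 = \<one>"
proof -
  define B where "B n = C \<inter> cball 0 (real n)" for n
  have starB: "star_shaped (B n)" for n
    unfolding star_shaped_def
  proof (intro conjI ballI)
    show "0 \<in> B n" using star by (simp add: star_shaped_def B_def)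
    fix x t assume x: "x \<in> B n" and t: "t \<in> {0..1::real}"
    have "norm (t *\<^sub>R x) \<le> 1 * norm x" unfolding norm_scaleR using t by (intro mult_right_mono) auto
    then show "t *\<^sub>R x \<in> B n" using star x t by (simp add: star_shaped_def B_def)
  qed
  have "\<exists>F. continuous_on (B n) F \<and> (\<forall>x\<in>B n. F x \<in> carrier G \<and> p (F x) = f x) \<and> F 0 = \<one>" for n
  proof -
    have "compact (B n)" unfolding B_def by (rule closed_Int_compact[OF C compact_cball])
    moreover have "continuous_on (B n) f" using contf by (rule continuous_on_subset) (auto simp: B_def)
    ultimately obtain F where "continuous_on (B n) F" "\<And>x. x \<in> B n \<Longrightarrow> F x \<in> carrier G"
        "\<And>x. x \<in> B n \<Longrightarrow> p (F x) = f x" "F 0 = \<one>"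
      using lift_compact_star_shaped[OF starB, of n f] f by (auto simp: B_def)
    then show ?thesis by blast
  qed
  then obtain F where F: "\<And>n. continuous_on (B n) (F n)" "\<And>n x. x \<in> B n \<Longrightarrow> F n x \<in> carrier G"
      "\<And>n x. x \<in> B n \<Longrightarrow> p (F n x) = f x" "\<And>n. F n 0 = \<one>"
    by metis
  have agree: "F m x = F n x" if "x \<in> B m" "m \<le> n" for m n x
  proof (rule lift_unique[of "B m" _ _ 0])
    have sub: "B m \<subseteq> B n" using that(2) by (auto simp: B_def)
    show "continuous_on (B m) (F n)" using F(1) sub continuous_on_subset by blast
    show "connected (B m)" "0 \<in> B m" using star_shaped_connected starB by (auto simp: star_shaped_def)
    show "\<And>x. x \<in> B m \<Longrightarrow> F n x \<in> carrier G" "\<And>x. x \<in> B m \<Longrightarrow> p (F m x) = p (F n x)"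
      using F sub by auto
  qed (use F that in auto)
  define H where "H x = F (nat \<lceil>norm x\<rceil>) x" for x
  have mem: "x \<in> B (nat \<lceil>norm x\<rceil>)" if "x \<in> C" for x using that by (simp add: B_def)
  have "continuous_on C H"
  proof (rule continuous_on_locally)
    fix x assume x: "x \<in> C"
    \<comment> \<open>One more than the rounded norm, so that the open ball of radius
      \<open>n\<close> is a neighbourhood of \<open>x\<close> on which a single lift serves.\<close>
    define n where "n = Suc (nat \<lceil>norm x\<rceil>)"
    have eq: "F n y = H y" if "y \<in> C" "norm y < n" for y
      unfolding H_def by (rule agree[OF mem, symmetric]) (use that in \<open>auto simp: nat_le_iff ceiling_le_iff\<close>)
    have "continuous_on (C \<inter> ball 0 n) (F n)"
      by (rule continuous_on_subset[OF F(1)]) (auto simp: B_def)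
    then have "continuous_on (C \<inter> ball 0 n) H" by (rule continuous_on_eq) (use eq in auto)
    moreover have "openin (top_of_set C) (C \<inter> ball 0 (real n))" by (simp add: openin_open_Int)
    moreover have "norm x < real n" unfolding n_def by linarith
    then have "x \<in> C \<inter> ball 0 (real n)" using x by simp
    ultimately show "\<exists>U. openin (top_of_set C) U \<and> x \<in> U \<and> continuous_on U H" by blast
  qed
  moreover have "H x \<in> carrier G" "p (H x) = f x" if "x \<in> C" for x
    using F(2,3)[OF mem[OF that]] by (simp_all add: H_def)
  moreover have "H 0 = \<one>" by (simp add: H_def F)
  ultimately show ?thesis using that by blast
qed

lemma one_parameter_lift:
  fixes m :: "real \<Rightarrow> real^('n + 'n)^('n + 'n)"
  assumes "continuous_on UNIV m" "\<And>a. m a \<in> Sp" "m 0 = mat 1" "\<And>a b. m (a + b) = m a ** m b"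
  obtains r where "continuous_on UNIV r" "\<And>a. r a \<in> carrier G" "\<And>a. p (r a) = m a" "r 0 = \<one>"
    "\<And>a b. r (a + b) = r a \<otimes> r b"
proof -
  obtain r where r: "continuous_on UNIV r" "\<And>a. r a \<in> carrier G" "\<And>a. p (r a) = m a" "r 0 = \<one>"
    using lift_closed_star_shaped[of UNIV m] assms by (auto simp: star_shaped_def)
  have "r (a + b) = r a \<otimes> r b" for a b
  proof (rule lift_unique[of UNIV "\<lambda>b. r (a + b)" "\<lambda>b. r a \<otimes> r b" 0])
    show "continuous_on UNIV (\<lambda>b. r (a + b))"
      by (rule continuous_on_compose2[OF r(1)]) (auto intro!: continuous_intros)
  qed (use r assms in \<open>auto intro!: continuous_on_mult continuous_intros simp: p_mult\<close>)
  then show ?thesis using that r by blast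
qed

text \<open>A path from the unit to \<open>g\<close> is projected, deformed into U(n) by the polar
  homotopy, and the whole square is lifted. The end points stay put, because their images are
  unitary and do not move under the homotopy.\<close>

lemma unitary_path:
  assumes g: "g \<in> carrier G" "p g \<in> unitary_Sp"
  obtains c where "path c" "pathstart c = \<one>" "pathfinish c = g"
    "\<And>t. t \<in> {0..1} \<Longrightarrow> c t \<in> carrier G" "\<And>t. t \<in> {0..1} \<Longrightarrow> p (c t) \<in> unitary_Sp"
proof -
  have "path_connected (carrier G)"
    using cover by (simp add: universal_covering_of_Sp_def simply_connected_path_connected)
  then obtain b where b: "path b" "path_image b \<subseteq> carrier G" "pathstart b = \<one>" "pathfinish b = g"
    using g unfolding path_connected_def by blast
  have contb: "continuous_on {0..1} b" using b by (simp add: path_def)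
  have bG: "b s \<in> carrier G" if "s \<in> {0..1}" for s using b that by (auto simp: path_image_def)
  have b01: "b 0 = \<one>" "b 1 = g" using b by (auto simp: pathstart_def pathfinish_def)
  define C where "C = {0..1::real} \<times> {0..1::real}"
  \<comment> \<open>Time is reversed so that the edge through the centre 0 of the square carries the
    given path.\<close>
  define f where "f z = polar_homotopy (1 - fst z) (p (b (snd z)))" for z
  have star: "star_shaped C" by (auto simp: star_shaped_def C_def mult_le_one zero_prod_def)
  have "continuous_on C (\<lambda>z. b (snd z))"
    by (rule continuous_on_compose2[OF contb]) (auto simp: C_def intro!: continuous_intros)
  then have contf: "continuous_on C f" unfolding f_def
    by (intro continuous_on_polar_homotopy continuous_on_p continuous_intros)
      (use bG p_in_Sp in \<open>auto simp: C_def\<close>)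
  have "f z \<in> Sp" if "z \<in> C" for z
    using that bG p_in_Sp by (auto simp: f_def C_def intro!: polar_homotopy_in_Sp)
  moreover have "f 0 = mat 1" by (simp add: f_def b01 p_one polar_homotopy_1 Sp_one)
  moreover have "compact C" unfolding C_def by (intro compact_Times) auto
  ultimately obtain F where F: "continuous_on C F" "\<And>z. z \<in> C \<Longrightarrow> F z \<in> carrier G"
      "\<And>z. z \<in> C \<Longrightarrow> p (F z) = f z" "F 0 = \<one>"
    using lift_compact_star_shaped[OF star _ contf] by metis
  have row: "continuous_on {0..1} (\<lambda>s. F (t, s))" "continuous_on {0..1} (\<lambda>s. F (s, t))" if "t \<in> {0..1}" for t
    by (rule continuous_on_compose2[OF F(1)]; use that in \<open>force simp: C_def intro!: continuous_intros\<close>)+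
  have "F (0, s) = b s" if "s \<in> {0..1}" for s
    by (rule lift_unique[of "{0..1}" "\<lambda>s. F (0, s)" b 0])
      (use F that row contb bG b01 in \<open>auto simp: C_def f_def polar_homotopy_1 p_in_Sp zero_prod_def\<close>)
  moreover have "F (1, 1) = F (0, 1)"
    by (rule lift_unique[of "{0..1}" "\<lambda>s. F (s, 1)" "\<lambda>s. F (0, 1)" 0])
      (use F row b01 unitary_SpD(2)[OF g(2)] in \<open>auto simp: C_def f_def polar_homotopy_orthogonal\<close>)
  moreover have "F (1, 0) = F (0, 0)"
    by (rule lift_unique[of "{0..1}" "\<lambda>s. F (s, 0)" "\<lambda>s. F (0, 0)" 0])
      (use F row b01 p_one in \<open>auto simp: C_def f_def polar_homotopy_orthogonal\<close>)
  ultimately have ends: "F (1, 0) = \<one>" "F (1, 1) = g" using b01 F(4) by (auto simp: zero_prod_def)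
  show ?thesis
  proof (rule that[of "\<lambda>s. F (1, s)"])
    show "path (\<lambda>s. F (1, s))" using row by (simp add: path_def)
    fix t :: real assume t: "t \<in> {0..1}"
    then show "F (1, t) \<in> carrier G" using F by (simp add: C_def)
    have "p (F (1, t)) = polar_unitary (p (b t))"
      using F(3)[of "(1, t)"] t bG p_in_Sp by (simp add: C_def f_def polar_homotopy_0)
    then show "p (F (1, t)) \<in> unitary_Sp" using t bG p_in_Sp polar_unitary_in_unitary_Sp by metis
  qed (use ends in \<open>auto simp: pathstart_def pathfinish_def\<close>)
qed

section \<open>The rotation angle on the universal covering\<close>

text \<open>The property is carried over from \<open>Sp\<close> by the local section, translated to
  \<open>g\<close>.\<close>

lemma locally_path_connected_carrier: "locally path_connected (carrier G)"
  unfolding locally_path_connected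
proof (intro allI impI, elim conjE)
  fix W g assume W: "openin (top_of_set (carrier G)) W" and gW: "g \<in> W"
  have g: "g \<in> carrier G" using W gW openin_imp_subset by blast
  obtain V s where V: "openin (top_of_set Sp) V" "mat 1 \<in> V" and s: "continuous_on V s"
      "openin (top_of_set (carrier G)) (s ` V)"
      "\<And>v. v \<in> V \<Longrightarrow> p (s v) = v" "s (mat 1) = \<one>" "\<And>v. v \<in> V \<Longrightarrow> s v \<in> carrier G"
    using local_section by metis
  have contgs: "continuous_on V (\<lambda>v. g \<otimes> s v)"
    using g s by (intro continuous_on_mult continuous_intros) auto
  let ?V = "V \<inter> (\<lambda>v. g \<otimes> s v) -` W"
  have "openin (top_of_set V) ?V"
    by (rule continuous_openin_preimage[OF contgs _ W]) (use g s in auto)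
  then have "openin (top_of_set Sp) ?V" using V(1) openin_trans by blast
  moreover have "mat 1 \<in> ?V" using V s g gW by simp
  ultimately obtain U where U: "openin (top_of_set Sp) U" "path_connected U" "mat 1 \<in> U" "U \<subseteq> ?V"
    using Sp_locally_path_connected unfolding locally_path_connected by blast
  have UV: "U \<subseteq> V" using U by blast
  have sU: "s ` U = s ` V \<inter> p -` U" using s(3) UV by (auto simp: image_iff)
  have "continuous_on (s ` V) p" using p_covering s(5) by (auto simp: covering_space_def intro: continuous_on_subset)
  moreover have "p \<in> s ` V \<rightarrow> Sp" using p_in_Sp s(5) by auto
  ultimately have "openin (top_of_set (s ` V)) (s ` U)"
    unfolding sU using continuous_openin_preimage U(1) by blast
  then have opsU: "openin (top_of_set (carrier G)) (s ` U)" using s(2) openin_trans by blast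
  let ?N = "(\<lambda>v. g \<otimes> s v) ` U"
  have "?N = carrier G \<inter> (\<lambda>x. inv g \<otimes> x) -` (s ` U)"
  proof
    show "?N \<subseteq> carrier G \<inter> (\<lambda>x. inv g \<otimes> x) -` (s ` U)"
      using UV s(5) g by (auto simp: m_assoc[symmetric] l_inv)
    show "carrier G \<inter> (\<lambda>x. inv g \<otimes> x) -` (s ` U) \<subseteq> ?N"
    proof clarify
      fix x v assume x: "x \<in> carrier G" "inv g \<otimes> x = s v" "v \<in> U"
      have "x = g \<otimes> s v" unfolding x(2)[symmetric] using x(1) g by (simp add: m_assoc[symmetric])
      then show "x \<in> ?N" using x(3) by blast
    qed
  qed
  moreover have "openin (top_of_set (carrier G)) (carrier G \<inter> (\<lambda>x. inv g \<otimes> x) -` (s ` U))"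
    by (rule continuous_openin_preimage[OF _ _ opsU]) (use g in \<open>auto intro!: continuous_on_mult continuous_intros\<close>)
  moreover have "path_connected ?N"
    using path_connected_continuous_image[OF continuous_on_subset[OF contgs UV] U(2)] .
  moreover have "g \<in> ?N" using U(3) s(4) g by force
  moreover have "?N \<subseteq> W" using U(4) by auto
  ultimately show "\<exists>U. openin (top_of_set (carrier G)) U \<and> path_connected U \<and> g \<in> U \<and> U \<subseteq> W"
    by metis
qed

definition angle :: "'g \<Rightarrow> real" where
  "angle = (SOME \<theta>. continuous_on (carrier G) \<theta> \<and> \<theta> \<one> = 0 \<and>
     (\<forall>g\<in>carrier G. circle_part (p g) = cis (\<theta> g)))"

lemma angle: 
  shows continuous_on_carrier_angle: "continuous_on (carrier G) angle"
    and angle_one: "angle \<one> = 0"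
    and cis_angle: "g \<in> carrier G \<Longrightarrow> cis (angle g) = circle_part (p g)"
proof -
  have "simply_connected (carrier G)" using cover by (simp add: universal_covering_of_Sp_def)
  moreover have "continuous_on (carrier G) (\<lambda>g. circle_part (p g))"
    by (intro continuous_on_circle_part continuous_on_p continuous_intros) (use p_in_Sp in auto)
  ultimately obtain \<theta> where "continuous_on (carrier G) \<theta>" "\<theta> \<one> = 0"
      "\<And>g. g \<in> carrier G \<Longrightarrow> circle_part (p g) = cis (\<theta> g)"
    using simply_connected_circle_lift[OF _ locally_path_connected_carrier, of "\<lambda>g. circle_part (p g)" \<one>]
      norm_circle_part p_in_Sp p_one circle_part_one by auto
  then have "\<exists>\<theta>. continuous_on (carrier G) \<theta> \<and> \<theta> \<one> = 0 \<and> (\<forall>g\<in>carrier G. circle_part (p g) = cis (\<theta> g))"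
    by blast
  then have "continuous_on (carrier G) angle \<and> angle \<one> = 0 \<and> (\<forall>g\<in>carrier G. circle_part (p g) = cis (angle g))"
    unfolding angle_def by (rule someI_ex)
  then show "continuous_on (carrier G) angle" "angle \<one> = 0"
      "g \<in> carrier G \<Longrightarrow> cis (angle g) = circle_part (p g)" by auto
qed

lemma continuous_on_angle:
  assumes "continuous_on S f" "\<And>x. x \<in> S \<Longrightarrow> f x \<in> carrier G"
  shows "continuous_on S (\<lambda>x. angle (f x))"
  by (rule continuous_on_compose2[OF continuous_on_carrier_angle]) (use assms in auto)

lemma connected_carrier: "connected (carrier G)"
  using cover by (simp add: universal_covering_of_Sp_def simply_connected_path_connected path_connected_imp_connected)

text \<open>As functions of \<open>g\<close> both sides are continuous arguments of the same
  circle-valued function, and they agree at the unit. Unitarity of \<open>p k\<close> enters through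
  \<open>circle_part_mult\<close>.\<close>

lemma angle_mult:
  assumes k: "k \<in> carrier G" "p k \<in> unitary_Sp" and g: "g \<in> carrier G"
  shows "angle (k \<otimes> g) = angle k + angle g"
proof -
  have "angle (k \<otimes> g) - (angle k + angle g) = angle (k \<otimes> \<one>) - (angle k + angle \<one>)"
  proof (rule cis_eq_imp_diff_constant[OF connected_carrier])
    show "continuous_on (carrier G) (\<lambda>g. angle (k \<otimes> g))"
      by (intro continuous_on_angle continuous_on_mult continuous_intros) (use k in auto)
    show "continuous_on (carrier G) (\<lambda>g. angle k + angle g)"
      by (intro continuous_intros continuous_on_carrier_angle)
    show "cis (angle (k \<otimes> x)) = cis (angle k + angle x)" if "x \<in> carrier G" for x
      using that k by (simp add: cis_angle p_mult circle_part_mult p_in_Sp cis_mult[symmetric])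
  qed (use g in auto)
  then show ?thesis using k by (simp add: angle_one)
qed

lemma angle_inv:
  assumes "k \<in> carrier G" "p k \<in> unitary_Sp"
  shows "angle (inv k) = - angle k"
  using angle_mult[OF assms, of "inv k"] assms by (simp add: angle_one)

lemma angle_curve:
  assumes r: "continuous_on S r" "\<And>a. a \<in> S \<Longrightarrow> r a \<in> carrier G" "r 0 = \<one>"
    and S: "connected S" "0 \<in> S" "a \<in> S" and c: "\<And>a. a \<in> S \<Longrightarrow> circle_part (p (r a)) = cis (c * a)"
  shows "angle (r a) = c * a"
proof -
  have "angle (r a) - c * a = angle (r 0) - c * 0"
    by (rule cis_eq_imp_diff_constant[OF S(1)])
      (use assms in \<open>auto intro!: continuous_on_angle continuous_intros simp: cis_angle\<close>)
  then show ?thesis using r by (simp add: angle_one)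
qed

end

section \<open>Unitary matrices fixing some of the basis vectors\<close>

lemma conj_transpose_mult: "conj_transpose (A ** B) = conj_transpose B ** conj_transpose A"
  by (simp add: conj_transpose_def matrix_matrix_mult_def vec_eq_iff mult.commute)

lemma conj_transpose_conj_transpose [simp]: "conj_transpose (conj_transpose A) = A"
  by (simp add: conj_transpose_def vec_eq_iff)

lemma conj_transpose_mat_1 [simp]: "conj_transpose (mat 1) = mat 1"
  by (simp add: conj_transpose_def vec_eq_iff mat_def)

lemma unitary_matricesD:
  "A \<in> unitary_matrices \<Longrightarrow> conj_transpose A ** A = mat 1"
  "A \<in> unitary_matrices \<Longrightarrow> A ** conj_transpose A = mat 1"
  by (auto simp: unitary_matrices_def)

lemma unitary_matrices_mult:
  assumes "A \<in> unitary_matrices" "B \<in> unitary_matrices" shows "A ** B \<in> unitary_matrices"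
proof -
  have "conj_transpose (A ** B) ** (A ** B) = conj_transpose B ** (conj_transpose A ** A) ** B"
    by (simp only: conj_transpose_mult matrix_mul_assoc)
  moreover have "(A ** B) ** conj_transpose (A ** B) = A ** (B ** conj_transpose B) ** conj_transpose A"
    by (simp only: conj_transpose_mult matrix_mul_assoc)
  ultimately show ?thesis using assms by (simp add: unitary_matrices_def)
qed

lemma unitary_matrices_conj_transpose: "A \<in> unitary_matrices \<Longrightarrow> conj_transpose A \<in> unitary_matrices"
  by (simp add: unitary_matrices_def)

lemma mat_1_unitary: "mat 1 \<in> unitary_matrices"
  by (simp add: unitary_matrices_def)

text \<open>A copy of U(k), where k is the number of elements of \<open>S\<close>; enlarging
  \<open>S\<close> by one index gives the tower of sphere fibrations.\<close>

definition fixing_unitaries :: "'n set \<Rightarrow> (complex^'n::finite^'n) set" where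
  "fixing_unitaries S = {A \<in> unitary_matrices. \<forall>j. j \<notin> S \<longrightarrow> A *v axis j 1 = axis j 1}"

lemma fixing_unitaries_mult:
  "A \<in> fixing_unitaries S \<Longrightarrow> B \<in> fixing_unitaries S \<Longrightarrow> A ** B \<in> fixing_unitaries S"
  by (simp add: fixing_unitaries_def unitary_matrices_mult matrix_vector_mul_assoc[symmetric])

lemma fixing_unitaries_conj_transpose:
  assumes "A \<in> fixing_unitaries S" shows "conj_transpose A \<in> fixing_unitaries S"
proof -
  have A: "A \<in> unitary_matrices" using assms by (simp add: fixing_unitaries_def)
  have "conj_transpose A *v axis j 1 = axis j 1" if "j \<notin> S" for j
  proof -
    have "A *v axis j 1 = axis j 1" using assms that by (simp add: fixing_unitaries_def)
    then have "conj_transpose A *v axis j 1 = conj_transpose A *v (A *v axis j 1)" by simp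
    then show ?thesis by (simp only: matrix_vector_mul_assoc unitary_matricesD[OF A] matrix_vector_mul_lid)
  qed
  then show ?thesis using A by (simp add: fixing_unitaries_def unitary_matrices_conj_transpose)
qed

lemma mat_1_fixing: "mat 1 \<in> fixing_unitaries S"
  by (simp add: fixing_unitaries_def mat_1_unitary)

lemma fixing_unitaries_insert:
  "A \<in> fixing_unitaries (insert i S) \<Longrightarrow> A *v axis i 1 = axis i 1 \<Longrightarrow> A \<in> fixing_unitaries S"
  unfolding fixing_unitaries_def by (auto; metis)

lemma unitary_column_inner:
  assumes "A \<in> unitary_matrices"
  shows "(\<Sum>k\<in>UNIV. cnj (A $ k $ a) * A $ k $ b) = (if a = b then 1 else 0)"
proof -
  have "(conj_transpose A ** A) $ a $ b = mat 1 $ a $ b" by (simp only: unitary_matricesD[OF assms])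
  then show ?thesis by (simp add: matrix_matrix_mult_def conj_transpose_def mat_def)
qed

lemma sum_norm_square: "(\<Sum>k\<in>UNIV. v $ k * cnj (v $ k)) = complex_of_real ((norm v)\<^sup>2)"
  by (simp add: norm_vec_def L2_set_def sum_nonneg complex_norm_square[symmetric])

section \<open>Spheres on which the unitary groups of the tower act\<close>

definition coordinate_subspace :: "'n set \<Rightarrow> (complex^'n::finite) set" where
  "coordinate_subspace S = {v. \<forall>j. j \<notin> S \<longrightarrow> v $ j = 0}"

definition coordinate_sphere :: "'n set \<Rightarrow> (complex^'n::finite) set" where
  "coordinate_sphere S = sphere 0 1 \<inter> coordinate_subspace S"

lemma subspace_coordinate_subspace: "subspace (coordinate_subspace S)"
  by (auto simp: subspace_def coordinate_subspace_def)

lemma norm_axis_complex [simp]: "norm (axis i 1 :: complex^'n) = 1"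
  by (simp add: norm_eq_sqrt_inner inner_axis_axis)

lemma axis_nth: "axis i x $ j = (if j = i then x else 0)"
  by (simp add: axis_def)

lemma axis_in_coordinate_sphere:
  "i \<in> S \<Longrightarrow> axis i 1 \<in> coordinate_sphere S" "i \<in> S \<Longrightarrow> - axis i 1 \<in> coordinate_sphere S"
  by (auto simp: coordinate_sphere_def coordinate_subspace_def axis_nth)

text \<open>The column is orthogonal to the columns outside \<open>S\<close>, which are basis
  vectors, so its entries there vanish.\<close>

lemma fixing_unitaries_column:
  assumes A: "A \<in> fixing_unitaries S" and "i \<in> S"
  shows "A *v axis i 1 \<in> coordinate_sphere S"
proof -
  have u: "A \<in> unitary_matrices" using A by (simp add: fixing_unitaries_def)
  let ?c = "A *v axis i 1"
  have c: "?c $ k = A $ k $ i" for k by (simp add: matrix_vector_mult_axis column_def)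
  have "(\<Sum>k\<in>UNIV. ?c $ k * cnj (?c $ k)) = 1"
    using unitary_column_inner[OF u, of i i] by (simp add: c mult.commute)
  then have "complex_of_real ((norm ?c)\<^sup>2) = 1" by (simp only: sum_norm_square)
  then have "(norm ?c)\<^sup>2 = 1" using of_real_eq_1_iff by blast
  then have "norm ?c = 1" using norm_ge_zero[of ?c] unfolding power2_eq_1_iff by linarith
  moreover have "?c $ j = 0" if j: "j \<notin> S" for j
  proof -
    have "A *v axis j 1 = axis j 1" using A j by (simp add: fixing_unitaries_def)
    moreover have "A $ k $ j = (A *v axis j 1) $ k" for k
      by (simp add: matrix_vector_mult_axis column_def)
    ultimately have "A $ k $ j = (if k = j then 1 else 0)" for k by (simp add: axis_nth)
    then have "(\<Sum>k\<in>UNIV. (if k = j then A $ k $ i else 0)) = (if j = i then 1 else 0)"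
      using unitary_column_inner[OF u, of j i] by (simp add: if_distrib[of cnj] if_distrib[of "\<lambda>x. x * _"] cong: if_cong)
    then show ?thesis using j \<open>i \<in> S\<close> by (auto simp: c)
  qed
  ultimately show ?thesis by (simp add: coordinate_sphere_def coordinate_subspace_def)
qed

section \<open>Reflections as sections over punctured spheres\<close>

definition rank_one :: "complex^'n \<Rightarrow> complex \<Rightarrow> complex^'n^'n" where
  "rank_one u c = (\<chi> a b. c * u $ a * cnj (u $ b))"

lemma rank_one_mult:
  "rank_one u c ** rank_one u d = rank_one u (c * d * (\<Sum>k\<in>UNIV. u $ k * cnj (u $ k)))"
  by (simp add: rank_one_def matrix_matrix_mult_def vec_eq_iff sum_distrib_left sum_distrib_right mult_ac)

lemma rank_one_add: "rank_one u c + rank_one u d = rank_one u (c + d)"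
  by (simp add: rank_one_def vec_eq_iff algebra_simps)

lemma conj_transpose_rank_one: "conj_transpose (mat 1 + rank_one u c) = mat 1 + rank_one u (cnj c)"
  by (simp add: conj_transpose_def rank_one_def vec_eq_iff mat_def)

lemma rank_one_perturbation_mult:
  "(mat 1 + rank_one u c) ** (mat 1 + rank_one u d) =
    mat 1 + rank_one u (c + d + c * d * (\<Sum>k\<in>UNIV. u $ k * cnj (u $ k)))"
  by (simp add: matrix_add_ldistrib matrix_add_rdistrib rank_one_mult add.assoc rank_one_add add.commute)

lemma rank_one_axis: "rank_one u c *v axis j 1 = (\<chi> a. c * cnj (u $ j) * u $ a)"
  by (simp add: rank_one_def matrix_vector_mult_axis column_def mult_ac)

text \<open>The complex reflection that moves \<open>e\<^sub>i\<close> to \<open>v\<close> along \<open>v - e\<^sub>i\<close>; its coefficient is junk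
  for \<open>v = e\<^sub>i\<close>.\<close>

definition reflection_to :: "'n \<Rightarrow> complex^'n \<Rightarrow> complex^'n^'n" where
  "reflection_to i v = mat 1 + rank_one (v - axis i 1) (1 / (cnj (v $ i) - 1))"

lemma unit_vector_coordinate_ne_1:
  fixes v :: "complex^'n"
  assumes "norm v = 1" "v \<noteq> axis i 1" shows "v $ i \<noteq> 1"
proof
  assume vi: "v $ i = 1"
  have "(\<Sum>k\<in>UNIV. (cmod (v $ k))\<^sup>2) = 1"
    using assms(1) by (simp add: norm_vec_def L2_set_def)
  then have "(\<Sum>k\<in>UNIV - {i}. (cmod (v $ k))\<^sup>2) = 0"
    by (simp add: sum.remove[of UNIV i] vi)
  then have "v $ k = 0" if "k \<noteq> i" for k using that by (simp add: sum_nonneg_eq_0_iff)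
  then have "v = axis i 1" using vi by (auto simp: vec_eq_iff axis_def)
  then show False using assms by simp
qed

lemma reflection_to:
  assumes v: "v \<in> coordinate_sphere S" and i: "i \<in> S" and ne: "v \<noteq> axis i 1"
  shows reflection_to_fixing: "reflection_to i v \<in> fixing_unitaries S"
    and reflection_to_axis: "reflection_to i v *v axis i 1 = v"
proof -
  define u where "u = v - axis i 1"
  define w where "w = v $ i"
  define c where "c = 1 / (cnj w - 1)"
  have nv: "norm v = 1" and supp: "\<And>j. j \<notin> S \<Longrightarrow> v $ j = 0"
    using v by (auto simp: coordinate_sphere_def coordinate_subspace_def)
  have w: "w \<noteq> 1" using unit_vector_coordinate_ne_1[OF nv ne] by (simp add: w_def)
  then have w': "cnj w \<noteq> 1" by (metis complex_cnj_cnj complex_cnj_one)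
  have T: "reflection_to i v = mat 1 + rank_one u c"
    by (simp add: reflection_to_def u_def c_def w_def)
  have "(\<Sum>k\<in>UNIV. u $ k * cnj (u $ k)) =
      (\<Sum>k\<in>UNIV. v $ k * cnj (v $ k) + (if k = i then 1 - w - cnj w else 0))"
    by (rule sum.cong) (auto simp: u_def w_def axis_def algebra_simps)
  also have "\<dots> = 2 - w - cnj w" by (simp add: sum.distrib sum_norm_square nv)
  finally have s: "(\<Sum>k\<in>UNIV. u $ k * cnj (u $ k)) = 2 - w - cnj w" .
  have cc: "cnj c = 1 / (w - 1)" by (simp add: c_def)
  have "c * (cnj w - 1) = 1" "cnj c * (w - 1) = 1" using w w' by (simp_all add: cc c_def)
  moreover have "c * cnj c * (2 - w - cnj w) = - (c * (cnj c * (w - 1))) - cnj c * (c * (cnj w - 1))"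
    by (simp add: algebra_simps)
  \<comment> \<open>With \<open>2 - w - cnj w\<close> the squared norm of \<open>u\<close>, this is
    exactly the condition for the rank-one perturbation of the unit to be unitary.\<close>
  ultimately have z: "c + cnj c + c * cnj c * (2 - w - cnj w) = 0" by simp
  have r0: "rank_one u 0 = 0" by (simp add: rank_one_def vec_eq_iff)
  have "(mat 1 + rank_one u c) ** (mat 1 + rank_one u (cnj c)) = mat 1"
    "(mat 1 + rank_one u (cnj c)) ** (mat 1 + rank_one u c) = mat 1"
    using z by (simp_all add: rank_one_perturbation_mult s r0 add.commute mult.commute)
  then have "reflection_to i v \<in> unitary_matrices"
    by (simp add: unitary_matrices_def T conj_transpose_rank_one)
  moreover have "reflection_to i v *v axis j 1 = axis j 1" if "j \<notin> S" for j
  proof -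
    have "u $ j = 0" using that supp i by (auto simp: u_def axis_def)
    then show ?thesis by (simp add: T matrix_vector_mult_add_rdistrib rank_one_axis vec_eq_iff)
  qed
  ultimately show "reflection_to i v \<in> fixing_unitaries S" by (simp add: fixing_unitaries_def)
  have "c * cnj (u $ i) = 1" using w' by (simp add: u_def c_def w_def)
  then have "rank_one u c *v axis i 1 = u" by (simp add: rank_one_axis vec_eq_iff)
  then show "reflection_to i v *v axis i 1 = v" by (simp add: T matrix_vector_mult_add_rdistrib u_def)
qed

lemma continuous_on_reflection_to [continuous_intros]:
  assumes "continuous_on X f" "\<And>x. x \<in> X \<Longrightarrow> f x \<in> coordinate_sphere S - {axis i 1}"
  shows "continuous_on X (\<lambda>x. reflection_to i (f x))"
proof -
  have "cnj (f x $ i) - 1 \<noteq> 0" if "x \<in> X" for x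
  proof -
    have "f x $ i \<noteq> 1"
      using unit_vector_coordinate_ne_1 assms(2)[OF that] by (auto simp: coordinate_sphere_def)
    then show ?thesis by (metis complex_cnj_cnj complex_cnj_one right_minus_eq)
  qed
  then show ?thesis unfolding reflection_to_def rank_one_def
    by (intro continuous_intros assms) auto
qed

text \<open>The second chart, continuous at \<open>axis i 1\<close>, where the first one breaks
  down. The right factor sends \<open>axis i 1\<close> to its negative, which repairs the sign of
  \<open>- v\<close> and makes the value at \<open>axis i 1\<close> the unit matrix.\<close>

definition antireflection_to :: "'n \<Rightarrow> complex^'n \<Rightarrow> complex^'n^'n" where
  "antireflection_to i v = reflection_to i (- v) ** conj_transpose (reflection_to i (- axis i 1))"

lemma axis_ne_minus: "axis i 1 \<noteq> (- axis i 1 :: complex^'n)"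
proof
  assume "axis i 1 = (- axis i 1 :: complex^'n)"
  then have "(axis i 1 :: complex^'n) $ i = (- axis i 1 :: complex^'n) $ i" by (rule arg_cong)
  then show False by simp
qed

lemma uminus_coordinate_sphere: "- v \<in> coordinate_sphere S \<longleftrightarrow> v \<in> coordinate_sphere S"
  by (simp add: coordinate_sphere_def coordinate_subspace_def)

lemma matrix_vector_mult_uminus:
  fixes A :: "'a::ring_1^'n^'m" shows "A *v (- x) = - (A *v x)"
  by (vector matrix_vector_mult_def sum_negf)

lemma antireflection_to:
  assumes v: "v \<in> coordinate_sphere S" and i: "i \<in> S" and ne: "v \<noteq> - axis i 1"
  shows antireflection_to_fixing: "antireflection_to i v \<in> fixing_unitaries S"
    and antireflection_to_axis: "antireflection_to i v *v axis i 1 = v"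
proof -
  let ?e = "axis i 1" and ?R = "reflection_to i (- axis i 1)"
  have v': "- v \<in> coordinate_sphere S" "- v \<noteq> ?e" using v ne
    by (auto simp: uminus_coordinate_sphere minus_equation_iff[of v])
  note R = reflection_to[OF axis_in_coordinate_sphere(2)[OF i] i axis_ne_minus[symmetric]]
  show "antireflection_to i v \<in> fixing_unitaries S"
    unfolding antireflection_to_def
    by (intro fixing_unitaries_mult fixing_unitaries_conj_transpose R reflection_to_fixing v' i)
  have U: "?R \<in> unitary_matrices" using R(1) by (simp add: fixing_unitaries_def)
  have "conj_transpose ?R *v - ?e = conj_transpose ?R *v (?R *v ?e)" by (simp only: R(2))
  also have "\<dots> = ?e" by (simp only: matrix_vector_mul_assoc unitary_matricesD[OF U] matrix_vector_mul_lid)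
  finally have "conj_transpose ?R *v ?e = - ?e" by (simp add: matrix_vector_mult_uminus minus_equation_iff)
  then show "antireflection_to i v *v axis i 1 = v"
    using reflection_to_axis[OF v'(1) i v'(2)]
    by (simp add: antireflection_to_def matrix_vector_mul_assoc[symmetric] matrix_vector_mult_uminus)
qed

lemma antireflection_to_self:
  assumes "i \<in> S" shows "antireflection_to i (axis i 1) = mat 1"
proof -
  have "reflection_to i (- axis i 1) \<in> unitary_matrices"
    using reflection_to_fixing[OF axis_in_coordinate_sphere(2)[OF assms] assms axis_ne_minus[symmetric]]
    by (simp add: fixing_unitaries_def)
  then show ?thesis by (simp add: antireflection_to_def unitary_matricesD)
qed

lemma continuous_on_antireflection_to [continuous_intros]:
  assumes "continuous_on X f" "\<And>x. x \<in> X \<Longrightarrow> f x \<in> coordinate_sphere S - {- axis i 1}"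
  shows "continuous_on X (\<lambda>x. antireflection_to i (f x))"
  unfolding antireflection_to_def
  by (intro continuous_intros assms) (use assms(2) in \<open>force simp: uminus_coordinate_sphere minus_equation_iff[of "f _"]\<close>)

text \<open>The fibres of the map from U(k + 1) to the sphere are cosets of U(k).\<close>

lemma fixing_unitaries_same_axis:
  assumes A: "A \<in> fixing_unitaries (insert i S)" and B: "B \<in> fixing_unitaries (insert i S)"
    and eq: "A *v axis i 1 = B *v axis i 1"
  shows "conj_transpose A ** B \<in> fixing_unitaries S"
proof (rule fixing_unitaries_insert)
  have U: "A \<in> unitary_matrices" using A by (simp add: fixing_unitaries_def)
  show "conj_transpose A ** B \<in> fixing_unitaries (insert i S)"
    by (intro fixing_unitaries_mult fixing_unitaries_conj_transpose A B)
  have "(conj_transpose A ** B) *v axis i 1 = conj_transpose A *v (A *v axis i 1)"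
    by (simp add: matrix_vector_mul_assoc[symmetric] eq)
  then show "(conj_transpose A ** B) *v axis i 1 = axis i 1"
    by (simp only: matrix_vector_mul_assoc unitary_matricesD[OF U] matrix_vector_mul_lid)
qed

text \<open>Stereographic projection. The target is a linear subspace, hence star-shaped, which is
  what lifting over the punctured sphere requires.\<close>

lemma punctured_coordinate_sphere_homeomorphism:
  assumes b: "b \<in> coordinate_sphere S"
  obtains P h k where "subspace P" "int (dim P) + 1 = int (dim (coordinate_subspace S))"
    "homeomorphism (coordinate_sphere S - {b}) P k (h :: complex^'n::finite \<Rightarrow> complex^'n)"
proof -
  let ?T = "coordinate_subspace S"
  have bT: "b \<in> ?T" "b \<in> sphere 0 1" using b by (auto simp: coordinate_sphere_def)
  then have "b \<noteq> 0" by auto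
  then have "dim ?T \<noteq> 0" using bT by (auto simp: dim_eq_0)
  then have d: "dim ?T > 0" by linarith
  obtain P :: "(complex^'n) set" where P: "subspace P" "dim P = dim ?T - 1"
    using choose_subspace_of_subspace[of "dim ?T - 1" ?T] by auto
  have "(sphere 0 1 \<inter> ?T) - {b} homeomorphic P"
  proof (rule homeomorphic_punctured_affine_sphere_affine)
    show "aff_dim ?T = aff_dim P + 1"
      using P d by (simp add: aff_dim_subspace subspace_coordinate_subspace)
  qed (use bT P subspace_coordinate_subspace subspace_imp_affine subspace_0 in auto)
  then obtain k h where "homeomorphism (coordinate_sphere S - {b}) P k h"
    unfolding homeomorphic_def coordinate_sphere_def by blast
  then show ?thesis using that P d by force
qed

text \<open>The dimension is real, so one complex coordinate contributes two independent vectors.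
  The bound 3 makes the stereographic image at least two-dimensional.\<close>

lemma dim_coordinate_subspace_ge:
  fixes i j :: "'n::finite"
  assumes "i \<in> S" "j \<in> S" "i \<noteq> j"
  shows "3 \<le> dim (coordinate_subspace S)"
proof -
  let ?B = "{axis i 1, axis i \<i>, axis j 1 :: complex^'n}"
  have ne: "axis i 1 \<noteq> (axis i \<i> :: complex^'n)" "axis j 1 \<noteq> (axis i 1 :: complex^'n)"
      "axis j 1 \<noteq> (axis i \<i> :: complex^'n)"
    using assms(3) by (auto simp: axis_eq_axis complex_eq_iff)
  have "pairwise orthogonal ?B"
    using assms(3) by (auto simp: pairwise_def orthogonal_def inner_axis_axis inner_complex_def)
  moreover have "0 \<notin> ?B" by (auto simp: axis_eq_0_iff)
  ultimately have "independent ?B" by (rule pairwise_orthogonal_independent)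
  moreover have "?B \<subseteq> coordinate_subspace S" using assms by (auto simp: coordinate_subspace_def axis_def)
  ultimately have "card ?B \<le> dim (coordinate_subspace S)" by (rule independent_card_le_dim[rotated])
  moreover have "card ?B = 3" using ne by auto
  ultimately show ?thesis by simp
qed

lemma path_connected_twice_punctured_sphere:
  assumes ij: "i \<in> S" "j \<in> S" "i \<noteq> j" and b: "b \<in> coordinate_sphere S"
  shows "path_connected (coordinate_sphere S - {b} - {c :: complex^'n::finite})"
proof -
  obtain P h k where P: "subspace P" "int (dim P) + 1 = int (dim (coordinate_subspace S))"
    and hom: "homeomorphism (coordinate_sphere S - {b}) P k (h :: complex^'n \<Rightarrow> complex^'n)"
    using punctured_coordinate_sphere_homeomorphism[OF b] by metis
  have k: "h (k v) = v" "k v \<in> P" if "v \<in> coordinate_sphere S - {b}" for v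
    using homeomorphism_apply1[OF hom that] homeomorphism_image1[OF hom] that by blast+
  have h: "k (h x) = x" "h x \<in> coordinate_sphere S - {b}" if "x \<in> P" for x
    using homeomorphism_apply2[OF hom that] homeomorphism_image2[OF hom] that by blast+
  \<comment> \<open>In dimension one, removing a point from the stereographic image would disconnect
    it.\<close>
  have "aff_dim P \<noteq> 1"
    using P dim_coordinate_subspace_ge[OF ij] by (simp add: aff_dim_subspace)
  show ?thesis
  proof (cases "c \<in> coordinate_sphere S - {b}")
    case True
    have "h ` (P - {k c}) = coordinate_sphere S - {b} - {c}"
    proof (intro equalityI subsetI)
      fix v assume "v \<in> h ` (P - {k c})"
      then obtain x where x: "x \<in> P" "x \<noteq> k c" "v = h x" by blast
      have "v \<noteq> c" using h(1)[OF x(1)] x by auto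
      then show "v \<in> coordinate_sphere S - {b} - {c}" using h(2)[OF x(1)] x by blast
    next
      fix v assume v: "v \<in> coordinate_sphere S - {b} - {c}"
      then have v': "v \<in> coordinate_sphere S - {b}" by blast
      have "k v \<noteq> k c" using k(1)[OF v'] k(1)[OF True] v by auto
      then show "v \<in> h ` (P - {k c})" using k[OF v'] by (intro image_eqI[of _ _ "k v"]) auto
    qed
    moreover have "path_connected (P - {k c})"
      using P(1) \<open>aff_dim P \<noteq> 1\<close> by (intro path_connected_punctured_convex subspace_imp_convex)
    moreover have "continuous_on (P - {k c}) h"
      using hom unfolding homeomorphism_def by (auto intro: continuous_on_subset)
    ultimately show ?thesis using path_connected_continuous_image by metis
  next
    case False
    have "path_connected (h ` P)"
      using hom P(1) unfolding homeomorphism_def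
      by (intro path_connected_continuous_image convex_imp_path_connected subspace_imp_convex) auto
    then show ?thesis using False hom by (simp add: homeomorphism_def)
  qed
qed

text \<open>Its determinant is \<open>c\<close> itself, whereas a scalar matrix would have the n-th
  power; so the angle of its lift grows at unit rate.\<close>

definition coordinate_rotation :: "'n \<Rightarrow> complex \<Rightarrow> complex^'n::finite^'n" where
  "coordinate_rotation i c = (\<chi> a b. if a = b then (if a = i then c else 1) else 0)"

lemma det_coordinate_rotation: "det (coordinate_rotation i c) = c"
proof -
  have "det (coordinate_rotation i c) = (\<Prod>a\<in>UNIV. if a = i then c else 1)"
    by (subst det_diagonal) (auto simp: coordinate_rotation_def)
  then show ?thesis by simp
qed

lemma coordinate_rotation_mult:
  "coordinate_rotation i c ** coordinate_rotation i d = coordinate_rotation i (c * d)"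
  by (simp add: coordinate_rotation_def matrix_matrix_mult_def vec_eq_iff if_distrib[of "\<lambda>x. x * _"]
      cong: if_cong)

lemma coordinate_rotation_1: "coordinate_rotation i 1 = mat 1"
  by (simp add: coordinate_rotation_def mat_def vec_eq_iff)

lemma coordinate_rotation_unitary: "coordinate_rotation i (cis a) \<in> unitary_matrices"
proof -
  have "conj_transpose (coordinate_rotation i (cis a)) = coordinate_rotation i (cis (- a))"
    by (simp add: conj_transpose_def coordinate_rotation_def vec_eq_iff cis_cnj)
  then show ?thesis
    by (simp add: unitary_matrices_def coordinate_rotation_mult cis_mult coordinate_rotation_1)
qed

lemma fixing_unitaries_singleton:
  assumes "A \<in> fixing_unitaries {i}" shows "A = coordinate_rotation i (det A)"
proof -
  have "A *v axis i 1 \<in> coordinate_sphere {i}" by (rule fixing_unitaries_column[OF assms]) simp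
  then have "A $ k $ i = 0" if "k \<noteq> i" for k
    using that by (auto simp: coordinate_sphere_def coordinate_subspace_def matrix_vector_mult_axis column_def)
  moreover have "A $ k $ j = axis j 1 $ k" if "j \<noteq> i" for j k
    using assms that by (auto simp: fixing_unitaries_def matrix_vector_mult_axis column_def vec_eq_iff)
  ultimately have "A $ a $ b = coordinate_rotation i (A $ i $ i) $ a $ b" for a b
    by (cases "b = i"; cases "a = b") (auto simp: coordinate_rotation_def axis_nth)
  then have "A = coordinate_rotation i (A $ i $ i)" unfolding vec_eq_iff by blast
  then show ?thesis using det_coordinate_rotation[of i "A $ i $ i"] by argo
qed

section \<open>The kernel of the covering is detected by the angle\<close>

context Sp_cover
begin

text \<open>The map is carried to the star-shaped stereographic image and translated to take the
  value 1 at the centre; a preimage \<open>g\<close> of the original value undoes the translation in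
  the covering group.\<close>

lemma lift_punctured_sphere:
  assumes b: "b \<in> coordinate_sphere S" and f: "continuous_on (coordinate_sphere S - {b}) f"
    and fSp: "\<And>v. v \<in> coordinate_sphere S - {b} \<Longrightarrow> f v \<in> Sp"
  obtains F where "continuous_on (coordinate_sphere S - {b :: complex^'n}) F"
    "\<And>v. v \<in> coordinate_sphere S - {b} \<Longrightarrow> F v \<in> carrier G"
    "\<And>v. v \<in> coordinate_sphere S - {b} \<Longrightarrow> p (F v) = f v"
proof -
  let ?A = "coordinate_sphere S - {b}"
  obtain P h k where P: "subspace P"
    and hom: "homeomorphism ?A P k (h :: complex^'n \<Rightarrow> complex^'n)"
    using punctured_coordinate_sphere_homeomorphism[OF b] by metis
  have h: "continuous_on P h" "\<And>x. x \<in> P \<Longrightarrow> h x \<in> ?A" and k: "continuous_on ?A k" "\<And>v. v \<in> ?A \<Longrightarrow> k v \<in> P"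
      "\<And>v. v \<in> ?A \<Longrightarrow> h (k v) = v"
    using hom unfolding homeomorphism_def by blast+
  have P0: "0 \<in> P" "star_shaped P" using P by (auto simp: star_shaped_def subspace_def)
  have h0: "f (h 0) \<in> Sp" using fSp h P0 by blast
  obtain g where g: "g \<in> carrier G" "p g = f (h 0)" using p_surj[OF h0] by blast
  have "continuous_on P (\<lambda>x. f (h x))" by (rule continuous_on_compose2[OF f h(1)]) (use h in blast)
  then have c: "continuous_on P (\<lambda>x. matrix_inv (f (h 0)) ** f (h x))"
    by (intro continuous_intros)
  obtain L where L: "continuous_on P L" "\<And>x. x \<in> P \<Longrightarrow> L x \<in> carrier G"
      "\<And>x. x \<in> P \<Longrightarrow> p (L x) = matrix_inv (f (h 0)) ** f (h x)"
    by (rule lift_closed_star_shaped[OF P0(2) closed_subspace[OF P] c])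
      (use fSp h h0 in \<open>auto intro!: Sp_mult simp: Sp_matrix_inv(2,4)\<close>)
  show ?thesis
  proof (rule that[of "\<lambda>v. g \<otimes> L (k v)"])
    have "continuous_on ?A (\<lambda>v. L (k v))" by (rule continuous_on_compose2[OF L(1) k(1)]) (use k in blast)
    then show "continuous_on ?A (\<lambda>v. g \<otimes> L (k v))"
      using g k L by (intro continuous_on_mult continuous_intros) auto
    fix v assume v: "v \<in> ?A"
    then show "g \<otimes> L (k v) \<in> carrier G" using g k L by simp
    have "p (g \<otimes> L (k v)) = f (h 0) ** matrix_inv (f (h 0)) ** f v"
      using g k[of] L v by (simp add: p_mult matrix_mul_assoc)
    then show "p (g \<otimes> L (k v)) = f v" by (simp add: Sp_matrix_inv(3)[OF h0])
  qed
qed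

text \<open>The full preimage, so that membership is a condition on matrices only; connectedness to
  the unit is tracked separately by \<open>path_component\<close>.\<close>

definition fixing_group :: "'n set \<Rightarrow> 'g set" where
  "fixing_group S = {g \<in> carrier G. p g \<in> unitary_embed ` fixing_unitaries S}"

lemma fixing_groupD:
  assumes "g \<in> fixing_group S"
  shows "g \<in> carrier G" "complex_part (p g) \<in> fixing_unitaries S" "p g = unitary_embed (complex_part (p g))"
    "p g \<in> unitary_Sp"
  using assms by (auto simp: fixing_group_def fixing_unitaries_def intro: unitary_embed_in_unitary_Sp)

lemma fixing_group_one: "\<one> \<in> fixing_group S"
  using mat_1_fixing unitary_embed_mat_1 by (force simp: fixing_group_def p_one image_iff)

lemma fixing_group_inv:
  assumes "g \<in> fixing_group S" shows "inv g \<in> fixing_group S"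
proof -
  note g = fixing_groupD[OF assms]
  have "p (inv g) = unitary_embed (conj_transpose (complex_part (p g)))"
    using g by (simp add: p_inv unitary_Sp_matrix_inv transpose_unitary_embed[symmetric])
  then show ?thesis
    using g by (simp add: fixing_group_def fixing_unitaries_conj_transpose)
qed

lemma fixing_group_mult:
  assumes "g \<in> fixing_group S" "h \<in> fixing_group S" shows "g \<otimes> h \<in> fixing_group S"
proof -
  note g = fixing_groupD[OF assms(1)] and h = fixing_groupD[OF assms(2)]
  have "p (g \<otimes> h) = unitary_embed (complex_part (p g) ** complex_part (p h))"
    by (simp add: p_mult g(1) h(1) unitary_embed_mult g(3)[symmetric] h(3)[symmetric])
  then show ?thesis using g h by (simp add: fixing_group_def fixing_unitaries_mult)
qed

lemma path_component_fixing_group_mult: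
  assumes "path_component (fixing_group S) a b" "path_component (fixing_group S) c d"
  shows "path_component (fixing_group S) (a \<otimes> c) (b \<otimes> d)"
proof -
  obtain f g where f: "path f" "path_image f \<subseteq> fixing_group S" "pathstart f = a" "pathfinish f = b"
    and g: "path g" "path_image g \<subseteq> fixing_group S" "pathstart g = c" "pathfinish g = d"
    using assms unfolding path_component_def by blast
  have "f t \<in> fixing_group S" "g t \<in> fixing_group S" if "t \<in> {0..1}" for t
    using f g that by (auto simp: path_image_def)
  then show ?thesis unfolding path_component_def using f g
    by (intro exI[of _ "\<lambda>t. f t \<otimes> g t"])
      (auto simp: path_def path_image_def pathstart_def pathfinish_def
        intro!: continuous_on_mult fixing_group_mult fixing_groupD(1))
qed

lemma path_component_fixing_group_inv:
  assumes "path_component (fixing_group S) a b"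
  shows "path_component (fixing_group S) (inv a) (inv b)"
proof -
  obtain f where f: "path f" "path_image f \<subseteq> fixing_group S" "pathstart f = a" "pathfinish f = b"
    using assms unfolding path_component_def by blast
  have "f t \<in> fixing_group S" if "t \<in> {0..1}" for t
    using f that by (auto simp: path_image_def)
  then show ?thesis unfolding path_component_def using f
    by (intro exI[of _ "\<lambda>t. inv (f t)"])
      (auto simp: path_def path_image_def pathstart_def pathfinish_def
        intro!: continuous_on_inv fixing_group_inv fixing_groupD(1))
qed

text \<open>On the overlap of the two charts of the sphere the lifted sections differ by an element of
  the identity path component, after correcting one section by a constant; the overlap is
  path-connected as soon as the sphere has dimension at least 3. A path over the sphere can
  therefore be divided by the sections without leaving that component.\<close>

lemma fixing_group_path_reduce:
  assumes S: "i \<notin> S" "S \<noteq> {}" and z: "p z = mat 1"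
    and path: "path_component (fixing_group (insert i S)) \<one> z"
  shows "path_component (fixing_group S) \<one> z"
proof -
  let ?S = "insert i S" and ?e = "axis i 1 :: complex^'n"
  let ?X = "coordinate_sphere ?S" and ?pc = "path_component (fixing_group S) \<one>"
  obtain j where j: "j \<in> S" "j \<noteq> i" using S by auto
  have eX: "?e \<in> ?X" "- ?e \<in> ?X" by (simp_all add: axis_in_coordinate_sphere)
  obtain c where c: "path c" "path_image c \<subseteq> fixing_group ?S" "pathstart c = \<one>" "pathfinish c = z"
    using path unfolding path_component_def by blast
  have cF: "c t \<in> fixing_group ?S" if "t \<in> {0..1}" for t using c that by (auto simp: path_image_def)
  have contc: "continuous_on {0..1} c" using c by (simp add: path_def)
  have "continuous_on (?X - {- ?e}) (\<lambda>v. unitary_embed (antireflection_to i v))"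
    by (intro continuous_intros) auto
  moreover have "unitary_embed (antireflection_to i v) \<in> Sp" if "v \<in> ?X - {- ?e}" for v
    using antireflection_to_fixing[of v ?S i] that
    by (auto simp: fixing_unitaries_def intro!: unitary_SpD(1) unitary_embed_in_unitary_Sp)
  ultimately obtain A0 where A0: "continuous_on (?X - {- ?e}) A0"
      "\<And>v. v \<in> ?X - {- ?e} \<Longrightarrow> A0 v \<in> carrier G"
      "\<And>v. v \<in> ?X - {- ?e} \<Longrightarrow> p (A0 v) = unitary_embed (antireflection_to i v)"
    using lift_punctured_sphere[OF eX(2)] by metis
  define A where "A v = A0 v \<otimes> inv (A0 ?e)" for v
  have e: "?e \<in> ?X - {- ?e}" using eX axis_ne_minus[of i] by blast
  have contA: "continuous_on (?X - {- ?e}) A"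
    unfolding A_def using A0 e by (intro continuous_on_mult continuous_intros) auto
  have A: "A v \<in> carrier G" "p (A v) = unitary_embed (antireflection_to i v)" if "v \<in> ?X - {- ?e}" for v
    using A0(2,3)[OF that] A0(2,3)[OF e] 
    by (simp_all add: A_def p_mult p_inv antireflection_to_self[of i "insert i S"])
  have Ae: "A ?e = \<one>" using A0(2)[OF e] by (simp add: A_def)
  have "continuous_on (?X - {?e}) (\<lambda>v. unitary_embed (reflection_to i v))"
    by (intro continuous_intros) auto
  moreover have "unitary_embed (reflection_to i v) \<in> Sp" if "v \<in> ?X - {?e}" for v
    using reflection_to_fixing[of v ?S i] that
    by (auto simp: fixing_unitaries_def intro!: unitary_SpD(1) unitary_embed_in_unitary_Sp)
  ultimately obtain B0 where B0: "continuous_on (?X - {?e}) B0"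
      "\<And>v. v \<in> ?X - {?e} \<Longrightarrow> B0 v \<in> carrier G"
      "\<And>v. v \<in> ?X - {?e} \<Longrightarrow> p (B0 v) = unitary_embed (reflection_to i v)"
    using lift_punctured_sphere[OF eX(1)] by metis
  have AF: "A v \<in> fixing_group ?S" "complex_part (p (A v)) *v ?e = v" if "v \<in> ?X - {- ?e}" for v
    using A[OF that] antireflection_to[of v ?S i] that by (auto simp: fixing_group_def)
  have B0F: "B0 v \<in> fixing_group ?S" "complex_part (p (B0 v)) *v ?e = v" if "v \<in> ?X - {?e}" for v
    using B0(2,3)[OF that] reflection_to[of v ?S i] that by (auto simp: fixing_group_def)
  \<comment> \<open>Two elements over the same point of the sphere differ by an element above the
    smaller unitary group.\<close>
  have quot: "inv g \<otimes> h \<in> fixing_group S"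
    if g: "g \<in> fixing_group ?S" and h: "h \<in> fixing_group ?S"
      and eq: "complex_part (p g) *v ?e = complex_part (p h) *v ?e" for g h
  proof -
    note g' = fixing_groupD[OF g] and h' = fixing_groupD[OF h]
    have "p (inv g \<otimes> h) = transpose (p g) ** p h"
      using g' h' by (simp add: p_mult p_inv unitary_Sp_matrix_inv)
    also have "\<dots> = transpose (unitary_embed (complex_part (p g))) ** unitary_embed (complex_part (p h))"
      by (simp only: g'(3)[symmetric] h'(3)[symmetric])
    also have "\<dots> = unitary_embed (conj_transpose (complex_part (p g)) ** complex_part (p h))"
      by (simp only: transpose_unitary_embed unitary_embed_mult)
    finally have eq': "p (inv g \<otimes> h) = unitary_embed (conj_transpose (complex_part (p g)) ** complex_part (p h))" .
    have "conj_transpose (complex_part (p g)) ** complex_part (p h) \<in> fixing_unitaries S"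
      by (rule fixing_unitaries_same_axis[OF g'(2) h'(2) eq])
    then show ?thesis unfolding fixing_group_def using eq' g'(1) h'(1) by blast
  qed
  let ?O = "?X - {?e} - {- ?e}"
  have pcO: "path_connected ?O"
    by (rule path_connected_twice_punctured_sphere[of i _ j]) (use j eX in auto)
  have "axis j 1 \<in> ?X" using j by (simp add: axis_in_coordinate_sphere)
  moreover have "axis j 1 \<noteq> ?e" "axis j 1 \<noteq> - ?e" using j by (auto simp: vec_eq_iff axis_nth)
  ultimately have v0: "axis j 1 \<in> ?O" by blast
  \<comment> \<open>The constant that makes the two sections agree at one chosen point of the
    overlap.\<close>
  define b where "b = inv (A (axis j 1)) \<otimes> B0 (axis j 1)"
  have bF: "b \<in> fixing_group S"
    unfolding b_def by (rule quot) (use v0 AF B0F in auto)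
  have bG: "b \<in> carrier G" by (rule fixing_groupD(1)[OF bF])
  define B where "B v = B0 v \<otimes> inv b" for v
  have BG: "B v \<in> carrier G" if "v \<in> ?X - {?e}" for v using B0(2)[OF that] bG by (simp add: B_def)
  have contB: "continuous_on (?X - {?e}) B"
    unfolding B_def using B0 bG by (intro continuous_on_mult continuous_intros) auto
  have overlap: "?pc (inv (A v) \<otimes> B v)" if v: "v \<in> ?O" for v
  proof -
    have 1: "inv (A v) \<otimes> B v = inv (A v) \<otimes> B0 v \<otimes> inv b" if "v \<in> ?O" for v
      unfolding B_def using that A B0 bG by (subst m_assoc) auto
    have 2: "inv (A v) \<otimes> B0 v \<in> fixing_group S" if "v \<in> ?O" for v
      by (rule quot) (use that AF B0F in auto)
    have "inv (A v) \<otimes> B v \<in> fixing_group S" if "v \<in> ?O" for v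
      unfolding 1[OF that] by (rule fixing_group_mult[OF 2[OF that] fixing_group_inv[OF bF]])
    then have sub: "(\<lambda>v. inv (A v) \<otimes> B v) ` ?O \<subseteq> fixing_group S" by blast
    have "continuous_on ?O (\<lambda>v. inv (A v) \<otimes> B v)"
      by (intro continuous_on_mult continuous_on_inv continuous_on_subset[OF contA] continuous_on_subset[OF contB])
        (use A BG in auto)
    then have "path_connected ((\<lambda>v. inv (A v) \<otimes> B v) ` ?O)"
      using pcO by (rule path_connected_continuous_image)
    then have "path_component ((\<lambda>v. inv (A v) \<otimes> B v) ` ?O)
        (inv (A (axis j 1)) \<otimes> B (axis j 1)) (inv (A v) \<otimes> B v)"
      using v v0 unfolding path_connected_component by blast
    moreover have "inv (A (axis j 1)) \<otimes> B (axis j 1) = \<one>"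
    proof -
      have "inv (A (axis j 1)) \<otimes> B (axis j 1) = b \<otimes> inv b"
        unfolding B_def b_def using v0 A B0 bG unfolding b_def by (subst m_assoc) auto
      then show ?thesis using bG by simp
    qed
    ultimately show ?thesis using path_component_of_subset[OF sub] by simp
  qed
  define col where "col g = complex_part (p g) *v ?e" for g
  have colX: "col g \<in> ?X" if "g \<in> fixing_group ?S" for g
    unfolding col_def by (rule fixing_unitaries_column[OF fixing_groupD(2)[OF that]]) simp
  \<comment> \<open>Division by a section over the column of \<open>g\<close> lands in the identity
    path component. Either chart may be used; \<open>both\<close> shows that the charts give the
    same answer.\<close>
  define R where "R g \<longleftrightarrow> (col g \<noteq> - ?e \<and> ?pc (inv (A (col g)) \<otimes> g)) \<or>
      (col g \<noteq> ?e \<and> ?pc (inv (B (col g)) \<otimes> g))" for g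
  have both: "?pc (inv (A (col g)) \<otimes> g) \<longleftrightarrow> ?pc (inv (B (col g)) \<otimes> g)"
    if g: "g \<in> fixing_group ?S" and ne: "col g \<noteq> ?e" "col g \<noteq> - ?e" for g
  proof -
    let ?v = "col g"
    have v: "?v \<in> ?O" using colX[OF g] ne by blast
    have mem: "A ?v \<in> carrier G" "B ?v \<in> carrier G" "g \<in> carrier G"
      using A BG v fixing_groupD(1)[OF g] by auto
    note o = overlap[OF v]
    have o': "?pc (inv (inv (A ?v) \<otimes> B ?v))" using path_component_fixing_group_inv[OF o] by simp
    have eq: "(inv (A ?v) \<otimes> B ?v) \<otimes> (inv (B ?v) \<otimes> g) = inv (A ?v) \<otimes> g"
      "inv (inv (A ?v) \<otimes> B ?v) \<otimes> (inv (A ?v) \<otimes> g) = inv (B ?v) \<otimes> g"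
      using mem by (simp_all add: m_assoc inv_mult_group) (simp_all add: m_assoc[symmetric])
    show ?thesis
      using path_component_fixing_group_mult[OF o, of \<one> "inv (B ?v) \<otimes> g"]
        path_component_fixing_group_mult[OF o', of \<one> "inv (A ?v) \<otimes> g"] eq by auto
  qed
  have contcol: "continuous_on {0..1} (\<lambda>t. col (c t))"
    unfolding col_def using fixing_groupD(1)[OF cF] contc by (intro continuous_intros continuous_on_p) auto
  \<comment> \<open>Inside one chart the divided path is continuous, so \<open>R\<close> is locally
    constant along \<open>c\<close>. The chart is a parameter, since both are used below.\<close>
  have local: "\<exists>T. openin (top_of_set {0..1}) T \<and> a \<in> T \<and> (\<forall>x\<in>T. \<forall>y\<in>T. R (c x) \<longrightarrow> R (c y))"
    if a: "a \<in> {0..1}" "col (c a) \<noteq> w" and wX: "w \<in> ?X"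
      and L: "continuous_on (?X - {w}) L" "\<And>v. v \<in> ?X - {w} \<Longrightarrow> L v \<in> carrier G"
      and LF: "\<And>g. g \<in> fixing_group ?S \<Longrightarrow> col g \<noteq> w \<Longrightarrow> inv (L (col g)) \<otimes> g \<in> fixing_group S"
      and RL: "\<And>g. g \<in> fixing_group ?S \<Longrightarrow> col g \<noteq> w \<Longrightarrow> R g \<longleftrightarrow> ?pc (inv (L (col g)) \<otimes> g)" for a w L
  proof -
    let ?T = "{0..1} \<inter> (\<lambda>t. col (c t)) -` (- {w})"
    have "openin (top_of_set {0..1}) ?T" by (rule continuous_openin_preimage_gen[OF contcol]) auto
    then obtain \<epsilon> where \<epsilon>: "\<epsilon> > 0" "ball a \<epsilon> \<inter> {0..1} \<subseteq> ?T"
      using a unfolding openin_contains_ball by blast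
    let ?J = "ball a \<epsilon> \<inter> {0..1}"
    let ?f = "\<lambda>t. inv (L (col (c t))) \<otimes> c t"
    have ok: "c t \<in> fixing_group ?S" "col (c t) \<noteq> w" "t \<in> {0..1}" if "t \<in> ?J" for t
      using \<epsilon> that cF by auto
    have "(\<lambda>t. col (c t)) ` ?J \<subseteq> ?X - {w}" using ok colX by blast
    then have "continuous_on ?J (\<lambda>t. L (col (c t)))"
      by (rule continuous_on_compose2[OF L(1) continuous_on_subset[OF contcol], rotated]) auto
    moreover have cG: "c t \<in> carrier G" if "t \<in> ?J" for t using ok(1)[OF that] fixing_groupD(1) by blast
    moreover have LG: "L (col (c t)) \<in> carrier G" if "t \<in> ?J" for t using ok[OF that] colX L(2) by blast
    ultimately have contf: "continuous_on ?J ?f"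
      by (intro continuous_on_mult continuous_on_inv continuous_on_subset[OF contc]) auto
    have fF: "?f ` ?J \<subseteq> fixing_group S" using LF ok by blast
    have "convex ?J" by (intro convex_Int convex_ball) auto
    then have "path_connected (?f ` ?J)"
      using contf by (intro path_connected_continuous_image convex_imp_path_connected)
    then have fxy: "path_component (fixing_group S) (?f x) (?f y)" if "x \<in> ?J" "y \<in> ?J" for x y
      using that path_component_of_subset[OF fF] unfolding path_connected_component by blast
    have "R (c x) \<longrightarrow> R (c y)" if "x \<in> ?J" "y \<in> ?J" for x y
      unfolding RL[OF ok(1,2)[OF that(1)]] RL[OF ok(1,2)[OF that(2)]]
      using path_component_trans[OF _ fxy[OF that]] by blast
    moreover have "openin (top_of_set {0..1}) ?J" by (metis open_ball openin_open_Int inf_commute)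
    moreover have "a \<in> ?J" using a \<epsilon> by simp
    ultimately show ?thesis by blast
  qed
  have RA: "R g \<longleftrightarrow> ?pc (inv (A (col g)) \<otimes> g)" if "g \<in> fixing_group ?S" "col g \<noteq> - ?e" for g
    using both that unfolding R_def by blast
  have RB: "R g \<longleftrightarrow> ?pc (inv (B (col g)) \<otimes> g)" if "g \<in> fixing_group ?S" "col g \<noteq> ?e" for g
    using both that unfolding R_def by blast
  have AFF: "inv (A (col g)) \<otimes> g \<in> fixing_group S" if "g \<in> fixing_group ?S" "col g \<noteq> - ?e" for g
    by (rule quot) (use that colX AF col_def in auto)
  have BFF: "inv (B (col g)) \<otimes> g \<in> fixing_group S" if g: "g \<in> fixing_group ?S" "col g \<noteq> ?e" for g
  proof -
    have v: "col g \<in> ?X - {?e}" using colX g by blast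
    have "inv (B (col g)) \<otimes> g = b \<otimes> (inv (B0 (col g)) \<otimes> g)"
      unfolding B_def using B0(2)[OF v] bG fixing_groupD(1)[OF g(1)] by (simp add: inv_mult_group m_assoc)
    moreover have "inv (B0 (col g)) \<otimes> g \<in> fixing_group S"
      by (rule quot) (use v g B0F col_def in auto)
    ultimately show ?thesis using fixing_group_mult bF by simp
  qed
  have col1: "col g = ?e" if "p g = mat 1" for g
    using that complex_part_unitary_embed[of "mat 1 :: complex^'n^'n"] by (simp add: col_def del: complex_part_unitary_embed)
  have "R (c 1)"
  proof (rule connected_induction_simple[of "{0..1::real}" 0 1 "\<lambda>t. R (c t)"])
    have "c 0 = \<one>" using c by (simp add: pathstart_def)
    moreover have "R \<one>" unfolding R_def col1[OF p_one] 
      by (intro disjI1 conjI axis_ne_minus) (simp add: Ae path_component_refl fixing_group_one)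
    ultimately show "R (c 0)" by simp
    show "\<exists>T. openin (top_of_set {0..1}) T \<and> a \<in> T \<and> (\<forall>x\<in>T. \<forall>y\<in>T. R (c x) \<longrightarrow> R (c y))"
      if a: "a \<in> {0..1}" for a
    proof (cases "col (c a) = - ?e")
      case False
      then show ?thesis using local[OF a _ eX(2) contA] A(1) AFF RA by blast
    next
      case True
      then have "col (c a) \<noteq> ?e" using axis_ne_minus by metis
      then show ?thesis using local[OF a _ eX(1) contB] BG BFF RB by blast
    qed
  qed auto
  then have "R z" using c by (simp add: pathfinish_def)
  then have "?pc (inv (A ?e) \<otimes> z)" unfolding R_def col1[OF z] by blast
  moreover have "z \<in> carrier G" using fixing_groupD(1)[OF cF[of 1]] c by (simp add: pathfinish_def)
  ultimately show ?thesis by (simp add: Ae)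
qed

lemma coordinate_rotation_lift:
  obtains D where "continuous_on UNIV D" "\<And>a. D a \<in> carrier G" "D 0 = \<one>"
    "\<And>a. p (D a) = unitary_embed (coordinate_rotation i (cis a))"
proof -
  define m where "m a = (unitary_embed (coordinate_rotation i (cis a)) :: real^('n + 'n)^('n + 'n))" for a
  have cont: "continuous_on UNIV m"
    unfolding m_def coordinate_rotation_def by (intro continuous_intros)
  have mSp: "m a \<in> Sp" for a
    unfolding m_def by (intro unitary_SpD(1) unitary_embed_in_unitary_Sp coordinate_rotation_unitary)
  have m0: "m 0 = mat 1" by (simp add: m_def coordinate_rotation_1)
  have madd: "m (a + b) = m a ** m b" for a b
    by (simp only: m_def unitary_embed_mult[symmetric] coordinate_rotation_mult cis_mult)
  show ?thesis
    by (rule one_parameter_lift[OF cont mSp m0 madd, unfolded m_def]) (rule that)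
qed

text \<open>Coordinates are removed one at a time. For a single coordinate the path is, by
  uniqueness of lifts, the lifted rotation evaluated at its own angle, so angle 0 at the end forces
  the unit.\<close>

lemma kernel_path_angle:
  assumes "finite S" "S \<noteq> {}" "path_component (fixing_group S) \<one> z" "p z = mat 1" "angle z = 0"
  shows "z = \<one>"
  using assms
proof (induction S rule: finite_ne_induct)
  case (singleton i)
  obtain D where D: "continuous_on UNIV D" "\<And>a. D a \<in> carrier G" "D 0 = \<one>"
      "\<And>a. p (D a) = unitary_embed (coordinate_rotation i (cis a))"
    by (rule coordinate_rotation_lift) (rule that)
  obtain c where c: "path c" "path_image c \<subseteq> fixing_group {i}" "pathstart c = \<one>" "pathfinish c = z"
    using singleton unfolding path_component_def by blast
  have cF: "c t \<in> fixing_group {i}" if "t \<in> {0..1}" for t using c that by (auto simp: path_image_def)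
  have contc: "continuous_on {0..1} c" using c by (simp add: path_def)
  have "c 1 = D (angle (c 1))"
  proof (rule lift_unique[of "{0..1}" c "\<lambda>t. D (angle (c t))" 0 1])
    have "continuous_on {0..1} (\<lambda>t. angle (c t))"
      using contc fixing_groupD(1)[OF cF] by (intro continuous_on_angle) auto
    then show "continuous_on {0..1} (\<lambda>t. D (angle (c t)))"
      by (rule continuous_on_compose2[OF D(1)]) auto
    fix t :: real assume t: "t \<in> {0..1}"
    note g = fixing_groupD[OF cF[OF t]]
    have "cis (angle (c t)) = det (complex_part (p (c t)))"
      using g by (simp add: cis_angle circle_part_unitary)
    then have "complex_part (p (c t)) = coordinate_rotation i (cis (angle (c t)))"
      using fixing_unitaries_singleton[OF g(2)] by simp
    then show "p (c t) = p (D (angle (c t)))" using g(3) by (simp add: D)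
  qed (use contc cF fixing_groupD(1) D c in \<open>auto simp: pathstart_def angle_one\<close>)
  then show ?case using c singleton D by (simp add: pathfinish_def)
next
  case (insert i S)
  then show ?case using fixing_group_path_reduce[of i S z] by blast
qed

text \<open>In terms of loops: a loop in U(n) whose determinant has winding number 0 lifts to a
  closed path.\<close>

theorem kernel_angle:
  assumes z: "z \<in> carrier G" "p z = mat 1" "angle z = 0"
  shows "z = \<one>"
proof (rule kernel_path_angle[of UNIV])
  have "p z \<in> unitary_Sp" using z unitary_Sp_one by simp
  then obtain c where c: "path c" "pathstart c = \<one>" "pathfinish c = z"
      "\<And>t. t \<in> {0..1} \<Longrightarrow> c t \<in> carrier G" "\<And>t. t \<in> {0..1} \<Longrightarrow> p (c t) \<in> unitary_Sp"
    using unitary_path z(1) by metis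
  have "fixing_group UNIV = {g \<in> carrier G. p g \<in> unitary_Sp}"
    by (simp add: fixing_group_def fixing_unitaries_def unitary_Sp_eq)
  then show "path_component (fixing_group UNIV) \<one> z"
    unfolding path_component_def using c by (intro exI[of _ c]) (auto simp: path_image_def)
qed (use z in auto)

end

section \<open>The subgroups \<open>\<H>\<close> and \<open>\<R>\<close>\<close>

definition scalar_Sp :: "real \<Rightarrow> real^('n::finite + 'n)^('n + 'n)" where
  "scalar_Sp a = unitary_embed (mat (cis a))"

lemma mat_mult_mat: "mat c ** mat d = (mat (c * d) :: 'a::semiring_1^'n^'n)"
  by (simp add: mat_def matrix_matrix_mult_def vec_eq_iff if_distrib[of "\<lambda>x. x * _"] cong: if_cong)

lemma mat_commute: "mat c ** A = A ** (mat c :: 'a::comm_semiring_1^'n^'n)"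
  by (simp add: mat_def matrix_matrix_mult_def vec_eq_iff if_distrib[of "\<lambda>x. x * _"]
      if_distrib[of "\<lambda>x. _ * x"] mult.commute cong: if_cong)

lemma mat_cis_unitary: "mat (cis a) \<in> (unitary_matrices :: (complex^'n::finite^'n) set)"
proof -
  have "conj_transpose (mat (cis a)) = (mat (cis (- a)) :: complex^'n^'n)"
    by (simp add: conj_transpose_def mat_def vec_eq_iff cis_cnj)
  then show ?thesis by (simp add: unitary_matrices_def mat_mult_mat cis_mult)
qed

lemma scalar_Sp_unitary: "scalar_Sp a \<in> unitary_Sp"
  unfolding scalar_Sp_def by (intro unitary_embed_in_unitary_Sp mat_cis_unitary)

lemma scalar_Sp_add: "scalar_Sp (a + b) = scalar_Sp a ** scalar_Sp b"
  by (simp add: scalar_Sp_def unitary_embed_mult[symmetric] mat_mult_mat cis_mult)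

lemma scalar_Sp_0: "scalar_Sp 0 = mat 1"
  by (simp add: scalar_Sp_def)

lemma continuous_on_scalar_Sp: "continuous_on UNIV scalar_Sp"
  unfolding scalar_Sp_def mat_def by (intro continuous_intros)

lemma det_mat: "det (mat c :: 'a::comm_ring_1^'n^'n) = c ^ CARD('n)"
  by (subst det_diagonal) (simp_all add: mat_def)

lemma circle_part_scalar_Sp:
  "circle_part (scalar_Sp a :: real^('n::finite + 'n)^('n + 'n)) = cis (real CARD('n) * a)"
  by (simp add: circle_part_unitary scalar_Sp_unitary) (simp add: scalar_Sp_def det_mat, rule Complex.DeMoivre)

lemma scalar_Sp_commute_unitary: "M \<in> unitary_Sp \<Longrightarrow> scalar_Sp a ** M = M ** scalar_Sp a"
  by (auto simp: unitary_Sp_eq scalar_Sp_def unitary_embed_mult[symmetric] mat_commute)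

text \<open>The scalar is 1 or -1, hence a real multiple of the unit matrix.\<close>

lemma scalar_Sp_int_pi:
  fixes M :: "real^('n::finite + 'n)^('n + 'n)"
  shows "scalar_Sp (of_int k * pi) ** M = M ** scalar_Sp (of_int k * pi)"
proof -
  have "sin (of_int k * pi) = 0" by (simp add: sin_zero_iff_int2)
  then have "scalar_Sp (of_int k * pi) = cos (of_int k * pi) *\<^sub>R (mat 1 :: real^('n + 'n)^('n + 'n))"
    unfolding scalar_Sp_def
    by (intro matrix_sum_eqI) (simp_all add: unitary_embed_nth mat_def)
  then show ?thesis by (simp add: matrix_scaleR_mult)
qed

lemma special_unitary_SpD: "M \<in> special_unitary_Sp \<Longrightarrow> M \<in> unitary_Sp"
  "M \<in> special_unitary_Sp \<Longrightarrow> circle_part M = 1"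
  by (auto simp: special_unitary_Sp_def)

lemma special_unitary_Sp_mult:
  "M \<in> special_unitary_Sp \<Longrightarrow> N \<in> special_unitary_Sp \<Longrightarrow> M ** N \<in> special_unitary_Sp"
  by (simp add: special_unitary_Sp_def unitary_Sp_mult circle_part_mult unitary_SpD(1))

lemma special_unitary_Sp_inv:
  assumes "M \<in> special_unitary_Sp" shows "matrix_inv M \<in> special_unitary_Sp"
proof -
  have M: "M \<in> unitary_Sp" "circle_part M = 1" using assms by (auto simp: special_unitary_Sp_def)
  note MS = unitary_SpD(1)[OF M(1)]
  have "circle_part (M ** matrix_inv M) = circle_part M * circle_part (matrix_inv M)"
    by (rule circle_part_mult[OF M(1) Sp_matrix_inv(2)[OF MS]])
  then show ?thesis
    using M by (simp add: special_unitary_Sp_def unitary_Sp_inv_closed Sp_matrix_inv(3)[OF MS] circle_part_one)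
qed

lemma special_unitary_Sp_one: "mat 1 \<in> special_unitary_Sp"
  by (simp add: special_unitary_Sp_def unitary_Sp_one circle_part_one)

context Sp_cover
begin

abbreviation H :: "'g set" where "H \<equiv> grpH G p"
abbreviation R :: "'g set" where "R \<equiv> grpR G p"

definition unitary_cover :: "'g set" where
  "unitary_cover = {g \<in> carrier G. p g \<in> unitary_Sp}"

definition special_unitary_cover :: "'g set" where
  "special_unitary_cover = {g \<in> carrier G. p g \<in> special_unitary_Sp}"

section \<open>The one-parameter group over the scalar matrices\<close>

definition rot :: "real \<Rightarrow> 'g" where
  "rot = (SOME r. continuous_on UNIV r \<and> (\<forall>a. r a \<in> carrier G \<and> p (r a) = scalar_Sp a) \<and> r 0 = \<one> \<and>
     (\<forall>a b. r (a + b) = r a \<otimes> r b))"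

lemma rot: 
  shows continuous_on_rot: "continuous_on UNIV rot"
    and rot_closed [simp]: "rot a \<in> carrier G"
    and p_rot: "p (rot a) = scalar_Sp a"
    and rot_0: "rot 0 = \<one>"
    and rot_add: "rot (a + b) = rot a \<otimes> rot b"
proof -
  have "\<exists>r. continuous_on UNIV r \<and> (\<forall>a. r a \<in> carrier G \<and> p (r a) = scalar_Sp a) \<and> r 0 = \<one> \<and>
     (\<forall>a b. r (a + b) = r a \<otimes> r b)"
    by (rule one_parameter_lift[OF continuous_on_scalar_Sp unitary_SpD(1)[OF scalar_Sp_unitary]
          scalar_Sp_0 scalar_Sp_add]) blast
  then have "continuous_on UNIV rot \<and> (\<forall>a. rot a \<in> carrier G \<and> p (rot a) = scalar_Sp a) \<and> rot 0 = \<one> \<and>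
     (\<forall>a b. rot (a + b) = rot a \<otimes> rot b)"
    unfolding rot_def by (rule someI_ex)
  then show "continuous_on UNIV rot" "rot a \<in> carrier G" "p (rot a) = scalar_Sp a" "rot 0 = \<one>"
      "rot (a + b) = rot a \<otimes> rot b" by auto
qed

lemma continuous_on_rot_compose:
  "continuous_on S f \<Longrightarrow> continuous_on S (\<lambda>x. rot (f x))"
  by (rule continuous_on_compose2[OF continuous_on_rot]) auto

lemma rot_minus: "rot (- a) = inv (rot a)"
  using rot_add[of "- a" a] by (intro inv_equality[symmetric]) (simp_all add: rot_0)

lemma angle_rot: "angle (rot a) = real CARD('n) * a"
  by (rule angle_curve[of UNIV rot])
    (auto simp: continuous_on_rot rot_0 p_rot circle_part_scalar_Sp)

lemma rot_unitary_cover: "rot a \<in> unitary_cover"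
  by (simp add: unitary_cover_def p_rot scalar_Sp_unitary)

lemma unitary_coverD: "g \<in> unitary_cover \<Longrightarrow> g \<in> carrier G" "g \<in> unitary_cover \<Longrightarrow> p g \<in> unitary_Sp"
  by (auto simp: unitary_cover_def)

lemma subgroup_unitary_cover: "subgroup unitary_cover G"
  by (rule subgroupI)
    (auto simp: unitary_cover_def p_mult p_inv unitary_Sp_mult unitary_Sp_inv_closed p_one unitary_Sp_one)

lemma subgroup_special_unitary_cover: "subgroup special_unitary_cover G"
proof (rule subgroupI)
  show "special_unitary_cover \<noteq> {}"
    using special_unitary_Sp_one p_one unfolding special_unitary_cover_def by force
qed (auto simp: special_unitary_cover_def p_mult p_inv special_unitary_Sp_mult special_unitary_Sp_inv)

lemma angle_shift:
  assumes "g \<in> unitary_cover"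
  shows "angle (g \<otimes> inv (rot (angle g / CARD('n)))) = 0"
  using assms rot_unitary_cover
  by (simp add: unitary_cover_def angle_mult angle_rot rot_minus[symmetric])

text \<open>For the harder inclusion, an element is divided by the rotation of the same angle. The
  quotient lies over a scalar that is an n-th root of unity; by connectedness that root is 1, and
  \<open>kernel_angle\<close> makes the quotient trivial.\<close>

lemma grpR_eq: "R = range rot"
proof
  let ?X = "{g \<in> carrier G. p g \<in> {unitary_embed (mat (cis a)) | a. True}}"
  have X: "?X = {g \<in> carrier G. \<exists>a. p g = scalar_Sp a}" by (auto simp: scalar_Sp_def)
  have "connected (range rot)" by (rule connected_continuous_image[OF continuous_on_rot connected_UNIV])
  moreover have "range rot \<subseteq> ?X" unfolding X using p_rot by auto
  moreover have "\<one> \<in> range rot" using rot_0 by (metis rangeI)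
  ultimately show "range rot \<subseteq> R" unfolding grpR_def by (intro connected_component_maximal)
  define f where "f = (\<lambda>g. g \<otimes> inv (rot (angle g / CARD('n))))"
  have RX: "R \<subseteq> ?X" unfolding grpR_def by (rule connected_component_subset)
  have conR: "connected R" unfolding grpR_def by (rule connected_connected_component)
  have oneR: "\<one> \<in> R"
    unfolding grpR_def using \<open>range rot \<subseteq> ?X\<close> \<open>\<one> \<in> range rot\<close> connected_component_refl by blast
  have RG: "g \<in> carrier G" if "g \<in> R" for g using RX that by blast
  have contf: "continuous_on R f" unfolding f_def
    by (intro continuous_on_mult continuous_on_inv continuous_on_rot_compose continuous_intros
        continuous_on_angle) (use RG in auto)
  have fin: "finite {z :: complex. z ^ CARD('n) = 1}" by (rule finite_roots_unity) simp
  have pf_root: "\<exists>z. z ^ CARD('n) = 1 \<and> p (f g) = unitary_embed (mat z)" if g: "g \<in> R" for g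
  proof -
    obtain b where b: "p g = scalar_Sp b" using g RX unfolding X by blast
    have "cis (angle g) = cis (real CARD('n) * b)"
      using cis_angle[OF RG[OF g]] by (simp add: b circle_part_scalar_Sp)
    then have "cis (real CARD('n) * b - angle g) = 1" by (simp add: cis_divide[symmetric])
    moreover have "cis (b - angle g / CARD('n)) ^ CARD('n) = cis (real CARD('n) * (b - angle g / CARD('n)))"
      by (rule Complex.DeMoivre)
    ultimately have "cis (b - angle g / CARD('n)) ^ CARD('n) = 1" by (simp add: right_diff_distrib)
    moreover have "p (f g) = scalar_Sp (b - angle g / CARD('n))"
      using RG[OF g] by (simp add: f_def p_mult b p_rot rot_minus[symmetric] scalar_Sp_add[symmetric])
    ultimately show ?thesis unfolding scalar_Sp_def by blast
  qed
  \<comment> \<open>Any diagonal entry recovers the scalar as a continuous function with finitely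
    many values.\<close>
  fix i :: 'n
  define \<zeta> where "\<zeta> g = complex_part (p (f g)) $ i $ i" for g
  have \<zeta>: "\<zeta> g ^ CARD('n) = 1" "p (f g) = unitary_embed (mat (\<zeta> g))" if g: "g \<in> R" for g
  proof -
    obtain z where z: "z ^ CARD('n) = 1" "p (f g) = unitary_embed (mat z)" using pf_root[OF g] by blast
    have "\<zeta> g = z" by (simp add: \<zeta>_def z(2) mat_def)
    then show "\<zeta> g ^ CARD('n) = 1" "p (f g) = unitary_embed (mat (\<zeta> g))" using z by simp_all
  qed
  have "finite (\<zeta> ` R)" using \<zeta>(1) by (intro finite_subset[OF _ fin]) auto
  moreover have "continuous_on R \<zeta>" unfolding \<zeta>_def
    by (intro continuous_intros continuous_on_p contf) (use RG in \<open>auto simp: f_def\<close>)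
  ultimately have "\<zeta> constant_on R"
    using conR by (intro continuous_finite_range_constant)
  moreover have "\<zeta> \<one> = 1"
  proof -
    have "p (f \<one>) = unitary_embed (mat 1)" by (simp add: f_def angle_one rot_0 p_one)
    then have "complex_part (p (f \<one>)) = mat 1" by (simp only: complex_part_unitary_embed)
    then show ?thesis by (simp add: \<zeta>_def mat_def)
  qed
  ultimately have "\<zeta> g = 1" if "g \<in> R" for g
    using that oneR unfolding constant_on_def by metis
  then have pf: "p (f g) = mat 1" if "g \<in> R" for g using \<zeta>(2)[OF that] that by simp
  show "R \<subseteq> range rot"
  proof
    fix g assume g: "g \<in> R"
    have "g \<in> unitary_cover"
      using g RX scalar_Sp_unitary unfolding X unitary_cover_def by force
    then have "f g = \<one>"
      using kernel_angle[of "f g"] pf[OF g] angle_shift RG[OF g] by (simp add: f_def)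
    then have "g = rot (angle g / CARD('n))"
      using RG[OF g] unfolding f_def by (metis inv_equality inv_inv inv_closed rot_closed)
    then show "g \<in> range rot" by blast
  qed
qed

section \<open>The identity component over SU(n)\<close>

lemma grpH_component: "H = connected_component_set special_unitary_cover \<one>"
  by (simp add: grpH_def special_unitary_Sp_eq[symmetric] special_unitary_cover_def)

lemma H_subset: "H \<subseteq> special_unitary_cover"
  unfolding grpH_component by (rule connected_component_subset)

lemma H_carrier: "h \<in> H \<Longrightarrow> h \<in> carrier G"
  using H_subset by (auto simp: special_unitary_cover_def)

lemma H_unitary_cover: "h \<in> H \<Longrightarrow> h \<in> unitary_cover"
  using H_subset special_unitary_SpD(1) by (auto simp: special_unitary_cover_def unitary_cover_def)

lemma connected_H: "connected H"
  unfolding grpH_component by (rule connected_connected_component)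

lemma one_in_H: "\<one> \<in> H"
  unfolding grpH_component
  using subgroup.one_closed[OF subgroup_special_unitary_cover] connected_component_refl by blast

lemma connected_subset_H:
  assumes "connected T" "T \<subseteq> special_unitary_cover" "a \<in> T" "a \<in> H"
  shows "T \<subseteq> H"
proof -
  have "T \<subseteq> connected_component_set special_unitary_cover a"
    using assms by (intro connected_component_maximal)
  then show ?thesis
    using assms(4) connected_component_eq unfolding grpH_component by metis
qed

lemma subgroup_H: "subgroup H G"
proof (rule subgroupI)
  show "H \<subseteq> carrier G" using H_carrier by blast
  show "H \<noteq> {}" using one_in_H by blast
  note S = subgroup_special_unitary_cover
  fix a assume a: "a \<in> H"
  have "(\<lambda>h. inv h) ` H \<subseteq> H"
  proof (rule connected_subset_H)
    show "connected ((\<lambda>h. inv h) ` H)"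
      using H_carrier by (intro connected_continuous_image connected_H continuous_on_inv continuous_intros)
    show "\<one> \<in> (\<lambda>h. inv h) ` H" using one_in_H by force
  qed (use one_in_H H_subset subgroup.m_inv_closed[OF S] in auto)
  then show "inv a \<in> H" using a by blast
  fix b assume b: "b \<in> H"
  have "(\<lambda>h. a \<otimes> h) ` H \<subseteq> H"
  proof (rule connected_subset_H)
    show "connected ((\<lambda>h. a \<otimes> h) ` H)"
      using H_carrier a by (intro connected_continuous_image connected_H continuous_on_mult continuous_intros)
    show "a \<in> (\<lambda>h. a \<otimes> h) ` H" using one_in_H H_carrier[OF a] by force
  qed (use a H_subset subgroup.m_closed[OF S] in auto)
  then show "a \<otimes> b \<in> H" using b by blast
qed

lemma angle_H: "h \<in> H \<Longrightarrow> angle h = 0"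
proof -
  assume h: "h \<in> H"
  have "angle h - 0 = angle \<one> - 0"
  proof (rule cis_eq_imp_diff_constant[OF connected_H])
    show "continuous_on H angle" "continuous_on H (\<lambda>_. 0)"
      using H_carrier by (auto intro: continuous_on_subset[OF continuous_on_carrier_angle])
    show "cis (angle x) = cis 0" if "x \<in> H" for x
      using that H_subset H_carrier by (auto simp: cis_angle special_unitary_cover_def special_unitary_SpD)
  qed (use h one_in_H in auto)
  then show ?thesis by (simp add: angle_one)
qed

lemma rot_commute_H: "h \<in> H \<Longrightarrow> rot a \<otimes> h = h \<otimes> rot a"
  by (rule commute_connected[OF connected_H _ one_in_H])
    (auto simp: H_carrier p_rot intro!: scalar_Sp_commute_unitary unitary_coverD(2) H_unitary_cover)

text \<open>Dividing a path over U(n) pointwise by the rotation of equal angle keeps the angle at 0,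
  so the divided path stays over SU(n) and, starting at the unit, in \<open>H\<close>.\<close>

lemma unitary_cover_decomp:
  assumes g: "g \<in> unitary_cover"
  shows "\<exists>h\<in>H. g = h \<otimes> rot (angle g / CARD('n))"
proof -
  obtain c where c: "path c" "pathstart c = \<one>" "pathfinish c = g"
      "\<And>t. t \<in> {0..1} \<Longrightarrow> c t \<in> carrier G" "\<And>t. t \<in> {0..1} \<Longrightarrow> p (c t) \<in> unitary_Sp"
    using unitary_path g unfolding unitary_cover_def by blast
  define \<sigma> where "\<sigma> t = c t \<otimes> inv (rot (angle (c t) / CARD('n)))" for t
  have cK: "c t \<in> unitary_cover" if "t \<in> {0..1}" for t using c that by (simp add: unitary_cover_def)
  have "continuous_on {0..1} c" using c by (simp add: path_def)
  then have "continuous_on {0..1} \<sigma>" unfolding \<sigma>_def using c(4)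
    by (intro continuous_on_mult continuous_on_inv continuous_on_rot_compose continuous_intros
        continuous_on_angle) auto
  then have "connected (\<sigma> ` {0..1})" by (rule connected_continuous_image) simp
  moreover have "\<sigma> ` {0..1} \<subseteq> special_unitary_cover"
  proof
    fix x assume "x \<in> \<sigma> ` {0..1}"
    then obtain t where t: "t \<in> {0..1}" "x = \<sigma> t" by blast
    have x: "x \<in> unitary_cover"
      unfolding t \<sigma>_def using cK[OF t(1)] rot_unitary_cover
      by (intro subgroup.m_closed subgroup.m_inv_closed subgroup_unitary_cover)
    have "angle x = 0" using angle_shift[OF cK[OF t(1)]] by (simp add: t \<sigma>_def)
    then have "circle_part (p x) = 1" using cis_angle[of x] x by (simp add: unitary_cover_def)
    then show "x \<in> special_unitary_cover"
      using x by (simp add: special_unitary_cover_def unitary_cover_def special_unitary_Sp_def)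
  qed
  moreover have "\<sigma> 0 = \<one>" using c by (simp add: \<sigma>_def pathstart_def angle_one rot_0)
  then have "\<one> \<in> \<sigma> ` {0..1}" by force
  ultimately have "\<sigma> ` {0..1} \<subseteq> H" using one_in_H by (intro connected_subset_H)
  then have "\<sigma> 1 \<in> H" by auto
  moreover have "g = \<sigma> 1 \<otimes> rot (angle g / CARD('n))"
    using c(3) unitary_coverD(1)[OF g] by (simp add: \<sigma>_def pathfinish_def m_assoc)
  ultimately show ?thesis by blast
qed

lemma H_R_eq: "H <#> R = unitary_cover"
proof
  show "H <#> R \<subseteq> unitary_cover"
    using subgroup.m_closed[OF subgroup_unitary_cover] H_unitary_cover rot_unitary_cover
    by (auto simp: set_mult_def grpR_eq)
  show "unitary_cover \<subseteq> H <#> R"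
    using unitary_cover_decomp by (force simp: set_mult_def grpR_eq)
qed

text \<open>Commuting with one lift of \<open>Omega\<close> already forces the image to be
  unitary.\<close>

lemma center_unitary_cover: "group_center G \<subseteq> unitary_cover"
proof
  fix z assume z: "z \<in> group_center G"
  then have zG: "z \<in> carrier G" by (simp add: group_center_def)
  obtain g where g: "g \<in> carrier G" "p g = Omega" using p_surj[OF Omega_in_Sp] by blast
  have "p (z \<otimes> g) = p (g \<otimes> z)" using z g by (simp add: group_center_def)
  then have "p z ** Omega = Omega ** p z" using zG g by (simp add: p_mult)
  then show "z \<in> unitary_cover" using zG by (simp add: unitary_cover_def Sp_commuting_Omega_unitary p_in_Sp)
qed

text \<open>These central elements are spaced by \<open>pi\<close> along the line, which is enough
  for cocompactness.\<close>

lemma rot_int_pi_center: "rot (of_int k * pi) \<in> group_center G"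
proof -
  have "rot (of_int k * pi) \<otimes> g = g \<otimes> rot (of_int k * pi)" if "g \<in> carrier G" for g
    by (rule commute_connected[OF connected_carrier _ _ _ _ that]) (simp_all add: p_rot scalar_Sp_int_pi)
  then show ?thesis by (simp add: group_center_def)
qed

section \<open>Compactness of \<open>\<H>\<close>\<close>

text \<open>Around each image point the local section, translated to a preimage, gives nearby
  preimages in \<open>T\<close>.\<close>

lemma p_open_map:
  assumes T: "openin (top_of_set (carrier G)) T"
  shows "openin (top_of_set Sp) (p ` T)"
proof (subst openin_subopen, intro ballI)
  fix y assume "y \<in> p ` T"
  then obtain g where g: "g \<in> T" "y = p g" by blast
  have gG: "g \<in> carrier G" using g T openin_imp_subset by blast
  obtain V s where V: "openin (top_of_set Sp) V" "mat 1 \<in> V" "continuous_on V s"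
      "\<And>v. v \<in> V \<Longrightarrow> p (s v) = v" "s (mat 1) = \<one>" "\<And>v. v \<in> V \<Longrightarrow> s v \<in> carrier G"
    using local_section by metis
  let ?W = "V \<inter> (\<lambda>v. g \<otimes> s v) -` T"
  have "openin (top_of_set V) ?W"
    by (rule continuous_openin_preimage[OF _ _ T])
      (use V gG in \<open>auto intro!: continuous_on_mult continuous_intros\<close>)
  then have W: "openin (top_of_set Sp) ?W" using V(1) openin_trans by blast
  let ?N = "Sp \<inter> (\<lambda>M. matrix_inv y ** M) -` ?W"
  have y: "y \<in> Sp" using g gG p_in_Sp by simp
  have "openin (top_of_set Sp) ?N"
    by (rule continuous_openin_preimage[OF _ _ W])
      (use y in \<open>auto intro!: continuous_intros Sp_mult Sp_matrix_inv(2)\<close>)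
  moreover have "y \<in> ?N" using y V g gG by (simp add: Sp_matrix_inv(4))
  moreover have "?N \<subseteq> p ` T"
  proof
    fix M assume M: "M \<in> ?N"
    let ?v = "matrix_inv y ** M"
    have v: "?v \<in> V" "g \<otimes> s ?v \<in> T" using M by auto
    have "p (g \<otimes> s ?v) = y ** matrix_inv y ** M"
      using g gG V v by (simp add: p_mult matrix_mul_assoc)
    then have "M = p (g \<otimes> s ?v)" by (simp add: Sp_matrix_inv(3)[OF y])
    then show "M \<in> p ` T" using v by blast
  qed
  ultimately show "\<exists>T'. openin (top_of_set Sp) T' \<and> y \<in> T' \<and> T' \<subseteq> p ` T" by blast
qed

text \<open>Described by the angle instead of as a component, so that \<open>p\<close> can be shown
  to map it homeomorphically onto SU(n). It contains \<open>H\<close> as a closed subset.\<close>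

definition zero_angle_cover :: "'g set" where
  "zero_angle_cover = {g \<in> special_unitary_cover. angle g = 0}"

lemma zero_angle_coverD:
  assumes "g \<in> zero_angle_cover"
  shows "g \<in> carrier G" "p g \<in> special_unitary_Sp" "p g \<in> unitary_Sp" "angle g = 0"
  using assms special_unitary_SpD by (auto simp: zero_angle_cover_def special_unitary_cover_def)

lemma inj_on_zero_angle_cover: "inj_on p zero_angle_cover"
proof (rule inj_onI)
  fix g h assume gh: "g \<in> zero_angle_cover" "h \<in> zero_angle_cover" and eq: "p g = p h"
  note g = zero_angle_coverD[OF gh(1)] and h = zero_angle_coverD[OF gh(2)]
  have "p (inv g \<otimes> h) = mat 1"
    using g h eq by (simp add: p_mult p_inv Sp_matrix_inv(4) p_in_Sp)
  moreover have "angle (inv g \<otimes> h) = 0"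
    using g h by (simp add: angle_mult angle_inv p_inv unitary_Sp_inv_closed)
  ultimately have "inv g \<otimes> h = \<one>" using g h by (intro kernel_angle) auto
  then show "g = h" using g h by (metis inv_equality inv_inv inv_closed)
qed

lemma p_zero_angle_cover: "p ` zero_angle_cover = special_unitary_Sp"
proof
  show "p ` zero_angle_cover \<subseteq> special_unitary_Sp" using zero_angle_coverD by blast
  show "special_unitary_Sp \<subseteq> p ` zero_angle_cover"
  proof
    fix M assume M: "M \<in> (special_unitary_Sp :: (real^('n + 'n)^('n + 'n)) set)"
    then have MU: "M \<in> unitary_Sp" "circle_part M = 1" by (auto simp: special_unitary_SpD)
    obtain g where g: "g \<in> carrier G" "p g = M" using p_surj unitary_SpD(1)[OF MU(1)] by blast
    obtain i :: 'n where True by simp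
    obtain D where D: "continuous_on UNIV D" "\<And>a. D a \<in> carrier G" "D 0 = \<one>"
        "\<And>a. p (D a) = unitary_embed (coordinate_rotation i (cis a))"
      by (rule coordinate_rotation_lift) (rule that)
    have "circle_part (p (D a)) = cis a" for a
      by (simp add: D(4) circle_part_unitary unitary_embed_in_unitary_Sp coordinate_rotation_unitary
          det_coordinate_rotation)
    then have angD: "angle (D a) = 1 * a" for a
      by (intro angle_curve[of UNIV D]) (use D in auto)
    \<comment> \<open>The angle of \<open>g\<close> is a multiple of \<open>2 * pi\<close>, so the
      correcting factor lies in the kernel of \<open>p\<close> and only the angle changes.\<close>
    let ?g = "g \<otimes> D (- angle g)"
    have "cis (- angle g) = 1" using cis_angle[OF g(1)] g MU by (simp add: cis_inverse[symmetric])
    then have "p ?g = M" using g D by (simp add: p_mult coordinate_rotation_1)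
    moreover have "angle ?g = 0" using g D MU angD[of "- angle g"] by (simp add: angle_mult)
    ultimately have "?g \<in> zero_angle_cover" "M = p ?g"
      using g D M by (simp_all add: zero_angle_cover_def special_unitary_cover_def)
    then show "M \<in> p ` zero_angle_cover" by blast
  qed
qed

lemma compact_zero_angle_cover: "compact zero_angle_cover"
proof -
  let ?Z = zero_angle_cover
  define s where "s = inv_into ?Z p"
  have sp: "s (p g) = g" if "g \<in> ?Z" for g unfolding s_def by (rule inv_into_f_f[OF inj_on_zero_angle_cover that])
  have "continuous_on special_unitary_Sp s"
  proof (rule continuous_on_inverse_open_map[OF _ p_zero_angle_cover])
    show "continuous_on ?Z p"
      using zero_angle_coverD(1) by (intro continuous_on_p continuous_intros)
    show "\<And>x. x \<in> ?Z \<Longrightarrow> s (p x) = x" by (rule sp)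
    fix U assume "openin (top_of_set ?Z) U"
    then obtain W where W: "open W" "U = ?Z \<inter> W" by (auto simp: openin_open)
    \<comment> \<open>Over SU(n) all angles are multiples of \<open>2 * pi\<close>, so this open
      window singles out angle 0 and turns \<open>U\<close> into a trace of an open set of the whole
      group.\<close>
    let ?T = "(carrier G \<inter> angle -` {-1<..<1}) \<inter> (carrier G \<inter> W)"
    have "openin (top_of_set (carrier G)) ?T"
      by (intro openin_Int continuous_openin_preimage_gen continuous_on_carrier_angle openin_open_Int W) auto
    then have "openin (top_of_set Sp) (p ` ?T)" by (rule p_open_map)
    then obtain O' where O': "open O'" "p ` ?T = Sp \<inter> O'" unfolding openin_open by blast
    have "p ` U = special_unitary_Sp \<inter> p ` ?T"
    proof
      show "p ` U \<subseteq> special_unitary_Sp \<inter> p ` ?T" using W zero_angle_coverD by auto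
      show "special_unitary_Sp \<inter> p ` ?T \<subseteq> p ` U"
      proof clarify
        fix g assume g: "g \<in> carrier G" "angle g \<in> {-1<..<1}" "g \<in> W" and M: "p g \<in> special_unitary_Sp"
        have "cis (angle g) = 1" using cis_angle[OF g(1)] special_unitary_SpD(2)[OF M] by simp
        then obtain n :: int where n: "angle g = 2 * pi * n"
          using cos_one_2pi_int[of "angle g"] by (auto simp: complex_eq_iff mult_ac)
        have "angle g = 0"
        proof (rule ccontr)
          assume "angle g \<noteq> 0"
          then have "n \<noteq> 0" using n by auto
          then have "1 \<le> \<bar>real_of_int n\<bar>" by linarith
          then have "2 * pi * 1 \<le> 2 * pi * \<bar>real_of_int n\<bar>" by (intro mult_left_mono) auto
          also have "\<dots> = \<bar>angle g\<bar>" by (simp add: n abs_mult)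
          finally show False using g(2) pi_ge_two by auto
        qed
        then have "g \<in> U" using g M W by (simp add: zero_angle_cover_def special_unitary_cover_def)
        then show "p g \<in> p ` U" by blast
      qed
    qed
    moreover have "special_unitary_Sp \<subseteq> Sp" using special_unitary_SpD(1) unitary_SpD(1) by blast
    ultimately have "p ` U = special_unitary_Sp \<inter> O'" unfolding O'(2) by blast
    then show "openin (top_of_set special_unitary_Sp) (p ` U)" using O'(1) by (simp add: openin_open_Int)
  qed
  then have "compact (s ` special_unitary_Sp)"
    by (rule compact_continuous_image[OF _ compact_special_unitary_Sp])
  moreover have "s ` special_unitary_Sp = ?Z"
    unfolding p_zero_angle_cover[symmetric] image_image using sp by simp
  ultimately show ?thesis by simp
qed

lemma compact_H: "compact H"
proof -
  have "closedin (top_of_set special_unitary_cover) H"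
    unfolding grpH_component by (rule closedin_connected_component)
  moreover have "H \<subseteq> zero_angle_cover" using H_subset angle_H by (auto simp: zero_angle_cover_def)
  moreover have "zero_angle_cover \<subseteq> special_unitary_cover" by (auto simp: zero_angle_cover_def)
  ultimately have "closedin (top_of_set zero_angle_cover) H" by (rule closedin_subset_trans)
  then show ?thesis using compact_zero_angle_cover closedin_compact by blast
qed

end

section \<open>The group \<open>\<E>\<close>\<close>

context Sp_cover
begin

lemma coset_mult_H: "x \<in> carrier G \<Longrightarrow> h \<in> H \<Longrightarrow> (x \<otimes> h) <# H = x <# H"
  by (rule l_repr_independence[symmetric, OF _ _ subgroup_H]) (auto simp: l_coset_def)

lemma coset_eqD:
  assumes "x \<in> carrier G" "y \<in> carrier G" "x <# H = y <# H" shows "\<exists>h\<in>H. y = x \<otimes> h"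
  using lcos_self[OF assms(2) subgroup_H] assms(3) by (auto simp: l_coset_def)

lemma one_coset_H: "\<one> <# H = H"
  using H_carrier by (force simp: l_coset_def)

section \<open>The quotient of HR by H as the real line\<close>

definition rot_coset :: "real \<Rightarrow> 'g set" where
  "rot_coset a = rot a <# H"

abbreviation level :: "'g \<Rightarrow> real" where
  "level g \<equiv> angle g / CARD('n)"

lemma level_rot: "level (rot a) = a"
  by (simp add: angle_rot)

lemma unitary_cover_coset:
  assumes "g \<in> unitary_cover" shows "g <# H = rot_coset (level g)"
proof -
  obtain h where h: "h \<in> H" "g = h \<otimes> rot (level g)" using unitary_cover_decomp[OF assms] by blast
  then have "g = rot (level g) \<otimes> h" using rot_commute_H by simp
  then show ?thesis using coset_mult_H[OF rot_closed h(1)] unfolding rot_coset_def by metis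
qed

lemma rot_coset_inject: "rot_coset a = rot_coset b \<longleftrightarrow> a = b"
proof
  assume "rot_coset a = rot_coset b"
  then obtain h where h: "h \<in> H" "rot b = rot a \<otimes> h"
    using coset_eqD[of "rot a" "rot b"] by (auto simp: rot_coset_def)
  have "angle (rot b) = angle (rot a) + angle h"
    unfolding h(2) using rot_unitary_cover H_carrier h(1) by (intro angle_mult) (auto simp: unitary_cover_def)
  then show "a = b" using h(1) by (simp add: angle_rot angle_H)
qed simp

abbreviation Q :: "'g set monoid" where "Q \<equiv> HR_mod_H G p"

lemma carrier_grpHR: "carrier (grpHR G p) = unitary_cover"
  by (simp add: grpHR_def H_R_eq)

lemma image_coset_unitary_cover: "(\<lambda>x. x <# H) ` unitary_cover = range rot_coset"
proof
  show "(\<lambda>x. x <# H) ` unitary_cover \<subseteq> range rot_coset" using unitary_cover_coset by auto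
  show "range rot_coset \<subseteq> (\<lambda>x. x <# H) ` unitary_cover" using rot_unitary_cover by (auto simp: rot_coset_def)
qed

lemma carrier_Q: "carrier Q = range rot_coset"
proof -
  have "carrier Q = (\<lambda>x. x <# H) ` unitary_cover"
    by (auto simp: HR_mod_H_def LFactGroup_def LCOSETS_def carrier_grpHR l_coset_def) (auto simp: grpHR_def)
  then show ?thesis by (simp only: image_coset_unitary_cover)
qed

text \<open>The product in the quotient is the product of sets; \<open>rot b\<close> moves past
  \<open>H\<close> because rotations commute with it.\<close>

lemma mult_Q: "rot_coset a \<otimes>\<^bsub>Q\<^esub> rot_coset b = rot_coset (a + b)"
proof -
  have "rot_coset a \<otimes>\<^bsub>Q\<^esub> rot_coset b = rot_coset a <#> rot_coset b"
    by (simp add: HR_mod_H_def LFactGroup_def set_mult_def grpHR_def)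
  also have "\<dots> = rot_coset (a + b)"
  proof (intro equalityI subsetI)
    fix x assume "x \<in> rot_coset a <#> rot_coset b"
    then obtain h k where hk: "h \<in> H" "k \<in> H" "x = (rot a \<otimes> h) \<otimes> (rot b \<otimes> k)"
      by (auto simp: set_mult_def rot_coset_def l_coset_def)
    have "x = rot a \<otimes> (h \<otimes> rot b) \<otimes> k" using hk H_carrier by (simp add: m_assoc)
    also have "\<dots> = rot (a + b) \<otimes> (h \<otimes> k)"
      using hk H_carrier by (simp add: rot_commute_H[symmetric] rot_add m_assoc)
    finally show "x \<in> rot_coset (a + b)"
      using subgroup.m_closed[OF subgroup_H hk(1,2)] by (auto simp: rot_coset_def l_coset_def)
  next
    fix x assume "x \<in> rot_coset (a + b)"
    then obtain h where h: "h \<in> H" "x = rot (a + b) \<otimes> h" by (auto simp: rot_coset_def l_coset_def)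
    then have "x = (rot a \<otimes> \<one>) \<otimes> (rot b \<otimes> h)" using H_carrier by (simp add: rot_add m_assoc)
    then show "x \<in> rot_coset a <#> rot_coset b"
      using h(1) one_in_H unfolding set_mult_def rot_coset_def l_coset_def by blast
  qed
  finally show ?thesis .
qed

lemma one_Q: "\<one>\<^bsub>Q\<^esub> = rot_coset 0"
  by (simp add: HR_mod_H_def LFactGroup_def rot_coset_def rot_0 one_coset_H)

lemma group_Q: "group Q"
proof (rule groupI)
  fix x assume "x \<in> carrier Q"
  then obtain a where "x = rot_coset a" by (auto simp: carrier_Q)
  then have "rot_coset (- a) \<otimes>\<^bsub>Q\<^esub> x = \<one>\<^bsub>Q\<^esub>" by (simp add: mult_Q one_Q)
  then show "\<exists>y\<in>carrier Q. y \<otimes>\<^bsub>Q\<^esub> x = \<one>\<^bsub>Q\<^esub>" by (auto simp: carrier_Q)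
qed (auto simp: carrier_Q mult_Q one_Q add.assoc)

lemma inv_Q: "inv\<^bsub>Q\<^esub> (rot_coset a) = rot_coset (- a)"
  by (rule group.inv_equality[OF group_Q]) (auto simp: carrier_Q mult_Q one_Q)

section \<open>The antidiagonal copy of the centre\<close>

lemma centerD:
  assumes "z \<in> group_center G"
  shows "z \<in> carrier G" "\<And>g. g \<in> carrier G \<Longrightarrow> z \<otimes> g = g \<otimes> z" "z \<in> unitary_cover" "p z \<in> unitary_Sp"
  using assms center_unitary_cover unitary_coverD(2) by (auto simp: group_center_def)

lemma level_center_mult: "z \<in> group_center G \<Longrightarrow> g \<in> carrier G \<Longrightarrow> level (z \<otimes> g) = level z + level g"
  using centerD(1,4)[of z] by (simp add: angle_mult add_divide_distrib)

abbreviation N :: "('g \<times> 'g set) set" where "N \<equiv> antidiag_center G p"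
abbreviation D :: "('g \<times> 'g set) monoid" where "D \<equiv> G \<times>\<times> Q"

lemma N_eq: "N = {(z, rot_coset (- level z)) | z. z \<in> group_center G}"
proof -
  have "inv\<^bsub>Q\<^esub> (z <# H) = rot_coset (- level z)" if "z \<in> group_center G" for z
    using that centerD(3) by (simp add: unitary_cover_coset inv_Q)
  then show ?thesis unfolding antidiag_center_def by blast
qed

lemma group_D: "group D"
  by (rule DirProd_group[OF is_group group_Q])

lemma subgroup_center: "subgroup (group_center G) G"
proof (rule subgroupI)
  show "group_center G \<noteq> {}" using l_one r_one unfolding group_center_def by force
  show "group_center G \<subseteq> carrier G" by (auto simp: group_center_def)
  fix a assume a: "a \<in> group_center G"
  note a' = centerD[OF a]
  have "inv a \<otimes> g = g \<otimes> inv a" if g: "g \<in> carrier G" for g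
  proof -
    have "inv a \<otimes> g = inv a \<otimes> (g \<otimes> a) \<otimes> inv a" using a'(1) g by (simp add: m_assoc)
    also have "\<dots> = inv a \<otimes> (a \<otimes> g) \<otimes> inv a" using a'(2)[OF g] by simp
    also have "\<dots> = g \<otimes> inv a" using a'(1) g by (simp add: m_assoc[symmetric])
    finally show ?thesis .
  qed
  then show "inv a \<in> group_center G" unfolding group_center_def using inv_closed[OF a'(1)] by blast
  fix b assume b: "b \<in> group_center G"
  note b' = centerD[OF b]
  have "a \<otimes> b \<otimes> g = g \<otimes> (a \<otimes> b)" if g: "g \<in> carrier G" for g
  proof -
    have "a \<otimes> b \<otimes> g = a \<otimes> (g \<otimes> b)" using a'(1) b'(1) b'(2)[OF g] g by (simp add: m_assoc)
    also have "\<dots> = (g \<otimes> a) \<otimes> b" using a'(1) b'(1) a'(2)[OF g] g by (simp add: m_assoc[symmetric])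
    finally show ?thesis using a'(1) b'(1) g by (simp add: m_assoc)
  qed
  then show "a \<otimes> b \<in> group_center G"
    unfolding group_center_def using m_closed[OF a'(1) b'(1)] by blast
qed

text \<open>Closure holds because \<open>level\<close> is additive on the centre. Normality holds
  because \<open>N\<close> is central: first entries are central in \<open>G\<close> and the
  quotient \<open>Q\<close> is commutative.\<close>

lemma normal_N: "N \<lhd> D"
proof -
  interpret D: group D by (rule group_D)
  have sub: "subgroup N D"
  proof (rule D.subgroupI)
    show "N \<subseteq> carrier D" using centerD(1) by (auto simp: N_eq carrier_Q)
    show "N \<noteq> {}" using subgroup.one_closed[OF subgroup_center] by (auto simp: N_eq)
    fix x assume "x \<in> N"
    then obtain z where z: "z \<in> group_center G" "x = (z, rot_coset (- level z))" by (auto simp: N_eq)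
    note zz = centerD[OF z(1)]
    have "inv\<^bsub>D\<^esub> x = (inv z, rot_coset (level z))"
      using zz group_Q is_group by (simp add: z(2) inv_Q carrier_Q)
    moreover have "level (inv z) = - level z" using zz by (simp add: angle_inv)
    ultimately show "inv\<^bsub>D\<^esub> x \<in> N"
      using subgroup.m_inv_closed[OF subgroup_center z(1)] unfolding N_eq by force
    fix y assume "y \<in> N"
    then obtain w where w: "w \<in> group_center G" "y = (w, rot_coset (- level w))" by (auto simp: N_eq)
    have "x \<otimes>\<^bsub>D\<^esub> y = (z \<otimes> w, rot_coset (- level (z \<otimes> w)))"
      using level_center_mult[OF z(1) centerD(1)[OF w(1)]] by (simp add: z w mult_Q add.commute)
    then show "x \<otimes>\<^bsub>D\<^esub> y \<in> N"
      using subgroup.m_closed[OF subgroup_center z(1) w(1)] unfolding N_eq by blast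
  qed
  have "x \<otimes>\<^bsub>D\<^esub> n \<otimes>\<^bsub>D\<^esub> inv\<^bsub>D\<^esub> x \<in> N" if x: "x \<in> carrier D" and n: "n \<in> N" for x n
  proof -
    obtain z where z: "z \<in> group_center G" "n = (z, rot_coset (- level z))" using n by (auto simp: N_eq)
    obtain g a where g: "g \<in> carrier G" "x = (g, rot_coset a)" using x by (auto simp: carrier_Q)
    have nD: "n \<in> carrier D" using n subgroup.subset[OF sub] by blast
    have "x \<otimes>\<^bsub>D\<^esub> n = n \<otimes>\<^bsub>D\<^esub> x"
      using centerD(2)[OF z(1) g(1)] by (simp add: z g mult_Q add.commute)
    then have "x \<otimes>\<^bsub>D\<^esub> n \<otimes>\<^bsub>D\<^esub> inv\<^bsub>D\<^esub> x = n \<otimes>\<^bsub>D\<^esub> (x \<otimes>\<^bsub>D\<^esub> inv\<^bsub>D\<^esub> x)"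
      by (simp only: D.m_assoc[OF nD x D.inv_closed[OF x]])
    then have "x \<otimes>\<^bsub>D\<^esub> n \<otimes>\<^bsub>D\<^esub> inv\<^bsub>D\<^esub> x = n" by (simp only: D.r_inv[OF x] D.r_one[OF nD])
    then show ?thesis using n by simp
  qed
  then show ?thesis using sub D.normal_inv_iff by blast
qed

section \<open>Classes in E written with a real second coordinate\<close>

abbreviation E :: "('g \<times> 'g set) set monoid" where "E \<equiv> grpE G p"

definition cls :: "'g \<Rightarrow> real \<Rightarrow> ('g \<times> 'g set) set" where
  "cls g a = classE G p (g, rot_coset a)"

lemma group_E: "group E"
  unfolding grpE_def by (rule normal.factorgroup_is_group[OF normal_N])

lemma carrier_E: "carrier E = {cls g a | g a. g \<in> carrier G}"
  by (auto simp: grpE_def FactGroup_def RCOSETS_def cls_def classE_def carrier_Q)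

lemma cls_closed: "g \<in> carrier G \<Longrightarrow> cls g a \<in> carrier E"
  by (auto simp: carrier_E)

lemma mult_E:
  assumes "g \<in> carrier G" "h \<in> carrier G"
  shows "cls g a \<otimes>\<^bsub>E\<^esub> cls h b = cls (g \<otimes> h) (a + b)"
proof -
  have "cls g a \<otimes>\<^bsub>E\<^esub> cls h b = classE G p ((g, rot_coset a) \<otimes>\<^bsub>D\<^esub> (h, rot_coset b))"
    using normal.rcos_sum[OF normal_N, of "(g, rot_coset a)" "(h, rot_coset b)"] assms
    by (simp add: cls_def classE_def grpE_def FactGroup_def carrier_Q)
  then show ?thesis by (simp add: cls_def mult_Q)
qed

lemma one_E: "\<one>\<^bsub>E\<^esub> = cls \<one> 0"
proof -
  have "N \<subseteq> carrier D" using subgroup.subset normal_imp_subgroup normal_N by blast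
  then have "N #>\<^bsub>D\<^esub> \<one>\<^bsub>D\<^esub> = N" by (rule group.coset_mult_one[OF group_D])
  then show ?thesis by (simp add: cls_def classE_def grpE_def FactGroup_def one_Q)
qed

lemma inv_E: "g \<in> carrier G \<Longrightarrow> inv\<^bsub>E\<^esub> (cls g a) = cls (inv g) (- a)"
  by (rule group.inv_equality[OF group_E]) (simp_all add: mult_E one_E cls_closed)

lemma cls_eq_iff:
  assumes "g \<in> carrier G" "g' \<in> carrier G"
  shows "cls g a = cls g' a' \<longleftrightarrow> (\<exists>z\<in>group_center G. g' = z \<otimes> g \<and> a' = a - level z)"
proof -
  have sub: "subgroup N D" using normal_imp_subgroup normal_N by blast
  have mem: "(g', rot_coset a') \<in> cls g a \<longleftrightarrow> (\<exists>z\<in>group_center G. g' = z \<otimes> g \<and> a' = a - level z)"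
  proof -
    have "cls g a = {(z \<otimes> g, rot_coset (a - level z)) | z. z \<in> group_center G}"
      unfolding cls_def classE_def r_coset_def N_eq by (auto simp: mult_Q)
    then show ?thesis by (auto simp: rot_coset_inject)
  qed
  have D: "(g, rot_coset a) \<in> carrier D" "(g', rot_coset a') \<in> carrier D" using assms by (auto simp: carrier_Q)
  have "cls g a = cls g' a' \<longleftrightarrow> (g', rot_coset a') \<in> cls g a"
  proof
    assume "cls g a = cls g' a'"
    then show "(g', rot_coset a') \<in> cls g a"
      using group.rcos_self[OF group_D D(2) sub] by (simp add: cls_def classE_def)
  next
    assume "(g', rot_coset a') \<in> cls g a"
    then show "cls g a = cls g' a'"
      unfolding cls_def classE_def by (rule group.repr_independence[OF group_D _ D(1) sub])
  qed
  then show ?thesis using mem by simp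
qed

section \<open>The action\<close>

abbreviation X :: "'g set set" where "X \<equiv> spaceX G p"
abbreviation act :: "('g \<times> 'g set) set \<Rightarrow> 'g set \<Rightarrow> 'g set" where "act \<equiv> actE G p"

lemma X_eq: "X = {x <# H | x. x \<in> carrier G}"
  by (auto simp: spaceX_def LCOSETS_def)

lemma H_in_X: "H \<in> X"
  using one_coset_H by (auto simp: X_eq)

text \<open>Changing the representative by \<open>z = k \<otimes> rot (level z)\<close> with
  \<open>k\<close> in \<open>H\<close> shifts the rotation by \<open>- level z\<close>, so the two
  rotations cancel; \<open>k\<close> and the change \<open>h\<close> of coset representative collect
  on the right inside \<open>H\<close>.\<close>

lemma action_well_defined:
  assumes g: "g \<in> carrier G" "g' \<in> carrier G" and x: "x \<in> carrier G" "x' \<in> carrier G"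
    and c: "cls g a = cls g' a'" and eq: "x <# H = x' <# H"
  shows "(g \<otimes> x \<otimes> rot a) <# H = (g' \<otimes> x' \<otimes> rot a') <# H"
proof -
  obtain z where z: "z \<in> group_center G" "g' = z \<otimes> g" "a' = a - level z"
    using c cls_eq_iff[OF g] by blast
  obtain h where h: "h \<in> H" "x' = x \<otimes> h" using coset_eqD[OF x eq] by blast
  obtain k where k: "k \<in> H" "z = k \<otimes> rot (level z)" using unitary_cover_decomp centerD(3)[OF z(1)] by blast
  note zG = centerD(1,2)[OF z(1)]
  have hG: "h \<in> carrier G" "k \<in> carrier G" using h k H_carrier by auto
  have zrot: "z \<otimes> rot a' = rot a \<otimes> k"
  proof -
    have "z \<otimes> rot a' = k \<otimes> (rot (level z) \<otimes> rot a')" by (subst k(2)) (simp add: hG m_assoc)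
    also have "rot (level z) \<otimes> rot a' = rot a" by (simp add: rot_add[symmetric] z(3))
    finally show ?thesis using rot_commute_H[OF k(1)] by simp
  qed
  have "g' \<otimes> x' \<otimes> rot a' = z \<otimes> (g \<otimes> x) \<otimes> (h \<otimes> rot a')"
    using g x zG hG by (simp add: z(2) h(2) m_assoc)
  also have "\<dots> = (g \<otimes> x) \<otimes> z \<otimes> (rot a' \<otimes> h)"
    using zG(2)[of "g \<otimes> x"] g x rot_commute_H[OF h(1)] by simp
  also have "\<dots> = (g \<otimes> x) \<otimes> (z \<otimes> rot a') \<otimes> h" using g x zG hG by (simp add: m_assoc)
  also have "\<dots> = (g \<otimes> x \<otimes> rot a) \<otimes> (k \<otimes> h)" unfolding zrot using g x hG by (simp add: m_assoc)
  finally show ?thesis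
    using coset_mult_H[of "g \<otimes> x \<otimes> rot a" "k \<otimes> h"] g x subgroup.m_closed[OF subgroup_H k(1) h(1)] by simp
qed

lemma act_cls:
  assumes g: "g \<in> carrier G" and x: "x \<in> carrier G"
  shows "act (cls g a) (x <# H) = (g \<otimes> x \<otimes> rot a) <# H"
proof -
  let ?P = "\<lambda>d. \<exists>g' \<in> carrier G. \<exists>r \<in> R. \<exists>x' \<in> carrier G. cls g a = classE G p (g', r <# H) \<and>
      x <# H = x' <# H \<and> d = (g' \<otimes> x' \<otimes> r) <# H"
  have "(THE d. ?P d) = (g \<otimes> x \<otimes> rot a) <# H"
  proof (rule the_equality)
    show "?P ((g \<otimes> x \<otimes> rot a) <# H)"
      using g x by (intro bexI[of _ g] bexI[of _ "rot a"] bexI[of _ x]) (auto simp: cls_def rot_coset_def grpR_eq)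
    fix d assume "?P d"
    then obtain g' b x' where *: "g' \<in> carrier G" "x' \<in> carrier G" "cls g a = cls g' b"
        "x <# H = x' <# H" "d = (g' \<otimes> x' \<otimes> rot b) <# H"
      by (auto simp: grpR_eq cls_def rot_coset_def)
    then show "d = (g \<otimes> x \<otimes> rot a) <# H" using action_well_defined[of g g' x x' a b] g x by simp
  qed
  then show ?thesis using x unfolding actE_def X_eq by auto
qed

lemma act_coset:
  assumes "g \<in> carrier G" "r \<in> R" "x \<in> carrier G"
  shows "act (classE G p (g, r <# H)) (x <# H) = (g \<otimes> x \<otimes> r) <# H"
proof -
  obtain a where "r = rot a" using assms(2) by (auto simp: grpR_eq)
  then show ?thesis using act_cls[OF assms(1,3), of a] by (simp add: cls_def rot_coset_def)
qed

lemma act_in_X: "e \<in> carrier E \<Longrightarrow> c \<in> X \<Longrightarrow> act e c \<in> X"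
  by (auto simp: carrier_E X_eq act_cls)

lemma act_one: "c \<in> X \<Longrightarrow> act \<one>\<^bsub>E\<^esub> c = c"
  by (auto simp: one_E X_eq act_cls rot_0)

lemma act_mult:
  assumes "e \<in> carrier E" "f \<in> carrier E" "c \<in> X"
  shows "act (e \<otimes>\<^bsub>E\<^esub> f) c = act e (act f c)"
proof -
  obtain g a h b x where *: "e = cls g a" "g \<in> carrier G" "f = cls h b" "h \<in> carrier G" "c = x <# H" "x \<in> carrier G"
    using assms by (auto simp: carrier_E X_eq)
  \<comment> \<open>Right multiplications compose in the opposite order, so the commutativity of
    rotations is what makes this an action.\<close>
  have "rot (a + b) = rot b \<otimes> rot a" by (metis add.commute rot_add)
  then show ?thesis using * by (simp add: mult_E act_cls m_assoc)
qed

lemma group_action_E: "group_action E X act"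
proof -
  have bij: "act e \<in> Bij X" if e: "e \<in> carrier E" for e
  proof -
    have i: "inv\<^bsub>E\<^esub> e \<in> carrier E" using group.inv_closed[OF group_E e] .
    have "bij_betw (act e) X X"
      by (rule bij_betw_byWitness[where f' = "act (inv\<^bsub>E\<^esub> e)"])
        (use e i in \<open>auto simp: act_mult[symmetric] act_in_X act_one
          group.l_inv[OF group_E] group.r_inv[OF group_E]\<close>)
    moreover have "act e \<in> extensional X" by (simp add: actE_def)
    ultimately show ?thesis by (simp add: Bij_def)
  qed
  have "act (e \<otimes>\<^bsub>E\<^esub> f) = compose X (act e) (act f)" if "e \<in> carrier E" "f \<in> carrier E" for e f
  proof (rule extensionalityI[of _ X])
    show "act (e \<otimes>\<^bsub>E\<^esub> f) \<in> extensional X" by (simp add: actE_def)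
    show "\<And>c. c \<in> X \<Longrightarrow> act (e \<otimes>\<^bsub>E\<^esub> f) c = compose X (act e) (act f) c"
      using that by (simp add: act_mult compose_eq)
  qed simp
  then have "act \<in> hom E (BijGroup X)" using bij by (auto simp: hom_def BijGroup_def)
  then show ?thesis
    using group_E group_BijGroup by (auto simp: group_action_def group_hom_def group_hom_axioms_def)
qed

lemma stabilizer_eq: "stabilizer E act H = {cls g a | g a. g \<in> carrier G \<and> g \<otimes> rot a \<in> H}"
proof -
  have "act (cls g a) H = H \<longleftrightarrow> g \<otimes> rot a \<in> H" if g: "g \<in> carrier G" for g a
  proof -
    have "act (cls g a) H = (g \<otimes> rot a) <# H"
      using act_cls[OF g one_closed, of a] g by (simp add: one_coset_H)
    moreover have "x <# H = H \<longleftrightarrow> x \<in> H" if "x \<in> carrier G" for x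
      using that coset_mult_H[of \<one> x] lcos_self[OF that subgroup_H] one_coset_H by auto
    ultimately show ?thesis using g by simp
  qed
  then show ?thesis unfolding stabilizer_def carrier_E by blast
qed

section \<open>The topology of \<open>\<E>\<close>\<close>

abbreviation TQ :: "'g set topology" where "TQ \<equiv> HR_mod_H_topology G p"
abbreviation TD :: "('g \<times> 'g set) topology" where "TD \<equiv> prod_topology (top_of_set (carrier G)) TQ"
abbreviation TE :: "('g \<times> 'g set) set topology" where "TE \<equiv> grpE_topology G p"

lemma quotient_map_TQ: "quotient_map (top_of_set unitary_cover) TQ (\<lambda>x. x <# H)"
  unfolding HR_mod_H_topology_def carrier_grpHR by (rule quotient_map_quotient_topology)

lemma topspace_TQ: "topspace TQ = range rot_coset"
  using quotient_imp_surjective_map[OF quotient_map_TQ] image_coset_unitary_cover by simp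

lemma quotient_map_TE: "quotient_map TD TE (classE G p)"
  unfolding grpE_topology_def by (rule quotient_map_quotient_topology)

text \<open>A continuous coordinate on the quotient, obtained by letting \<open>level\<close>
  descend through the quotient map.\<close>

lemma rot_coset_level:
  obtains \<psi> where "continuous_map TQ euclideanreal \<psi>" "\<And>a. \<psi> (rot_coset a) = a"
proof -
  have "continuous_on unitary_cover (\<lambda>x. level x)"
    by (intro continuous_intros continuous_on_angle) (auto simp: unitary_cover_def)
  then have "continuous_map (top_of_set unitary_cover) euclideanreal level" by simp
  then obtain \<psi> where \<psi>: "continuous_map TQ euclideanreal \<psi>" "\<And>x. x \<in> unitary_cover \<Longrightarrow> \<psi> (x <# H) = level x"
    by (rule quotient_map_lift_exists[OF quotient_map_TQ])
      (auto simp: unitary_cover_coset rot_coset_inject)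
  have "\<psi> (rot_coset a) = a" for a
    using \<psi>(2)[OF rot_unitary_cover] unfolding rot_coset_def level_rot by blast
  then show ?thesis using that \<psi>(1) by blast
qed

text \<open>Invariance under the antidiagonal centre lets \<open>f\<close> descend to a continuous
  function on E. It is applied to the matrix norm and to the total angle.\<close>

lemma continuous_map_bounded_on_compact:
  fixes f :: "'g \<times> 'g set \<Rightarrow> real"
  assumes f: "continuous_map TD euclideanreal f"
    and inv: "\<And>g a z. g \<in> carrier G \<Longrightarrow> z \<in> group_center G \<Longrightarrow> f (z \<otimes> g, rot_coset (a - level z)) = f (g, rot_coset a)"
    and L: "compactin TE L"
  obtains B where "\<And>g a. g \<in> carrier G \<Longrightarrow> cls g a \<in> L \<Longrightarrow> \<bar>f (g, rot_coset a)\<bar> \<le> B"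
proof -
  have "f y = f y'" if yy: "y \<in> topspace TD" "y' \<in> topspace TD" "classE G p y = classE G p y'" for y y'
  proof -
    obtain g a g' a' where y: "y = (g, rot_coset a)" "g \<in> carrier G" "y' = (g', rot_coset a')" "g' \<in> carrier G"
      using yy(1,2) by (auto simp: topspace_TQ)
    then have "cls g a = cls g' a'" using yy(3) by (simp add: cls_def)
    then show ?thesis using y inv cls_eq_iff by auto
  qed
  then obtain F where F: "continuous_map TE euclideanreal F" "\<And>y. y \<in> topspace TD \<Longrightarrow> F (classE G p y) = f y"
    using quotient_map_lift_exists[OF quotient_map_TE f] by metis
  have "compact (F ` L)" using image_compactin[OF L F(1)] by simp
  then obtain B where B: "\<And>e. e \<in> L \<Longrightarrow> \<bar>F e\<bar> \<le> B"
    using compact_imp_bounded by (force simp: bounded_iff)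
  have "\<bar>f (g, rot_coset a)\<bar> \<le> B" if "g \<in> carrier G" "cls g a \<in> L" for g a
    using B[OF that(2)] F(2)[of "(g, rot_coset a)"] that(1) by (simp add: cls_def topspace_TQ)
  then show ?thesis using that by blast
qed

text \<open>Multiplying by central elements \<open>rot (k\<pi>)\<close> brings the angle into \<open>[0, \<pi>]\<close>, so the stabilizer
  is a quotient of the compact set \<open>\<H> \<times> [0, \<pi>]\<close>.\<close>

lemma compact_stabilizer: "compactin TE (stabilizer E act H)"
proof -
  define C where "C = H \<times> {0..pi}"
  define f where "f = (\<lambda>z. (fst z \<otimes> inv (rot (snd z)), rot_coset (snd z)))"
  have c1: "continuous_on C (\<lambda>z. fst z \<otimes> inv (rot (snd z)))"
    by (intro continuous_on_mult continuous_on_inv continuous_on_rot_compose continuous_intros)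
      (auto simp: C_def H_carrier)
  have c2: "continuous_on C (\<lambda>z. rot (snd z))" by (intro continuous_on_rot_compose continuous_intros)
  have "continuous_map (top_of_set C) (top_of_set (carrier G)) (\<lambda>z. fst z \<otimes> inv (rot (snd z)))"
    using c1 by (auto simp: continuous_map_in_subtopology C_def H_carrier)
  moreover have "continuous_map (top_of_set C) (top_of_set unitary_cover) (\<lambda>z. rot (snd z))"
    using c2 rot_unitary_cover by (auto simp: continuous_map_in_subtopology)
  then have "continuous_map (top_of_set C) TQ ((\<lambda>x. x <# H) \<circ> (\<lambda>z. rot (snd z)))"
    by (rule continuous_map_compose[OF _ quotient_imp_continuous_map[OF quotient_map_TQ]])
  then have "continuous_map (top_of_set C) TQ (\<lambda>z. rot_coset (snd z))" by (simp add: o_def rot_coset_def)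
  ultimately have "continuous_map (top_of_set C) TD f"
    unfolding f_def by (simp add: continuous_map_paired)
  then have cont: "continuous_map (top_of_set C) TE (classE G p \<circ> f)"
    by (rule continuous_map_compose[OF _ quotient_imp_continuous_map[OF quotient_map_TE]])
  have "compactin (top_of_set C) C"
    using compact_Times[OF compact_H compact_Icc, of 0 pi] by (simp add: compactin_subtopology C_def)
  then have "compactin TE ((classE G p \<circ> f) ` C)" using cont by (rule image_compactin)
  moreover have "(classE G p \<circ> f) ` C = stabilizer E act H"
  proof
    show "(classE G p \<circ> f) ` C \<subseteq> stabilizer E act H"
    proof clarify
      fix h a assume "(h, a) \<in> C"
      then have h: "h \<in> H" by (simp add: C_def)
      have "h \<otimes> inv (rot a) \<otimes> rot a \<in> H" using h H_carrier by (simp add: m_assoc)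
      then show "(classE G p \<circ> f) (h, a) \<in> stabilizer E act H"
        using H_carrier[OF h] unfolding stabilizer_eq f_def
        by (auto simp: cls_def[symmetric] intro!: exI[of _ "h \<otimes> inv (rot a)"] exI[of _ a])
    qed
    show "stabilizer E act H \<subseteq> (classE G p \<circ> f) ` C"
    proof
      fix e assume "e \<in> stabilizer E act H"
      then obtain g a where e: "e = cls g a" "g \<in> carrier G" "g \<otimes> rot a \<in> H" by (auto simp: stabilizer_eq)
      define h where "h = g \<otimes> rot a"
      define k where "k = \<lfloor>a / pi\<rfloor>"
      define a' where "a' = a - of_int k * pi"
      have "of_int k \<le> a / pi" "a / pi < of_int k + 1" unfolding k_def by linarith+
      then have a': "0 \<le> a'" "a' \<le> pi" by (simp_all add: a'_def field_simps)
      have h: "h \<in> H" "h \<in> carrier G" using e H_carrier by (auto simp: h_def)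
      let ?z = "rot (of_int k * pi)"
      note z = rot_int_pi_center[of k]
      have "?z \<otimes> g = h \<otimes> inv (rot a')"
      proof -
        have "inv (rot a') = inv (rot a) \<otimes> ?z"
          using rot_add[of "- a" "of_int k * pi"] by (simp add: a'_def rot_minus[symmetric])
        then have "h \<otimes> inv (rot a') = g \<otimes> ?z" using e(2) by (simp add: h_def m_assoc) (simp add: m_assoc[symmetric])
        then show ?thesis using centerD(2)[OF z e(2)] by simp
      qed
      moreover have "cls g a = cls (?z \<otimes> g) a'"
        using cls_eq_iff[OF e(2), of "?z \<otimes> g" a a'] z e(2) by (auto simp: a'_def angle_rot)
      ultimately have "e = (classE G p \<circ> f) (h, a')" by (simp add: e(1) f_def cls_def)
      then show "e \<in> (classE G p \<circ> f) ` C" using h a' by (auto simp: C_def)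
    qed
  qed
  ultimately show ?thesis by simp
qed

section \<open>Maximality\<close>

text \<open>The matrices under first components of classes in \<open>L\<close> form a bounded group;
  once it is closed under transposition, \<open>bounded_subgroup_orthogonal\<close> applies.\<close>

lemma compact_subgroup_unitary:
  assumes sub: "subgroup L E" and L: "compactin TE L" "stabilizer E act H \<subseteq> L"
    and e: "cls g a \<in> L" "g \<in> carrier G"
  shows "g \<in> unitary_cover"
proof -
  let ?M = "{p g | g a. g \<in> carrier G \<and> cls g a \<in> L}"
  \<comment> \<open>The norm descends to E because central elements lie over orthogonal
    matrices.\<close>
  have "continuous_map TD euclideanreal (norm \<circ> p \<circ> fst)"
  proof (intro continuous_map_compose[OF continuous_map_fst])
    have "continuous_on (carrier G) (norm \<circ> p)" unfolding o_def
      by (intro continuous_intros continuous_on_p) auto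
    then show "continuous_map (top_of_set (carrier G)) euclideanreal (norm \<circ> p)" by simp
  qed
  then obtain B where B: "\<And>g a. g \<in> carrier G \<Longrightarrow> cls g a \<in> L \<Longrightarrow> \<bar>(norm \<circ> p \<circ> fst) (g, rot_coset a)\<bar> \<le> B"
    by (rule continuous_map_bounded_on_compact[OF _ _ L(1)])
      (auto simp: p_mult centerD(1) intro!: norm_orthogonal_mult unitary_SpD(2) centerD(4))
  have mult: "X ** Y \<in> ?M" if XY: "X \<in> ?M" "Y \<in> ?M" for X Y
  proof -
    obtain g a where 1: "X = p g" "g \<in> carrier G" "cls g a \<in> L" using XY(1) by blast
    obtain h b where 2: "Y = p h" "h \<in> carrier G" "cls h b \<in> L" using XY(2) by blast
    have "cls (g \<otimes> h) (a + b) \<in> L" using subgroup.m_closed[OF sub 1(3) 2(3)] mult_E[OF 1(2) 2(2)] by simp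
    moreover have "X ** Y = p (g \<otimes> h)" by (simp add: 1 2 p_mult)
    ultimately show ?thesis using m_closed[OF 1(2) 2(2)] by blast
  qed
  have inv: "matrix_inv X \<in> ?M" if X: "X \<in> ?M" for X
  proof -
    obtain g a where *: "X = p g" "g \<in> carrier G" "cls g a \<in> L" using X by blast
    have "cls (inv g) (- a) \<in> L" using subgroup.m_inv_closed[OF sub *(3)] inv_E[OF *(2)] by simp
    moreover have "matrix_inv X = p (inv g)" by (simp add: * p_inv)
    ultimately show ?thesis using inv_closed[OF *(2)] by blast
  qed
  \<comment> \<open>A lift \<open>k\<close> of any unitary matrix is
    \<open>h \<otimes> rot b\<close>, and the class of \<open>k\<close> with coordinate
    \<open>- b\<close> fixes the base coset.\<close>
  have unitary: "X \<in> ?M" if X: "X \<in> unitary_Sp" for X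
  proof -
    obtain k where k: "k \<in> carrier G" "p k = X" using p_surj unitary_SpD(1)[OF X] by blast
    then have "k \<in> unitary_cover" using X by (simp add: unitary_cover_def)
    then obtain h b where h: "h \<in> H" "k = h \<otimes> rot b" using unitary_cover_decomp by blast
    have "k \<otimes> rot (- b) = h" using h H_carrier by (simp add: rot_minus m_assoc)
    then have "cls k (- b) \<in> L" using L(2) h k unfolding stabilizer_eq by blast
    then show ?thesis using k by blast
  qed
  have Sp: "X \<in> Sp" if "X \<in> ?M" for X using that p_in_Sp by blast
  have Om: "Omega \<in> unitary_Sp" using Sp_commuting_Omega_unitary Omega_in_Sp by blast
  \<comment> \<open>The transpose is the inverse conjugated by \<open>Omega\<close>, and
    \<open>Omega\<close> is unitary, hence in \<open>?M\<close>.\<close>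
  have transp: "transpose X \<in> ?M" if X: "X \<in> ?M" for X
  proof -
    have "transpose X = transpose Omega ** matrix_inv X ** Omega"
      by (simp add: Sp_matrix_inv(1)[OF Sp[OF X]] transpose_Omega matrix_minus_mult
          matrix_mul_assoc[symmetric] Omega_cancel) (simp add: Omega_squared matrix_minus_mult)
    moreover have Omt: "transpose Omega \<in> unitary_Sp"
      using unitary_Sp_inv_closed[OF Om] by (simp add: unitary_Sp_matrix_inv[OF Om])
    have "transpose Omega ** matrix_inv X ** Omega \<in> ?M"
      by (rule mult[OF mult[OF unitary[OF Omt] inv[OF X]] unitary[OF Om]])
    ultimately show ?thesis by simp
  qed
  have "transpose (p g) ** p g = mat 1"
  proof (rule bounded_subgroup_orthogonal[of ?M])
    show "\<And>X. X \<in> ?M \<Longrightarrow> det X \<noteq> 0" using Sp Sp_det by blast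
    show "\<And>X. X \<in> ?M \<Longrightarrow> norm X \<le> B" using B by force
    show "p g \<in> ?M" using e by blast
  qed (use mult inv transp in blast)+
  then show ?thesis using e p_in_Sp by (simp add: unitary_cover_def unitary_Sp_def)
qed

lemma compact_subgroup_stabilizer:
  assumes sub: "subgroup L E" and L: "compactin TE L" "stabilizer E act H \<subseteq> L"
  shows "L \<subseteq> stabilizer E act H"
proof
  fix e assume e: "e \<in> L"
  then obtain g a where g: "e = cls g a" "g \<in> carrier G"
    using subgroup.subset[OF sub] by (auto simp: carrier_E)
  have gU: "g \<in> unitary_cover" using compact_subgroup_unitary[OF sub L] e g by blast
  obtain \<psi> where \<psi>: "continuous_map TQ euclideanreal \<psi>" "\<And>a. \<psi> (rot_coset a) = a" by (rule rot_coset_level) (rule that)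
  \<comment> \<open>The total angle: a central \<open>z\<close> adds \<open>level z\<close> to the
    first term and removes it from the second.\<close>
  define f where "f = (\<lambda>y. level (fst y) + \<psi> (snd y))"
  have "continuous_map (top_of_set (carrier G)) euclideanreal level"
    using continuous_on_carrier_angle by (simp, intro continuous_intros) auto
  then have "continuous_map TD euclideanreal (level \<circ> fst)" "continuous_map TD euclideanreal (\<psi> \<circ> snd)"
    using \<psi>(1) continuous_map_compose continuous_map_fst continuous_map_snd by blast+
  then have "continuous_map TD euclideanreal f" unfolding f_def o_def by (rule continuous_map_add)
  then obtain B where B: "\<And>g a. g \<in> carrier G \<Longrightarrow> cls g a \<in> L \<Longrightarrow> \<bar>f (g, rot_coset a)\<bar> \<le> B"
    by (rule continuous_map_bounded_on_compact[OF _ _ L(1)]) (auto simp: f_def \<psi> level_center_mult)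
  define b where "b = level g + a"
  \<comment> \<open>Since \<open>g\<close> lies over U(n), the total angle of the k-th power is
    \<open>k\<close> times that of \<open>g\<close>; boundedness on \<open>L\<close> then leaves
    only 0.\<close>
  have pow: "cls (g [^] k) (real k * a) \<in> L \<and> level (g [^] k) = real k * level g" for k :: nat
  proof (induction k)
    case 0
    show ?case using subgroup.one_closed[OF sub] by (simp add: one_E angle_one)
  next
    case (Suc k)
    have "cls (g \<otimes> g [^] k) (a + real k * a) \<in> L"
      using subgroup.m_closed[OF sub e] Suc g by (metis mult_E nat_pow_closed)
    moreover have "level (g \<otimes> g [^] k) = level g + level (g [^] k)"
      using gU g by (simp add: angle_mult unitary_cover_def add_divide_distrib)
    moreover have "g [^] Suc k = g \<otimes> g [^] k" by (rule nat_pow_Suc2[OF g(2)])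
    moreover have "real (Suc k) * x = x + real k * x" for x by (simp add: algebra_simps)
    ultimately show ?case using Suc by (simp only:)
  qed
  have bound: "real k * \<bar>b\<bar> \<le> B" for k :: nat
  proof -
    have "f (g [^] k, rot_coset (real k * a)) = real k * b"
      unfolding f_def fst_conv snd_conv \<psi>(2) b_def distrib_left using pow[of k] by argo
    then show ?thesis
      using B[of "g [^] k" "real k * a"] pow[of k] g(2) by (simp add: abs_mult)
  qed
  have "b = 0"
  proof (rule ccontr)
    assume "b \<noteq> 0"
    then obtain k :: nat where "B < real k * \<bar>b\<bar>" using reals_Archimedean3[of "\<bar>b\<bar>"] by auto
    then show False using bound[of k] by simp
  qed
  define c where "c = level g"
  have "a = - c" using \<open>b = 0\<close> by (simp add: b_def c_def)
  obtain h where h: "h \<in> H" "g = h \<otimes> rot c" using unitary_cover_decomp[OF gU] unfolding c_def by blast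
  have "g \<otimes> rot a = h"
    using H_carrier[OF h(1)] by (simp add: h(2) \<open>a = - c\<close> rot_minus m_assoc)
  then show "e \<in> stabilizer E act H" using g h unfolding stabilizer_eq by blast
qed

theorem maximal_compact_stabilizer: "maximal_compact_subgroup E TE (stabilizer E act H)"
  unfolding maximal_compact_subgroup_def compact_subgroup_def
  using compact_stabilizer compact_subgroup_stabilizer group_action.stabilizer_subgroup[OF group_action_E H_in_X]
  by blast

end

theorem lemma3p12:
  fixes G :: "'g::topological_space monoid"
    and p :: "'g \<Rightarrow> real^('n::finite + 'n)^('n + 'n)"
  assumes "CARD('n) \<ge> 2"
    and "universal_covering_of_Sp G p"
  shows "group_action (grpE G p) (spaceX G p) (actE G p) \<and>
    (\<forall>g \<in> carrier G. \<forall>r \<in> grpR G p. \<forall>x \<in> carrier G.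
       actE G p (classE G p (g, r <#\<^bsub>G\<^esub> grpH G p)) (x <#\<^bsub>G\<^esub> grpH G p)
         = (g \<otimes>\<^bsub>G\<^esub> x \<otimes>\<^bsub>G\<^esub> r) <#\<^bsub>G\<^esub> grpH G p) \<and>
    maximal_compact_subgroup (grpE G p) (grpE_topology G p)
      (stabilizer (grpE G p) (actE G p) (grpH G p))"
proof -
  interpret Sp_cover G p using assms(2) by unfold_locales
  show ?thesis using group_action_E act_coset maximal_compact_stabilizer by blast
qed

end
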